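(* For any fixed $0\le n\le T$ and any admissible $(A,C)$ (with $A$ of size $n+1$), in the general coding structure with the optimal feedback generator and its associated estimation system (see context), it holds that: (i) $$I(W;y^T)=\tfrac12\log\det K_e^{(T)}=\tfrac12\sum_{t=0}^T\log K_{e,t}=\tfrac12\sum_{t=0}^T\log(\mathbb C\Sigma_t\mathbb C'+1)=\tfrac12\log\det \mathrm{MMSE}_{W,T}^{-1}=\tfrac12\log\det\mathcal I_{W,T}=\tfrac12\log\det\mathrm{CRB}_{W,T}^{-1};$$ (ii) $$P_{T,n}(A,C)=\frac1{T+1}\sum_{t=0}^T\mathbb D\Sigma_t\mathbb D'=\frac1{T+1}\mathrm{trace}(\mathrm{CMMSE}_{r,T})=\frac1{T+1}\sum_{t=0}^TCA^t\,\mathrm{MMSE}_{W,t}\,(A^t)'C'.$$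
   Context: Conventions. $'$ denotes transpose, $x^T$ denotes the stacked column vector of $x_0,\dots,x_T$, $\log$ is to base 2. Channel. $\mathcal Z(z)$ is a single-input single-output finite-dimensional LTI transfer function, stable and minimum phase, with $\mathcal Z(\infty)=1$. $\mathcal Z_T$ is the $(T+1)\times(T+1)$ lower-triangular Toeplitz matrix of its impulse response. $\mathcal Z^{-1}$ has minimal realization $(F,G,H,1)$ with $F\in\mathbb R^{m\times m}$ stable, $m\ge1$. $\{N_t\}$ is white Gaussian noise, zero mean, unit variance. The channel $\mathcal F$ is $s_{t+1}=Fs_t+Gu_t$, $y_t=Hs_t+u_t+N_t$, $s_0=0$, i.e. $y^T=\mathcal Z_T^{-1}u^T+N^T$. General coding structure. $W\sim\mathcal N(0,I_{n+1})$ independent of the noise; $x_0=W$, $x_{t+1}=Ax_t$, $r_t=Cx_t$, $u_t=r_t-\hat r_t$, $-\hat r^T=\mathcal G_Ty^T$ with $\mathcal G_T$ strictly lower triangular; admissible $(A,C)$ means $A\in\mathbb R^{(n+1)\times(n+1)}$, $C\in\mathbb R^{1\times(n+1)}$, $(A,C)$ observable, and no eigenvalue of $A$ on the unit circle or equal to an eigenvalue of $F$. The feedback generator is chosen as the optimal one $\mathcal G_T^*(A,C)$, i.e. the one minimizing $\frac1{T+1}\mathbf E(u^T)'u^T$ for the given $(A,C)$; $P_{T,n}(A,C)$ is the resulting value of $\frac1{T+1}\mathbf E(u^T)'u^T$. In state space it is $\hat s_{t+1}=F\hat s_t+L_{2,t}e_t$, $e_t=y_t-H\hat s_t$, $\hat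 x_{t+1}=A\hat x_t+L_{1,t}e_t$, $\hat r_t=C\hat x_t$, $\hat s_0=0,\hat x_0=0$, with $$\begin{bmatrix}L_{1,t} \\ L_{2,t}\end{bmatrix}=\frac{\mathbb A\Sigma_t\mathbb C'}{\mathbb C\Sigma_t\mathbb C'+1},\quad \Sigma_{t+1}=\mathbb A\Sigma_t\mathbb A'-\frac{\mathbb A\Sigma_t\mathbb C'\mathbb C\Sigma_t\mathbb A'}{\mathbb C\Sigma_t\mathbb C'+1},\quad\Sigma_0=\begin{bmatrix}I_{n+1} & 0 \\ 0 & 0\end{bmatrix},$$ $\mathbb A=\begin{bmatrix}A & 0 \\ G C & F\end{bmatrix}$, $\mathbb C=[C\ \ H]$, $\mathbb D=[C\ \ 0]$. $\{e_t\}$ is the innovations process, $K_e^{(T)}$ is the covariance matrix of $e^T$, and $K_{e,t}=\mathbf E e_t^2$. Estimation system (no feedback). The source $r_t=CA^tW$ is sent over the channel without feedback, giving $\bar y^T=\mathcal Z_T^{-1}r^T+N^T$, and is estimated by the Kalman filter; the Kalman filter's estimates of $x_t$ and $r_t$ and its innovations coincide with the $\hat x_t$, $\hat r_t$, $e_t$ above. $\mathrm{MMSE}_{W,T}$ is the minimum mean-squared error matrix of $W$ in this estimation system with observations $\bar y^T$, and $\mathrm{MMSE}_{W,t}$ is the same quantity with $t$ in place of $T$. $\mathrm{CMMSE}_{r,T}$ is the causal minimum MSE matrix of $r^T$, i.e. the covariance matrix of the error $r^T-\hat r^T$ of the Kalman filter. $\mathcal I_{W,T}$ is the Bayesian Fisher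 information matrix of $W$ for the estimation system, $\mathbf E[\nabla_W\ln p(\bar y^T,W)\,(\nabla_W\ln p(\bar y^T,W))']$, and $\mathrm{CRB}_{W,T}=\mathcal I_{W,T}^{-1}$ is the Bayesian Cramer-Rao bound of $W$.
   Formalization: In the last expression of (ii), MMSE_{W,t} is taken given only the observations at times before t (none for t=0) rather than up to time t; as stated the equality is false, e.g. for T=n=0, C=c it would read c²=c²/(1+c²). *)

theory Defs
  imports
    "HOL-Probability.Probability"
    "Jordan_Normal_Form.Determinant"
    "Jordan_Normal_Form.Gauss_Jordan_Elimination"
    "Jordan_Normal_Form.Char_Poly"
begin

no_notation Finite_Cartesian_Product.vec_nth (infixl \<open>$\<close> 90)
no_notation Inner_Product.real_inner_class.inner (infix \<open>\<bullet>\<close> 70)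
hide_const (open) Finite_Cartesian_Product.vec Finite_Cartesian_Product.transpose
  Finite_Cartesian_Product.mat Determinants.det

text \<open>The inverse of an invertible square matrix; unspecified otherwise.\<close>

definition mat_inv :: "'a::field mat \<Rightarrow> 'a mat" where
  "mat_inv A = the (mat_inverse A)"

definition mat_trace :: "'a::comm_monoid_add mat \<Rightarrow> 'a" where
  "mat_trace A = (\<Sum>i<dim_row A. A $$ (i, i))"

definition beside :: "'a::zero mat \<Rightarrow> 'a mat \<Rightarrow> 'a mat" where
  "beside A B = four_block_mat A B (0\<^sub>m 0 (dim_col A)) (0\<^sub>m 0 (dim_col B))"

definition strictly_lower_triangular :: "nat \<Rightarrow> real mat \<Rightarrow> bool" where
  "strictly_lower_triangular k K \<longleftrightarrow>
     K \<in> carrier_mat k k \<and> (\<forall>i<k. \<forall>j<k. i \<le> j \<longrightarrow> K $$ (i, j) = 0)"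

abbreviation cmat :: "real mat \<Rightarrow> complex mat" where
  "cmat \<equiv> map_mat complex_of_real"

text \<open>A finite-dimensional single-input single-output transfer function is a ratio of
  two real polynomials.\<close>

definition transfer :: "real poly \<Rightarrow> real poly \<Rightarrow> complex \<Rightarrow> complex" where
  "transfer num den z =
     poly (map_poly complex_of_real num) z / poly (map_poly complex_of_real den) z"

definition schur_stable_poly :: "real poly \<Rightarrow> bool" where
  "schur_stable_poly p \<longleftrightarrow> (\<forall>z. poly (map_poly complex_of_real p) z = 0 \<longrightarrow> cmod z < 1)"

definition stable_mat :: "real mat \<Rightarrow> bool" where
  "stable_mat F \<longleftrightarrow> (\<forall>z. eigenvalue (cmat F) z \<longrightarrow> cmod z < 1)"

text \<open>Two rational functions that agree near infinity are equal, so it suffices to compare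
  there; this avoids the points where one side has a pole.\<close>

definition realizes ::
    "nat \<Rightarrow> real mat \<Rightarrow> real mat \<Rightarrow> real mat \<Rightarrow> real \<Rightarrow> (complex \<Rightarrow> complex) \<Rightarrow> bool" where
  "realizes m F G H d Z \<longleftrightarrow>
     F \<in> carrier_mat m m \<and> G \<in> carrier_mat m 1 \<and> H \<in> carrier_mat 1 m \<and>
     (\<forall>\<^sub>F z in at_infinity.
        Z z = complex_of_real d + (cmat H * mat_inv (z \<cdot>\<^sub>m 1\<^sub>m m - cmat F) * cmat G) $$ (0, 0))"

definition minimal_realization ::
    "nat \<Rightarrow> real mat \<Rightarrow> real mat \<Rightarrow> real mat \<Rightarrow> real \<Rightarrow> (complex \<Rightarrow> complex) \<Rightarrow> bool" where
  "minimal_realization m F G H d Z \<longleftrightarrow>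
     realizes m F G H d Z \<and> (\<forall>m' F' G' H' d'. realizes m' F' G' H' d' Z \<longrightarrow> m \<le> m')"

text \<open>By coprimality the poles and zeros of \<open>num / den\<close> are the roots of \<open>den\<close> and \<open>num\<close>, so
  the two conditions on roots say that it is stable and minimum phase.\<close>

definition channel_model ::
    "real poly \<Rightarrow> real poly \<Rightarrow> nat \<Rightarrow> real mat \<Rightarrow> real mat \<Rightarrow> real mat \<Rightarrow> bool" where
  "channel_model num den m F G H \<longleftrightarrow>
     den \<noteq> 0 \<and> coprime num den \<and> schur_stable_poly den \<and> schur_stable_poly num \<and>
     (transfer num den \<longlongrightarrow> 1) at_infinity \<and>
     1 \<le> m \<and> minimal_realization m F G H 1 (\<lambda>z. inverse (transfer num den z)) \<and>
     stable_mat F"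

definition observable :: "real mat \<Rightarrow> real mat \<Rightarrow> bool" where
  "observable A C \<longleftrightarrow>
     (\<forall>x\<in>carrier_vec (dim_row A). (\<forall>t. (C * A ^\<^sub>m t) *\<^sub>v x = 0\<^sub>v (dim_row C)) \<longrightarrow>
        x = 0\<^sub>v (dim_row A))"

definition admissible :: "nat \<Rightarrow> real mat \<Rightarrow> real mat \<Rightarrow> real mat \<Rightarrow> bool" where
  "admissible n F A C \<longleftrightarrow>
     A \<in> carrier_mat (n + 1) (n + 1) \<and> C \<in> carrier_mat 1 (n + 1) \<and> observable A C \<and>
     (\<forall>z. eigenvalue (cmat A) z \<longrightarrow> cmod z \<noteq> 1 \<and> \<not> eigenvalue (cmat F) z)"

primrec src_state :: "real mat \<Rightarrow> real vec \<Rightarrow> nat \<Rightarrow> real vec" where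
  "src_state A w 0 = w"
| "src_state A w (Suc t) = A *\<^sub>v src_state A w t"

definition src_out :: "real mat \<Rightarrow> real mat \<Rightarrow> real vec \<Rightarrow> nat \<Rightarrow> real" where
  "src_out A C w t = (C *\<^sub>v src_state A w t) $ 0"

primrec ch_state :: "real mat \<Rightarrow> real mat \<Rightarrow> (nat \<Rightarrow> real) \<Rightarrow> nat \<Rightarrow> real vec" where
  "ch_state F G u 0 = 0\<^sub>v (dim_row F)"
| "ch_state F G u (Suc t) = F *\<^sub>v ch_state F G u t + u t \<cdot>\<^sub>v col G 0"

definition ch_out ::
    "real mat \<Rightarrow> real mat \<Rightarrow> real mat \<Rightarrow> (nat \<Rightarrow> real) \<Rightarrow> (nat \<Rightarrow> real) \<Rightarrow> nat \<Rightarrow> real" where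
  "ch_out F G H u v t = (H *\<^sub>v ch_state F G u t) $ 0 + u t + v t"

lemma ch_state_cong:
  "(\<And>i. i < t \<Longrightarrow> u i = u' i) \<Longrightarrow> ch_state F G u t = ch_state F G u' t"
  by (induction t) auto

lemma ch_out_cong [fundef_cong]:
  assumes "F = F'" "G = G'" "H = H'" "v = v'" "t = t'" "\<And>i. i \<le> t' \<Longrightarrow> u i = u' i"
  shows "ch_out F G H u v t = ch_out F' G' H' u' v' t'"
  using assms ch_state_cong[of t' u u' F' G'] by (simp add: ch_out_def)

text \<open>Closed loop: \<open>u = r + K y\<close>, where \<open>y\<close> is the channel response to \<open>u\<close>.  The generator
  \<open>K\<close> is strictly lower triangular, so only past outputs enter.\<close>

fun fb_in :: "real mat \<Rightarrow> real mat \<Rightarrow> real mat \<Rightarrow> real mat \<Rightarrow>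
    (nat \<Rightarrow> real) \<Rightarrow> (nat \<Rightarrow> real) \<Rightarrow> nat \<Rightarrow> real" where
  "fb_in F G H K r v t =
     r t + (\<Sum>j<t. K $$ (t, j) * ch_out F G H (\<lambda>i. fb_in F G H K r v i) v j)"

declare fb_in.simps [simp del]

text \<open>A random vector or process is a family of real random variables indexed by naturals.\<close>

definition rvec :: "nat set \<Rightarrow> (nat \<Rightarrow> 'a \<Rightarrow> real) \<Rightarrow> 'a \<Rightarrow> nat \<Rightarrow> real" where
  "rvec I X \<omega> = (\<lambda>i\<in>I. X i \<omega>)"

definition cov_mat :: "'a measure \<Rightarrow> nat \<Rightarrow> (nat \<Rightarrow> 'a \<Rightarrow> real) \<Rightarrow> real mat" where
  "cov_mat M k X = Matrix.mat k k (\<lambda>(i, j).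
     integral\<^sup>L M (\<lambda>\<omega>. (X i \<omega> - integral\<^sup>L M (X i)) * (X j \<omega> - integral\<^sup>L M (X j))))"

definition src_proc ::
    "real mat \<Rightarrow> real mat \<Rightarrow> (nat \<Rightarrow> 'a \<Rightarrow> real) \<Rightarrow> nat \<Rightarrow> 'a \<Rightarrow> real" where
  "src_proc A C W t \<omega> = src_out A C (Matrix.vec (dim_row A) (\<lambda>i. W i \<omega>)) t"

definition in_proc ::
    "real mat \<Rightarrow> real mat \<Rightarrow> real mat \<Rightarrow> real mat \<Rightarrow> real mat \<Rightarrow> real mat \<Rightarrow>
     (nat \<Rightarrow> 'a \<Rightarrow> real) \<Rightarrow> (nat \<Rightarrow> 'a \<Rightarrow> real) \<Rightarrow> nat \<Rightarrow> 'a \<Rightarrow> real" where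
  "in_proc F G H A C K W N t \<omega> =
     fb_in F G H K (\<lambda>i. src_proc A C W i \<omega>) (\<lambda>i. N i \<omega>) t"

definition out_proc ::
    "real mat \<Rightarrow> real mat \<Rightarrow> real mat \<Rightarrow> real mat \<Rightarrow> real mat \<Rightarrow> real mat \<Rightarrow>
     (nat \<Rightarrow> 'a \<Rightarrow> real) \<Rightarrow> (nat \<Rightarrow> 'a \<Rightarrow> real) \<Rightarrow> nat \<Rightarrow> 'a \<Rightarrow> real" where
  "out_proc F G H A C K W N t \<omega> =
     ch_out F G H (\<lambda>i. in_proc F G H A C K W N i \<omega>) (\<lambda>i. N i \<omega>) t"

definition nofb_out_proc ::
    "real mat \<Rightarrow> real mat \<Rightarrow> real mat \<Rightarrow> real mat \<Rightarrow> real mat \<Rightarrow>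
     (nat \<Rightarrow> 'a \<Rightarrow> real) \<Rightarrow> (nat \<Rightarrow> 'a \<Rightarrow> real) \<Rightarrow> nat \<Rightarrow> 'a \<Rightarrow> real" where
  "nofb_out_proc F G H A C W N t \<omega> =
     ch_out F G H (\<lambda>i. src_proc A C W i \<omega>) (\<lambda>i. N i \<omega>) t"

definition avg_power ::
    "'a measure \<Rightarrow> real mat \<Rightarrow> real mat \<Rightarrow> real mat \<Rightarrow> real mat \<Rightarrow> real mat \<Rightarrow>
     (nat \<Rightarrow> 'a \<Rightarrow> real) \<Rightarrow> (nat \<Rightarrow> 'a \<Rightarrow> real) \<Rightarrow> nat \<Rightarrow> real mat \<Rightarrow> real" where
  "avg_power M F G H A C W N T K =
     1 / real (T + 1) * integral\<^sup>L M (\<lambda>\<omega>. \<Sum>t\<le>T. (in_proc F G H A C K W N t \<omega>)\<^sup>2)"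

definition opt_gen ::
    "'a measure \<Rightarrow> real mat \<Rightarrow> real mat \<Rightarrow> real mat \<Rightarrow> real mat \<Rightarrow> real mat \<Rightarrow>
     (nat \<Rightarrow> 'a \<Rightarrow> real) \<Rightarrow> (nat \<Rightarrow> 'a \<Rightarrow> real) \<Rightarrow> nat \<Rightarrow> real mat" where
  "opt_gen M F G H A C W N T =
     arg_min (avg_power M F G H A C W N T) (strictly_lower_triangular (T + 1))"

definition opt_power ::
    "'a measure \<Rightarrow> real mat \<Rightarrow> real mat \<Rightarrow> real mat \<Rightarrow> real mat \<Rightarrow> real mat \<Rightarrow>
     (nat \<Rightarrow> 'a \<Rightarrow> real) \<Rightarrow> (nat \<Rightarrow> 'a \<Rightarrow> real) \<Rightarrow> nat \<Rightarrow> real" where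
  "opt_power M F G H A C W N T =
     avg_power M F G H A C W N T (opt_gen M F G H A C W N T)"

definition opt_out ::
    "'a measure \<Rightarrow> real mat \<Rightarrow> real mat \<Rightarrow> real mat \<Rightarrow> real mat \<Rightarrow> real mat \<Rightarrow>
     (nat \<Rightarrow> 'a \<Rightarrow> real) \<Rightarrow> (nat \<Rightarrow> 'a \<Rightarrow> real) \<Rightarrow> nat \<Rightarrow> nat \<Rightarrow> 'a \<Rightarrow> real" where
  "opt_out M F G H A C W N T = out_proc F G H A C (opt_gen M F G H A C W N T) W N"

definition AA :: "real mat \<Rightarrow> real mat \<Rightarrow> real mat \<Rightarrow> real mat \<Rightarrow> real mat" where
  "AA F G A C = four_block_mat A (0\<^sub>m (dim_row A) (dim_row F)) (G * C) F"

definition CC :: "real mat \<Rightarrow> real mat \<Rightarrow> real mat" where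
  "CC H C = beside C H"

definition DD :: "real mat \<Rightarrow> real mat \<Rightarrow> real mat" where
  "DD F C = beside C (0\<^sub>m 1 (dim_row F))"

primrec kf_cov ::
    "real mat \<Rightarrow> real mat \<Rightarrow> real mat \<Rightarrow> real mat \<Rightarrow> real mat \<Rightarrow> nat \<Rightarrow> real mat" where
  "kf_cov F G H A C 0 =
     four_block_mat (1\<^sub>m (dim_row A)) (0\<^sub>m (dim_row A) (dim_row F))
       (0\<^sub>m (dim_row F) (dim_row A)) (0\<^sub>m (dim_row F) (dim_row F))"
| "kf_cov F G H A C (Suc t) =
     (let S = kf_cov F G H A C t; a = AA F G A C; c = CC H C in
        a * S * a\<^sup>T - (1 / ((c * S * c\<^sup>T) $$ (0, 0) + 1)) \<cdot>\<^sub>m (a * S * c\<^sup>T * c * S * a\<^sup>T))"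

definition kf_gain ::
    "real mat \<Rightarrow> real mat \<Rightarrow> real mat \<Rightarrow> real mat \<Rightarrow> real mat \<Rightarrow> nat \<Rightarrow> real vec" where
  "kf_gain F G H A C t =
     (let S = kf_cov F G H A C t; a = AA F G A C; c = CC H C in
        (1 / ((c * S * c\<^sup>T) $$ (0, 0) + 1)) \<cdot>\<^sub>v col (a * S * c\<^sup>T) 0)"

text \<open>Estimate of the channel state in the closed loop, driven by the output path \<open>y\<close>; its gain
  is the lower block of the Kalman gain.\<close>

primrec loop_est ::
    "real mat \<Rightarrow> real mat \<Rightarrow> real mat \<Rightarrow> real mat \<Rightarrow> real mat \<Rightarrow> (nat \<Rightarrow> real) \<Rightarrow> nat \<Rightarrow> real vec" where
  "loop_est F G H A C y 0 = 0\<^sub>v (dim_row F)"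
| "loop_est F G H A C y (Suc t) =
     F *\<^sub>v loop_est F G H A C y t +
     (y t - (H *\<^sub>v loop_est F G H A C y t) $ 0) \<cdot>\<^sub>v vec_last (kf_gain F G H A C t) (dim_row F)"

definition innov ::
    "'a measure \<Rightarrow> real mat \<Rightarrow> real mat \<Rightarrow> real mat \<Rightarrow> real mat \<Rightarrow> real mat \<Rightarrow>
     (nat \<Rightarrow> 'a \<Rightarrow> real) \<Rightarrow> (nat \<Rightarrow> 'a \<Rightarrow> real) \<Rightarrow> nat \<Rightarrow> nat \<Rightarrow> 'a \<Rightarrow> real" where
  "innov M F G H A C W N T t \<omega> =
     opt_out M F G H A C W N T t \<omega> -
     (H *\<^sub>v loop_est F G H A C (\<lambda>i. opt_out M F G H A C W N T i \<omega>) t) $ 0"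

text \<open>Kalman filter of the system without feedback: one-step prediction of the joint state of
  source and channel from the output path \<open>y\<close>.\<close>

primrec kf_est ::
    "real mat \<Rightarrow> real mat \<Rightarrow> real mat \<Rightarrow> real mat \<Rightarrow> real mat \<Rightarrow> (nat \<Rightarrow> real) \<Rightarrow> nat \<Rightarrow> real vec" where
  "kf_est F G H A C y 0 = 0\<^sub>v (dim_row A + dim_row F)"
| "kf_est F G H A C y (Suc t) =
     AA F G A C *\<^sub>v kf_est F G H A C y t +
     (y t - (CC H C *\<^sub>v kf_est F G H A C y t) $ 0) \<cdot>\<^sub>v kf_gain F G H A C t"

definition src_est ::
    "real mat \<Rightarrow> real mat \<Rightarrow> real mat \<Rightarrow> real mat \<Rightarrow> real mat \<Rightarrow>
     (nat \<Rightarrow> 'a \<Rightarrow> real) \<Rightarrow> (nat \<Rightarrow> 'a \<Rightarrow> real) \<Rightarrow> nat \<Rightarrow> 'a \<Rightarrow> real" where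
  "src_est F G H A C W N t \<omega> =
     (DD F C *\<^sub>v kf_est F G H A C (\<lambda>i. nofb_out_proc F G H A C W N i \<omega>) t) $ 0"

definition CMMSE ::
    "'a measure \<Rightarrow> real mat \<Rightarrow> real mat \<Rightarrow> real mat \<Rightarrow> real mat \<Rightarrow> real mat \<Rightarrow>
     (nat \<Rightarrow> 'a \<Rightarrow> real) \<Rightarrow> (nat \<Rightarrow> 'a \<Rightarrow> real) \<Rightarrow> nat \<Rightarrow> real mat" where
  "CMMSE M F G H A C W N T =
     cov_mat M (T + 1) (\<lambda>t \<omega>. src_proc A C W t \<omega> - src_est F G H A C W N t \<omega>)"

text \<open>Minimum mean-squared error matrix of the vector \<open>X 0, \<dots>, X (k - 1)\<close> given the
  observations \<open>Y t\<close>, \<open>t \<in> I\<close>: the error covariance of the conditional mean.  The set of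
  observation times is an explicit argument because two of them occur: the mutual information
  involves the observations at times \<open>{..T}\<close>, whereas \<open>src_est\<close> at time \<open>t\<close> is a one-step
  prediction, whose error is governed by the observations at times \<open>{..<t}\<close> (none for \<open>t = 0\<close>).\<close>

definition obs_algebra :: "'a measure \<Rightarrow> nat set \<Rightarrow> (nat \<Rightarrow> 'a \<Rightarrow> real) \<Rightarrow> 'a measure" where
  "obs_algebra M I Y = vimage_algebra (space M) (rvec I Y) (Pi\<^sub>M I (\<lambda>_. borel))"

definition mmse_mat ::
    "'a measure \<Rightarrow> nat \<Rightarrow> (nat \<Rightarrow> 'a \<Rightarrow> real) \<Rightarrow> nat set \<Rightarrow> (nat \<Rightarrow> 'a \<Rightarrow> real) \<Rightarrow> real mat" where
  "mmse_mat M k X I Y = Matrix.mat k k (\<lambda>(i, j). integral\<^sup>L M (\<lambda>\<omega>.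
     (X i \<omega> - real_cond_exp M (obs_algebra M I Y) (X i) \<omega>) *
     (X j \<omega> - real_cond_exp M (obs_algebra M I Y) (X j) \<omega>)))"

text \<open>A version of the joint density of \<open>(Y 0, \<dots>, Y T)\<close> and \<open>(W 0, \<dots>, W n)\<close> whose logarithm
  has partial derivatives in the second argument.  Two such versions have almost surely the same
  gradient, so the choice made below is immaterial.\<close>

definition joint_density ::
    "'a measure \<Rightarrow> nat \<Rightarrow> nat \<Rightarrow> (nat \<Rightarrow> 'a \<Rightarrow> real) \<Rightarrow> (nat \<Rightarrow> 'a \<Rightarrow> real) \<Rightarrow>
     ((nat \<Rightarrow> real) \<times> (nat \<Rightarrow> real) \<Rightarrow> real) \<Rightarrow> bool" where
  "joint_density M T n Y W p \<longleftrightarrow>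
     distributed M (Pi\<^sub>M {..T} (\<lambda>_. lborel) \<Otimes>\<^sub>M Pi\<^sub>M {..n} (\<lambda>_. lborel))
       (\<lambda>\<omega>. (rvec {..T} Y \<omega>, rvec {..n} W \<omega>)) (\<lambda>z. ennreal (p z)) \<and>
     (\<forall>y\<in>space (Pi\<^sub>M {..T} (\<lambda>_. lborel)). \<forall>w\<in>space (Pi\<^sub>M {..n} (\<lambda>_. lborel)).
        0 < p (y, w) \<and> (\<forall>i\<le>n. (\<lambda>x. p (y, w(i := x))) differentiable (at (w i))))"

definition score ::
    "((nat \<Rightarrow> real) \<times> (nat \<Rightarrow> real) \<Rightarrow> real) \<Rightarrow> nat \<Rightarrow> (nat \<Rightarrow> real) \<Rightarrow> (nat \<Rightarrow> real) \<Rightarrow> real" where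
  "score p i y w = deriv (\<lambda>x. ln (p (y, w(i := x)))) (w i)"

definition fisher_mat ::
    "'a measure \<Rightarrow> nat \<Rightarrow> nat \<Rightarrow> (nat \<Rightarrow> 'a \<Rightarrow> real) \<Rightarrow> (nat \<Rightarrow> 'a \<Rightarrow> real) \<Rightarrow> real mat" where
  "fisher_mat M T n Y W =
     (let p = (SOME p. joint_density M T n Y W p) in
        Matrix.mat (n + 1) (n + 1) (\<lambda>(i, j). integral\<^sup>L M (\<lambda>\<omega>.
          score p i (rvec {..T} Y \<omega>) (rvec {..n} W \<omega>) *
          score p j (rvec {..T} Y \<omega>) (rvec {..n} W \<omega>))))"

definition crb_mat ::
    "'a measure \<Rightarrow> nat \<Rightarrow> nat \<Rightarrow> (nat \<Rightarrow> 'a \<Rightarrow> real) \<Rightarrow> (nat \<Rightarrow> 'a \<Rightarrow> real) \<Rightarrow> real mat" where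
  "crb_mat M T n Y W = mat_inv (fisher_mat M T n Y W)"

end

theory Submission
  imports Defs
begin

text \<open>There is no process noise, so the state of the channel without feedback is a linear image
  \<open>Psi t\<close> of the constant \<open>W\<close>, and \<open>ybar t = g t \<bullet> W + N t\<close>.  The Kalman filter is therefore
  recursive least squares for \<open>W\<close>: \<open>\<Sigma> t = Psi t * P t * (Psi t)\<^sup>T\<close>, where \<open>P t\<close> is the inverse of
  \<open>J t = 1 + (\<Sum>s<t. g s (g s)\<^sup>T)\<close>, and the matrix determinant lemma gives
  \<open>det (J t) = (\<Prod>s<t. K s)\<close> with \<open>K s\<close> the innovation variances.  Completing the square in the joint
  density identifies the conditional mean of \<open>W\<close> (whose error covariance is \<open>P t\<close>) and shows that the
  observations have the density of independent innovations, from which the mutual information is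
  read off; \<open>J\<close> is also the Fisher information.

  For every feedback generator the outputs, the outputs without feedback and the innovations
  determine each other by unit lower triangular linear maps.  These preserve Lebesgue measure, so
  feedback does not change the mutual information, and the channel input is the prediction error
  of \<open>r\<close> plus a combination of past innovations, which is orthogonal to it.  Hence the optimal
  generator is the one that feeds back the prediction of \<open>r\<close>.\<close>

section \<open>Unit triangular maps and Lebesgue measure\<close>

text \<open>\<open>opt_gen\<close> is a choice of minimiser and \<open>fisher_mat\<close> uses a
  choice of density, so neither can be taken to be a preferred object. Minimal power forces the
  closed-loop input to equal the prediction error at every sample point up to time \<open>T\<close>;
  this fixes inputs and outputs without deciding whether the generator is unique. Two densities are
  compared almost everywhere. Statements about laws come from explicit densities and
  measure-preserving maps, statements about power and covariance from inner products of
  square-integrable variables, and the completed square links the two. One index shift runs through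
  the whole argument: \<open>P t\<close> belongs to the \<open>t\<close> observations before time
  \<open>t\<close>. The power at time \<open>t\<close> therefore involves \<open>P t\<close>, while
  the information after time \<open>T\<close> involves \<open>J (Suc T)\<close>.\<close>

abbreviation lborel_pow :: "nat \<Rightarrow> (nat \<Rightarrow> real) measure" where
  "lborel_pow k \<equiv> Pi\<^sub>M {..<k} (\<lambda>_. lborel)"

interpretation lborel_pow: product_sigma_finite "\<lambda>_::nat. lborel :: real measure"
  by standard

lemma sigma_finite_lborel_pow: "sigma_finite_measure (lborel_pow k)"
  by (rule lborel_pow.sigma_finite) simp

text \<open>One family covers all changes of variables: \<open>\<sigma> = 1\<close> with
  \<open>c = 0\<close> is a translation, \<open>\<sigma> = -1\<close> with \<open>c = 0\<close> a
  reflection about half the offset, and \<open>\<sigma> = 1\<close> with \<open>a = 0\<close> a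
  causal unit triangular map.\<close>

definition tri_map ::
    "nat \<Rightarrow> real \<Rightarrow> (nat \<Rightarrow> real) \<Rightarrow> (nat \<Rightarrow> nat \<Rightarrow> real) \<Rightarrow> (nat \<Rightarrow> real) \<Rightarrow> nat \<Rightarrow> real" where
  "tri_map k \<sigma> a c v = (\<lambda>t\<in>{..<k}. \<sigma> * v t + (a t + (\<Sum>s<t. c t s * v s)))"

lemma measurable_tri_map:
  assumes [measurable]: "\<And>t. t < k \<Longrightarrow> a t \<in> borel_measurable S"
    and v[measurable]: "v \<in> measurable S (lborel_pow k)"
  shows "(\<lambda>x. tri_map k \<sigma> (\<lambda>t. a t x) c (v x)) \<in> measurable S (lborel_pow k)"
proof -
  have "(\<lambda>x. v x s) \<in> borel_measurable S" if "s < k" for s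
    using measurable_compose[OF v, of "\<lambda>x. x s" lborel] that by simp
  then show ?thesis
    unfolding tri_map_def by (intro measurable_restrict) auto
qed

lemma measurable_tri_map'[measurable]:
  "tri_map k \<sigma> a c \<in> measurable (lborel_pow k) (lborel_pow k)"
  using measurable_tri_map[of k "\<lambda>t _. a t" "lborel_pow k" "\<lambda>x. x"] by simp

text \<open>The last output is affine in the last input with slope \<open>\<sigma>\<close>, and the
  earlier outputs ignore that input. For fixed earlier coordinates the affine map preserves the
  one-dimensional integral, which leaves the same problem one dimension lower.\<close>

lemma nn_integral_tri_map:
  assumes \<sigma>: "\<bar>\<sigma>\<bar> = 1" and "f \<in> borel_measurable (lborel_pow k)"
  shows "(\<integral>\<^sup>+v. f (tri_map k \<sigma> a c v) \<partial>lborel_pow k) = (\<integral>\<^sup>+v. f v \<partial>lborel_pow k)"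
  using assms(2)
proof (induction k arbitrary: f)
  case 0
  show ?case
    by (rule nn_integral_cong) (auto simp: tri_map_def space_PiM)
next
  case (Suc k)
  note Suc.prems[measurable]
  have ins: "{..<Suc k} = insert k {..<k}" by auto
  have f[measurable]: "f \<in> borel_measurable (Pi\<^sub>M (insert k {..<k}) (\<lambda>_. lborel))"
    using Suc.prems unfolding ins .
  have [measurable]: "tri_map (Suc k) \<sigma> a c \<in>
      measurable (Pi\<^sub>M (insert k {..<k}) (\<lambda>_. lborel)) (Pi\<^sub>M (insert k {..<k}) (\<lambda>_. lborel))"
    using measurable_tri_map'[of "Suc k"] unfolding ins .
  have split: "tri_map (Suc k) \<sigma> a c (v(k := x)) =
      (tri_map k \<sigma> a c v)(k := (a k + (\<Sum>s<k. c k s * v s)) + \<sigma> * x)" for v x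
    by (rule ext) (auto simp: tri_map_def restrict_def less_Suc_eq intro!: sum.cong)
  have "(\<integral>\<^sup>+v. f (tri_map (Suc k) \<sigma> a c v) \<partial>lborel_pow (Suc k)) =
      (\<integral>\<^sup>+v. \<integral>\<^sup>+x. f (tri_map (Suc k) \<sigma> a c (v(k := x))) \<partial>lborel \<partial>lborel_pow k)"
    unfolding ins by (rule lborel_pow.product_nn_integral_insert) measurable
  also have "\<dots> = (\<integral>\<^sup>+v. \<integral>\<^sup>+x. f ((tri_map k \<sigma> a c v)(k := x)) \<partial>lborel \<partial>lborel_pow k)"
  proof (rule nn_integral_cong)
    fix v assume "v \<in> space (lborel_pow k)"
    have "tri_map k \<sigma> a c v \<in> space (lborel_pow k)"
      by (simp add: tri_map_def space_PiM)
    then have [measurable]: "(\<lambda>x. f ((tri_map k \<sigma> a c v)(k := x))) \<in> borel_measurable borel"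
      using measurable_component_update[of "tri_map k \<sigma> a c v" "{..<k}" "\<lambda>_. lborel" k]
      by (auto intro: measurable_compose[OF _ f])
    show "(\<integral>\<^sup>+x. f (tri_map (Suc k) \<sigma> a c (v(k := x))) \<partial>lborel) =
        (\<integral>\<^sup>+x. f ((tri_map k \<sigma> a c v)(k := x)) \<partial>lborel)"
      unfolding split using \<sigma>
      by (subst nn_integral_real_affine[where c = \<sigma> and t = "a k + (\<Sum>s<k. c k s * v s)"])
        (auto simp: one_ennreal_def[symmetric])
  qed
  also have "\<dots> = (\<integral>\<^sup>+v. \<integral>\<^sup>+x. f (v(k := x)) \<partial>lborel \<partial>lborel_pow k)"
    by (rule Suc.IH) measurable
  also have "\<dots> = (\<integral>\<^sup>+v. f v \<partial>lborel_pow (Suc k))"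
    unfolding ins by (rule lborel_pow.product_nn_integral_insert[symmetric]) (auto simp: f)
  finally show ?case .
qed

lemma distr_tri_map:
  assumes "\<bar>\<sigma>\<bar> = 1"
  shows "distr (lborel_pow k) (lborel_pow k) (tri_map k \<sigma> a c) = lborel_pow k"
proof (rule measure_eqI)
  fix X assume "X \<in> sets (distr (lborel_pow k) (lborel_pow k) (tri_map k \<sigma> a c))"
  then have [measurable]: "X \<in> sets (lborel_pow k)" by simp
  have "emeasure (distr (lborel_pow k) (lborel_pow k) (tri_map k \<sigma> a c)) X =
      (\<integral>\<^sup>+v. indicator X (tri_map k \<sigma> a c v) \<partial>lborel_pow k)"
    by (simp flip: nn_integral_indicator add: nn_integral_distr)
  then show "emeasure (distr (lborel_pow k) (lborel_pow k) (tri_map k \<sigma> a c)) X =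
      emeasure (lborel_pow k) X"
    using nn_integral_tri_map[OF assms, of "indicator X" k a c] by simp
qed simp

lemma integral_tri_map:
  fixes f :: "(nat \<Rightarrow> real) \<Rightarrow> real"
  assumes "\<bar>\<sigma>\<bar> = 1" and f: "f \<in> borel_measurable (lborel_pow k)"
  shows "(\<integral>v. f (tri_map k \<sigma> a c v) \<partial>lborel_pow k) = (\<integral>v. f v \<partial>lborel_pow k)"
  by (subst (2) distr_tri_map[OF assms(1), of k a c, symmetric], subst integral_distr)
    (use f in auto)

section \<open>Densities of product measures and of images under measure-preserving maps\<close>

lemma PiM_density:
  fixes f :: "'i \<Rightarrow> real \<Rightarrow> ennreal"
  assumes I: "finite I" and f[measurable]: "\<And>i. i \<in> I \<Longrightarrow> f i \<in> borel_measurable borel"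
    and fin: "\<And>i. sigma_finite_measure (density lborel (f i))"
  shows "Pi\<^sub>M I (\<lambda>i. density lborel (f i)) = density (Pi\<^sub>M I (\<lambda>_. lborel)) (\<lambda>x. \<Prod>i\<in>I. f i (x i))"
proof (rule sym, rule product_sigma_finite.PiM_eqI)
  interpret product_sigma_finite "\<lambda>_::'i. lborel :: real measure" by standard
  show "product_sigma_finite (\<lambda>i. density lborel (f i))"
    using fin by (simp add: product_sigma_finite_def)
  show "sets (density (Pi\<^sub>M I (\<lambda>_. lborel)) (\<lambda>x. \<Prod>i\<in>I. f i (x i))) =
      sets (Pi\<^sub>M I (\<lambda>i. density lborel (f i)))"
    by (simp cong: sets_PiM_cong)
  fix A assume A: "\<And>i. i \<in> I \<Longrightarrow> A i \<in> sets (density lborel (f i))"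
  have A'[measurable]: "A i \<in> sets borel" if "i \<in> I" for i using A[OF that] by simp
  have [measurable]: "(\<lambda>x. f i (x i)) \<in> borel_measurable (Pi\<^sub>M I (\<lambda>_. lborel))" if "i \<in> I" for i
    using that by measurable
  have [measurable]: "Pi\<^sub>E I A \<in> sets (Pi\<^sub>M I (\<lambda>_. lborel :: real measure))"
    using I A' by (auto intro!: sets_PiM_I_finite)
  have "emeasure (density (Pi\<^sub>M I (\<lambda>_. lborel)) (\<lambda>x. \<Prod>i\<in>I. f i (x i))) (Pi\<^sub>E I A) =
      (\<integral>\<^sup>+x. (\<Prod>i\<in>I. f i (x i)) * indicator (Pi\<^sub>E I A) x \<partial>Pi\<^sub>M I (\<lambda>_. lborel))"
    by (rule emeasure_density) measurable
  also have "\<dots> = (\<integral>\<^sup>+x. (\<Prod>i\<in>I. f i (x i) * indicator (A i) (x i)) \<partial>Pi\<^sub>M I (\<lambda>_. lborel))"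
  proof (rule nn_integral_cong)
    fix x assume "x \<in> space (Pi\<^sub>M I (\<lambda>_. lborel :: real measure))"
    then have "indicator (Pi\<^sub>E I A) x = (\<Prod>i\<in>I. indicator (A i) (x i) :: ennreal)"
      using I by (auto simp: space_PiM PiE_def Pi_def indicator_def)
    then show "(\<Prod>i\<in>I. f i (x i)) * indicator (Pi\<^sub>E I A) x =
        (\<Prod>i\<in>I. f i (x i) * indicator (A i) (x i))"
      by (simp add: prod.distrib)
  qed
  also have "\<dots> = (\<Prod>i\<in>I. \<integral>\<^sup>+x. f i x * indicator (A i) x \<partial>lborel)"
    using I by (intro product_nn_integral_prod) auto
  also have "\<dots> = (\<Prod>i\<in>I. emeasure (density lborel (f i)) (A i))"
    by (intro prod.cong refl emeasure_density[symmetric]) auto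
  finally show "emeasure (density (Pi\<^sub>M I (\<lambda>_. lborel)) (\<lambda>x. \<Prod>i\<in>I. f i (x i))) (Pi\<^sub>E I A) =
      (\<Prod>i\<in>I. emeasure (density lborel (f i)) (A i))" .
qed (use I in auto)

text \<open>Writing the base measure as its own image under \<open>\<Phi>\<close> moves the density
  without a Jacobian, and \<open>\<Psi>\<close> has to undo \<open>\<Phi>\<close> from one side
  only.\<close>

lemma distributed_bij:
  assumes X: "distributed M S X f"
    and \<Phi>[measurable]: "\<Phi> \<in> measurable S S" and \<Psi>[measurable]: "\<Psi> \<in> measurable S S"
    and inv: "\<And>x. x \<in> space S \<Longrightarrow> \<Psi> (\<Phi> x) = x"
    and pres: "distr S S \<Phi> = S"
  shows "distributed M S (\<lambda>\<omega>. \<Phi> (X \<omega>)) (\<lambda>x. f (\<Psi> x))"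
proof -
  have f[measurable]: "f \<in> borel_measurable S" and [measurable]: "X \<in> measurable M S"
    using X by (auto simp: distributed_def)
  have "density S (\<lambda>x. f (\<Psi> x)) = density (distr S S \<Phi>) (\<lambda>x. f (\<Psi> x))" by (simp add: pres)
  also have "\<dots> = distr (density S (\<lambda>x. f (\<Psi> (\<Phi> x)))) S \<Phi>"
    by (subst density_distr) auto
  also have "density S (\<lambda>x. f (\<Psi> (\<Phi> x))) = density S f"
    by (rule density_cong) (auto simp: inv)
  also have "density S f = distr M S X" using X by (simp add: distributed_def)
  also have "distr (distr M S X) S \<Phi> = distr M S (\<lambda>\<omega>. \<Phi> (X \<omega>))"
    by (simp add: distr_distr comp_def)
  finally show ?thesis by (simp add: distributed_def)
qed

text \<open>By Tonelli, invariance may be checked on each fibre. This lets the noise be translated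
  by an amount that depends on the message.\<close>

lemma distr_pair_fibrewise:
  assumes "sigma_finite_measure T"
    and \<Phi>[measurable]: "(\<lambda>z. \<Phi> (fst z) (snd z)) \<in> measurable (S \<Otimes>\<^sub>M T) T"
    and pres: "\<And>x. x \<in> space S \<Longrightarrow> distr T T (\<Phi> x) = T"
  shows "distr (S \<Otimes>\<^sub>M T) (S \<Otimes>\<^sub>M T) (\<lambda>z. (fst z, \<Phi> (fst z) (snd z))) = S \<Otimes>\<^sub>M T"
proof (rule measure_eqI)
  interpret T: sigma_finite_measure T by fact
  let ?\<Phi> = "\<lambda>z. (fst z, \<Phi> (fst z) (snd z))"
  fix X assume "X \<in> sets (distr (S \<Otimes>\<^sub>M T) (S \<Otimes>\<^sub>M T) ?\<Phi>)"
  then have X[measurable]: "X \<in> sets (S \<Otimes>\<^sub>M T)" by simp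
  have "emeasure (distr (S \<Otimes>\<^sub>M T) (S \<Otimes>\<^sub>M T) ?\<Phi>) X =
      (\<integral>\<^sup>+z. indicator X (?\<Phi> z) \<partial>(S \<Otimes>\<^sub>M T))"
    by (simp flip: nn_integral_indicator add: nn_integral_distr)
  also have "\<dots> = (\<integral>\<^sup>+x. \<integral>\<^sup>+y. indicator X (x, \<Phi> x y) \<partial>T \<partial>S)"
    by (subst T.nn_integral_fst[symmetric]) auto
  also have "\<dots> = (\<integral>\<^sup>+x. \<integral>\<^sup>+y. indicator X (x, y) \<partial>T \<partial>S)"
  proof (rule nn_integral_cong)
    fix x assume x[measurable]: "x \<in> space S"
    have [measurable]: "\<Phi> x \<in> measurable T T"
      using measurable_compose[OF measurable_Pair1'[OF x] \<Phi>] by simp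
    have "(\<integral>\<^sup>+y. indicator X (x, y) \<partial>T) = (\<integral>\<^sup>+y. indicator X (x, y) \<partial>distr T T (\<Phi> x))"
      by (simp add: pres x)
    also have "\<dots> = (\<integral>\<^sup>+y. indicator X (x, \<Phi> x y) \<partial>T)"
      using x by (intro nn_integral_distr) auto
    finally show "(\<integral>\<^sup>+y. indicator X (x, \<Phi> x y) \<partial>T) = (\<integral>\<^sup>+y. indicator X (x, y) \<partial>T)" ..
  qed
  also have "\<dots> = (\<integral>\<^sup>+z. indicator X z \<partial>(S \<Otimes>\<^sub>M T))"
    by (subst T.nn_integral_fst) auto
  finally show "emeasure (distr (S \<Otimes>\<^sub>M T) (S \<Otimes>\<^sub>M T) ?\<Phi>) X = emeasure (S \<Otimes>\<^sub>M T) X"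
    by simp
qed simp

section \<open>Causal linear combinations\<close>

text \<open>The coefficients are chosen before \<open>w\<close>, so one combination serves every
  argument. The type of \<open>w\<close> is left open: it is a sample point for processes, and the
  coordinate vector itself in \<open>tri_map_inverse\<close>.\<close>

definition lin_span :: "(nat \<Rightarrow> 'w \<Rightarrow> real) \<Rightarrow> nat \<Rightarrow> ('w \<Rightarrow> real) \<Rightarrow> bool" where
  "lin_span b t f \<longleftrightarrow> (\<exists>c. \<forall>w. f w = (\<Sum>s<t. c s * b s w))"

lemma lin_span_zero: "lin_span b t (\<lambda>_. 0)"
  unfolding lin_span_def by (rule exI[of _ "\<lambda>_. 0"]) simp

lemma lin_span_add:
  assumes "lin_span b t f" "lin_span b t g"
  shows "lin_span b t (\<lambda>w. f w + g w)"
proof -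
  obtain c d where "\<forall>w. f w = (\<Sum>s<t. c s * b s w)" "\<forall>w. g w = (\<Sum>s<t. d s * b s w)"
    using assms unfolding lin_span_def by auto
  then show ?thesis unfolding lin_span_def
    by (intro exI[of _ "\<lambda>s. c s + d s"]) (simp add: algebra_simps sum.distrib)
qed

lemma lin_span_scale:
  assumes "lin_span b t f"
  shows "lin_span b t (\<lambda>w. a * f w)"
proof -
  obtain c where "\<forall>w. f w = (\<Sum>s<t. c s * b s w)"
    using assms unfolding lin_span_def by auto
  then show ?thesis unfolding lin_span_def
    by (intro exI[of _ "\<lambda>s. a * c s"]) (simp add: algebra_simps sum_distrib_left)
qed

lemma lin_span_diff:
  assumes "lin_span b t f" "lin_span b t g"
  shows "lin_span b t (\<lambda>w. f w - g w)"
  using lin_span_add[OF assms(1) lin_span_scale[OF assms(2), of "-1"]] by simp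

lemma lin_span_sum:
  assumes "\<And>i. i \<in> I \<Longrightarrow> lin_span b t (f i)"
  shows "lin_span b t (\<lambda>w. \<Sum>i\<in>I. f i w)"
  using assms by (induction I rule: infinite_finite_induct)
    (auto intro: lin_span_zero lin_span_add)

lemma lin_span_base:
  assumes "s < t"
  shows "lin_span b t (b s)"
proof -
  have "(\<Sum>r<t. (if r = s then 1 else 0) * b r w) = b s w" for w
    using assms by (simp add: if_distrib[of "\<lambda>x. x * _"] cong: if_cong)
  then show ?thesis unfolding lin_span_def
    by (intro exI[of _ "\<lambda>r. if r = s then 1 else 0"]) simp
qed

lemma lin_span_trans:
  assumes "lin_span b t f" "\<And>s. s < t \<Longrightarrow> lin_span b' t' (b s)"
  shows "lin_span b' t' f"
proof -
  obtain c where "f = (\<lambda>w. \<Sum>s<t. c s * b s w)"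
    using assms(1) unfolding lin_span_def by auto
  then show ?thesis
    by (auto intro!: lin_span_sum lin_span_scale assms(2))
qed

lemma lin_span_mono: "lin_span b t f \<Longrightarrow> t \<le> t' \<Longrightarrow> lin_span b t' f"
  by (erule lin_span_trans) (auto intro: lin_span_base)

lemmas lin_span_intros =
  lin_span_zero lin_span_add lin_span_diff lin_span_scale lin_span_sum lin_span_base

text \<open>The span stops strictly before \<open>t\<close>, so the matrix taking \<open>y\<close>
  to \<open>x\<close> has unit diagonal: it is invertible and preserves volume.\<close>

definition unit_tri :: "nat \<Rightarrow> (nat \<Rightarrow> 'w \<Rightarrow> real) \<Rightarrow> (nat \<Rightarrow> 'w \<Rightarrow> real) \<Rightarrow> bool" where
  "unit_tri k x y \<longleftrightarrow> (\<forall>t<k. lin_span y t (\<lambda>w. x t w - y t w))"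

lemma unit_triD: "unit_tri k x y \<Longrightarrow> t < k \<Longrightarrow> lin_span y t (\<lambda>w. x t w - y t w)"
  by (simp add: unit_tri_def)

lemma unit_tri_lin_span:
  assumes "unit_tri k x y" "t < k"
  shows "lin_span y (Suc t) (x t)"
proof -
  have "lin_span y (Suc t) (\<lambda>w. (x t w - y t w) + y t w)"
    using assms by (intro lin_span_add lin_span_base)
      (auto intro: lin_span_mono[OF unit_triD])
  then show ?thesis by simp
qed

lemma lin_span_unit_tri:
  assumes "unit_tri k x y" "t \<le> k" "lin_span x t f"
  shows "lin_span y t f"
  using assms(3)
  by (rule lin_span_trans) (use assms(1,2) in \<open>auto intro: lin_span_mono[OF unit_tri_lin_span]\<close>)

text \<open>Forward substitution: the past values of \<open>y\<close> that separate
  \<open>x t\<close> from \<open>y t\<close> are, by induction, already combinations of past values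
  of \<open>x\<close>.\<close>

lemma unit_tri_sym:
  assumes xy: "unit_tri k x y"
  shows "unit_tri k y x"
proof -
  have "t < k \<longrightarrow> lin_span x t (\<lambda>w. y t w - x t w)" for t
  proof (induction t rule: less_induct)
    case (less t)
    show ?case
    proof
      assume t: "t < k"
      have y: "lin_span x t (y s)" if "s < t" for s
      proof -
        have "lin_span x t (\<lambda>w. (y s w - x s w) + x s w)"
          using less that t
          by (intro lin_span_add lin_span_base) (auto intro: lin_span_mono[of x s _ t])
        then show ?thesis by simp
      qed
      have "lin_span x t (\<lambda>w. - 1 * (x t w - y t w))"
        by (intro lin_span_scale lin_span_trans[OF unit_triD[OF xy t] y])
      then show "lin_span x t (\<lambda>w. y t w - x t w)" by simp
    qed
  qed
  then show ?thesis by (simp add: unit_tri_def)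
qed

lemma unit_tri_coeffs:
  assumes "unit_tri k x y"
  obtains c where "\<And>t w. t < k \<Longrightarrow> x t w = y t w + (\<Sum>s<t. c t s * y s w)"
proof -
  have "\<forall>t. \<exists>c. t < k \<longrightarrow> (\<forall>w. x t w - y t w = (\<Sum>s<t. c s * y s w))"
    using assms unfolding unit_tri_def lin_span_def by blast
  then obtain c where "\<forall>t. t < k \<longrightarrow> (\<forall>w. x t w - y t w = (\<Sum>s<t. c t s * y s w))"
    by metis
  then show thesis by (intro that[of c]) (auto simp: algebra_simps)
qed

text \<open>With the coordinate vector as argument, the abstract inversion
  \<open>unit_tri_sym\<close> delivers the coefficients of an inverse map. Off the index range both
  sides are \<open>undefined\<close>.\<close>

lemma tri_map_inverse:
  obtains d where "\<And>v. v \<in> space (lborel_pow k) \<Longrightarrow>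
      tri_map k 1 (\<lambda>_. 0) d (tri_map k 1 (\<lambda>_. 0) c v) = v"
proof -
  have "unit_tri k (\<lambda>t v. v t + (\<Sum>s<t. c t s * v s)) (\<lambda>t v. v t)"
    unfolding unit_tri_def by (auto intro!: lin_span_intros)
  from unit_tri_coeffs[OF unit_tri_sym[OF this]] obtain d where
    d: "\<And>t v. t < k \<Longrightarrow> v t = v t + (\<Sum>s<t. c t s * v s) +
      (\<Sum>s<t. d t s * (v s + (\<Sum>r<s. c s r * v r)))" by blast
  show thesis
  proof (rule that[of d])
    fix v assume "v \<in> space (lborel_pow k)"
    then have undef: "v t = undefined" if "\<not> t < k" for t
      using that by (auto simp: space_PiM PiE_def extensional_def)
    show "tri_map k 1 (\<lambda>_. 0) d (tri_map k 1 (\<lambda>_. 0) c v) = v"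
    proof
      fix t
      show "tri_map k 1 (\<lambda>_. 0) d (tri_map k 1 (\<lambda>_. 0) c v) t = v t"
        using d[of t v] undef[of t] by (auto simp: tri_map_def intro!: sum.cong)
    qed
  qed
qed

section \<open>Recursive least squares\<close>

text \<open>\<open>mat_inv\<close> is the outcome of Gauss-Jordan elimination, which must be shown
  to succeed before uniqueness of inverses applies. A right inverse of a square matrix is two-sided,
  so \<open>A\<close> is a unit and elimination does succeed.\<close>

lemma mat_inv_eq:
  assumes A: "A \<in> carrier_mat n n" and B: "B \<in> carrier_mat n n" and AB: "A * B = 1\<^sub>m n"
  shows "mat_inv A = B"
proof -
  have BA: "B * A = 1\<^sub>m n" using mat_mult_left_right_inverse[OF A B AB] .
  have "A \<in> Units (ring_mat TYPE('a) n ())"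
    using A B AB BA by (auto simp: Units_def ring_mat_def)
  then obtain B' where "mat_inverse A = Some B'"
    using mat_inverse(1)[OF A, of "()"] by (cases "mat_inverse A") auto
  with mat_inverse(2)[OF A this] have inv: "mat_inv A = B'" "B' * A = 1\<^sub>m n"
    and B': "B' \<in> carrier_mat n n" by (auto simp: mat_inv_def)
  have "B' = B' * (A * B)" using AB B' by simp
  also have "\<dots> = B' * A * B" by (rule assoc_mult_mat[OF B' A B, symmetric])
  also have "\<dots> = B" using inv(2) B by simp
  finally show ?thesis using inv by simp
qed

lemma smult_mat_mult_vec:
  fixes c :: "'a :: comm_ring"
  assumes "v \<in> carrier_vec (dim_col A)"
  shows "(c \<cdot>\<^sub>m A) *\<^sub>v v = c \<cdot>\<^sub>v (A *\<^sub>v v)"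
  using assms by (intro eq_vecI) auto

text \<open>The bordered matrix \<open>?M\<close> has two block triangular factorisations, one with
  Schur complement \<open>1 + r * u\<close>, the other with \<open>1 + u * r\<close>; comparing
  their determinants needs no inverse.\<close>

lemma det_one_plus_rank_one:
  fixes u :: "'a :: idom mat"
  assumes u: "u \<in> carrier_mat n 1" and r: "r \<in> carrier_mat 1 n"
  shows "det (1\<^sub>m n + u * r) = 1 + (r * u) $$ (0, 0)"
proof -
  let ?M = "four_block_mat (1\<^sub>m n) (- u) r (1\<^sub>m 1)"
  let ?L = "four_block_mat (1\<^sub>m n) (0\<^sub>m n 1) r (1\<^sub>m 1)"
  let ?U = "four_block_mat (1\<^sub>m n) (- u) (0\<^sub>m 1 n) (1\<^sub>m 1 + r * u)"
  let ?U' = "four_block_mat (1\<^sub>m n) (- u) (0\<^sub>m 1 n) (1\<^sub>m 1)"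
  let ?L' = "four_block_mat (1\<^sub>m n + u * r) (0\<^sub>m n 1) r (1\<^sub>m 1)"
  have ur: "u * r \<in> carrier_mat n n" and ru: "r * u \<in> carrier_mat 1 1" and mu: "- u \<in> carrier_mat n 1"
    using u r by auto
  have "det ?L' = det (1\<^sub>m n + u * r) * det (1\<^sub>m 1 :: 'a mat)"
    by (rule det_four_block_mat_upper_right_zero_col) (use ur r in auto)
  then have L': "det ?L' = det (1\<^sub>m n + u * r)" by simp
  have "det ?U' = det (1\<^sub>m n :: 'a mat) * det (1\<^sub>m 1 :: 'a mat)"
    by (rule det_four_block_mat_lower_left_zero) (use mu in auto)
  then have U': "det ?U' = 1" by simp
  have "det ?L = det (1\<^sub>m n :: 'a mat) * det (1\<^sub>m 1 :: 'a mat)"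
    by (rule det_four_block_mat_upper_right_zero_col) (use r in auto)
  then have L: "det ?L = 1" by simp
  have "det ?U = det (1\<^sub>m n :: 'a mat) * det (1\<^sub>m 1 + r * u)"
    by (rule det_four_block_mat_lower_left_zero) (use mu ru in auto)
  then have U: "det ?U = 1 + (r * u) $$ (0, 0)"
    using ru by (simp add: det_single index_add_mat(1) carrier_matD[OF ru] del: index_mult_mat)
  have c: "?L \<in> carrier_mat (n + 1) (n + 1)" "?U \<in> carrier_mat (n + 1) (n + 1)"
      "?L' \<in> carrier_mat (n + 1) (n + 1)" "?U' \<in> carrier_mat (n + 1) (n + 1)"
    using ur ru by (intro four_block_carrier_mat; simp)+
  have cancel: "1\<^sub>m n + u * r + - u * r = (1\<^sub>m n :: 'a mat)"
  proof -
    have "1\<^sub>m n + u * r + - u * r = 1\<^sub>m n + (u * r + - (u * r))"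
      using ur u r by (subst assoc_add_mat[of _ n n]) auto
    also have "u * r + - (u * r) = 0\<^sub>m n n" using u r by (intro eq_matI) auto
    finally show ?thesis by simp
  qed
  have "?L * ?U = four_block_mat (1\<^sub>m n * 1\<^sub>m n + 0\<^sub>m n 1 * 0\<^sub>m 1 n)
      (1\<^sub>m n * - u + 0\<^sub>m n 1 * (1\<^sub>m 1 + r * u)) (r * 1\<^sub>m n + 1\<^sub>m 1 * 0\<^sub>m 1 n)
      (r * - u + 1\<^sub>m 1 * (1\<^sub>m 1 + r * u))"
    by (rule mult_four_block_mat) (use u r ru mu in auto)
  also have "\<dots> = ?M"
    using u r ru mu by (intro cong_four_block_mat eq_matI) auto
  finally have 1: "?L * ?U = ?M" .
  have "?U' * ?L' = four_block_mat (1\<^sub>m n * (1\<^sub>m n + u * r) + - u * r)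
      (1\<^sub>m n * 0\<^sub>m n 1 + - u * 1\<^sub>m 1) (0\<^sub>m 1 n * (1\<^sub>m n + u * r) + 1\<^sub>m 1 * r)
      (0\<^sub>m 1 n * 0\<^sub>m n 1 + 1\<^sub>m 1 * 1\<^sub>m 1)"
    by (rule mult_four_block_mat) (use u r ur mu in auto)
  also have "\<dots> = ?M"
    using u r ur mu cancel by (intro cong_four_block_mat) auto
  finally have "?U' * ?L' = ?L * ?U" using 1 by simp
  then have "det ?U' * det ?L' = det ?L * det ?U"
    by (simp only: det_mult[OF c(4) c(3), symmetric] det_mult[OF c(1) c(2), symmetric])
  then show ?thesis unfolding L L' U U' by simp
qed

text \<open>Recursive least squares: \<open>P t\<close>, \<open>est y t\<close> and \<open>inn y t\<close> are the Kalman covariance, estimate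
  and innovation for a constant state observed through the rows \<open>R t\<close> in unit noise, and \<open>J t\<close> is
  the information matrix.\<close>

locale rls =
  fixes d :: nat and R :: "nat \<Rightarrow> real mat"
  assumes R: "R t \<in> carrier_mat 1 d"
begin

lemma R_simps[simp]:
  "R t \<in> carrier_mat (Suc 0) d" "dim_row (R t) = 1" "dim_col (R t) = d"
  using R[of t] by auto

definition g :: "nat \<Rightarrow> real vec" where "g t = row (R t) 0"

primrec P :: "nat \<Rightarrow> real mat" where
  "P 0 = 1\<^sub>m d"
| "P (Suc t) = P t - (1 / ((R t * P t * (R t)\<^sup>T) $$ (0, 0) + 1)) \<cdot>\<^sub>m
     (P t * (R t)\<^sup>T * R t * P t)"

primrec J :: "nat \<Rightarrow> real mat" where
  "J 0 = 1\<^sub>m d"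
| "J (Suc t) = J t + (R t)\<^sup>T * R t"

definition K :: "nat \<Rightarrow> real" where "K t = g t \<bullet> (P t *\<^sub>v g t) + 1"

primrec est :: "(nat \<Rightarrow> real) \<Rightarrow> nat \<Rightarrow> real vec" where
  "est y 0 = 0\<^sub>v d"
| "est y (Suc t) = est y t + ((y t - g t \<bullet> est y t) / K t) \<cdot>\<^sub>v (P t *\<^sub>v g t)"

definition inn :: "(nat \<Rightarrow> real) \<Rightarrow> nat \<Rightarrow> real" where
  "inn y t = y t - g t \<bullet> est y t"

lemma g[simp]: "g t \<in> carrier_vec d"
  by (rule carrier_vecI) (simp add: g_def)

lemma P[simp]: "P t \<in> carrier_mat d d"
proof -
  have "dim_row (P t) = d \<and> dim_col (P t) = d" by (induction t) simp_all
  then show ?thesis by (intro carrier_matI) auto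
qed

lemma J[simp]: "J t \<in> carrier_mat d d"
proof -
  have "dim_row (J t) = d \<and> dim_col (J t) = d" by (induction t) simp_all
  then show ?thesis by (intro carrier_matI) auto
qed

lemma P_J_dims[simp]:
  "dim_row (P t) = d" "dim_col (P t) = d" "dim_row (J t) = d" "dim_col (J t) = d"
  by (rule carrier_matD[OF P] carrier_matD[OF J])+

lemma est_dim[simp]: "dim_vec (est y t) = d"
  by (induction t) simp_all

lemma est[simp]: "est y t \<in> carrier_vec d"
  by (rule carrier_vecI) simp

lemma g_dim[simp]: "dim_vec (g t) = d"
  by (simp add: g_def)

lemma mult_vec_carrier[simp]:
  "v \<in> carrier_vec d \<Longrightarrow> P t *\<^sub>v v \<in> carrier_vec d"
  "v \<in> carrier_vec d \<Longrightarrow> J t *\<^sub>v v \<in> carrier_vec d"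
  by (rule mult_mat_vec_carrier[OF P] mult_mat_vec_carrier[OF J], assumption)+

lemma R_mult_vec: "v \<in> carrier_vec d \<Longrightarrow> R t *\<^sub>v v = vec (Suc 0) (\<lambda>_. g t \<bullet> v)"
  by (rule eq_vecI) (auto simp: g_def)

lemma RT_mult_vec: "(R t)\<^sup>T *\<^sub>v vec (Suc 0) (\<lambda>_. c) = c \<cdot>\<^sub>v g t"
  by (rule eq_vecI) (auto simp: g_def scalar_prod_def)

lemma col_RT: "col ((R t)\<^sup>T) 0 = g t" by (simp add: g_def)

lemma K_eq: "(R t * P t * (R t)\<^sup>T) $$ (0, 0) + 1 = K t"
proof -
  have "R t * P t * (R t)\<^sup>T = R t * (P t * (R t)\<^sup>T)"
    by (rule assoc_mult_mat[of _ 1 d _ d _ 1]) auto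
  then show ?thesis
    unfolding K_def by (simp add: g_def col_mult2[of _ d d _ 1])
qed

lemma J_step:
  assumes v: "v \<in> carrier_vec d"
  shows "J (Suc t) *\<^sub>v v = J t *\<^sub>v v + (g t \<bullet> v) \<cdot>\<^sub>v g t"
proof -
  have "((R t)\<^sup>T * R t) *\<^sub>v v = (R t)\<^sup>T *\<^sub>v (R t *\<^sub>v v)"
    using v by (intro assoc_mult_mat_vec[of _ d 1 _ d]) auto
  then show ?thesis using v
    by (simp add: add_mult_distrib_mat_vec[of _ d d] mult_carrier_mat[of _ d 1] R_mult_vec RT_mult_vec)
qed

lemma P_step:
  assumes v: "v \<in> carrier_vec d"
  shows "P (Suc t) *\<^sub>v v = P t *\<^sub>v v - (g t \<bullet> (P t *\<^sub>v v) / K t) \<cdot>\<^sub>v (P t *\<^sub>v g t)"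
proof -
  have c: "P t * (R t)\<^sup>T \<in> carrier_mat d 1" "P t * (R t)\<^sup>T * R t \<in> carrier_mat d d"
      "P t * (R t)\<^sup>T * R t * P t \<in> carrier_mat d d"
    by (rule carrier_matI; simp)+
  have "(P t * (R t)\<^sup>T * R t * P t) *\<^sub>v v = P t * (R t)\<^sup>T * R t *\<^sub>v (P t *\<^sub>v v)"
    using v c by (intro assoc_mult_mat_vec[of _ d d _ d]) auto
  also have "\<dots> = P t * (R t)\<^sup>T *\<^sub>v (R t *\<^sub>v (P t *\<^sub>v v))"
    using v c by (intro assoc_mult_mat_vec[of _ d 1 _ d]) auto
  also have "\<dots> = P t *\<^sub>v ((R t)\<^sup>T *\<^sub>v (R t *\<^sub>v (P t *\<^sub>v v)))"
    using v c by (intro assoc_mult_mat_vec[of _ d d _ 1]) (auto simp: R_mult_vec)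
  also have "\<dots> = (g t \<bullet> (P t *\<^sub>v v)) \<cdot>\<^sub>v (P t *\<^sub>v g t)"
    using v by (simp add: R_mult_vec RT_mult_vec mult_mat_vec[of _ d d])
  finally show ?thesis
    unfolding P.simps K_eq
    using v c by (simp add: minus_mult_distrib_mat_vec[of _ d d] smult_mat_mult_vec smult_smult_assoc)
qed

lemma J_sym: "u \<in> carrier_vec d \<Longrightarrow> v \<in> carrier_vec d \<Longrightarrow> u \<bullet> (J t *\<^sub>v v) = v \<bullet> (J t *\<^sub>v u)"
proof (induction t)
  case (Suc t)
  then show ?case
    by (simp add: J_step scalar_prod_add_distrib[of _ d] comm_scalar_prod[of "g t" d] del: J.simps)
qed (simp add: comm_scalar_prod[of _ d])

lemma P_sym: "u \<in> carrier_vec d \<Longrightarrow> v \<in> carrier_vec d \<Longrightarrow> u \<bullet> (P t *\<^sub>v v) = v \<bullet> (P t *\<^sub>v u)"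
proof (induction t arbitrary: u v)
  case (Suc t)
  then show ?case
    using Suc.IH[of u "g t"] Suc.IH[of v "g t"] Suc.IH[of u v]
    by (simp add: P_step scalar_prod_minus_distrib[of _ d] del: P.simps)
qed (simp add: comm_scalar_prod[of _ d])

lemma J_nonneg: "v \<in> carrier_vec d \<Longrightarrow> 0 \<le> v \<bullet> (J t *\<^sub>v v)"
proof (induction t)
  case 0
  then show ?case by (simp add: scalar_prod_def sum_nonneg)
next
  case (Suc t)
  then show ?case
    by (simp add: J_step scalar_prod_add_distrib[of _ d] comm_scalar_prod[of "g t" d] del: J.simps)
qed

text \<open>The two claims need each other. The rank-one update of the inverse (Sherman-Morrison)
  divides by \<open>K t\<close>; conversely the inverse property turns
  \<open>g \<bullet> P g\<close> into the \<open>J\<close>-form of \<open>P g\<close>, which is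
  nonnegative.\<close>

lemma JP_vec_and_K_ge_1:
  "(\<forall>v\<in>carrier_vec d. J t *\<^sub>v (P t *\<^sub>v v) = v) \<and> 1 \<le> K t"
proof (induction t)
  case 0
  have "0 \<le> g 0 \<bullet> g 0" by (simp add: scalar_prod_def sum_nonneg)
  then show ?case by (simp add: K_def)
next
  case (Suc t)
  then have IH: "\<And>v. v \<in> carrier_vec d \<Longrightarrow> J t *\<^sub>v (P t *\<^sub>v v) = v" and K: "1 \<le> K t" by auto
  have JP: "J (Suc t) *\<^sub>v (P (Suc t) *\<^sub>v v) = v" if v: "v \<in> carrier_vec d" for v
  proof -
    let ?c = "g t \<bullet> (P t *\<^sub>v v)"
    have gPg: "g t \<bullet> (P t *\<^sub>v g t) = K t - 1" by (simp add: K_def)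
    have "J (Suc t) *\<^sub>v (P (Suc t) *\<^sub>v v) =
        v - (?c / K t) \<cdot>\<^sub>v g t + (?c - ?c / K t * (K t - 1)) \<cdot>\<^sub>v g t"
      using v IH[OF v] IH[of "g t"] gPg K
      by (simp add: J_step P_step mult_minus_distrib_mat_vec[of _ d d] mult_mat_vec[of _ d d]
          scalar_prod_minus_distrib[of _ d] del: J.simps P.simps)
        (rule eq_vecI; simp add: field_simps)
    also have "?c - ?c / K t * (K t - 1) = ?c / K t" using K by (simp add: field_simps)
    also have "v - (?c / K t) \<cdot>\<^sub>v g t + (?c / K t) \<cdot>\<^sub>v g t = v"
      using v by (intro eq_vecI) auto
    finally show ?thesis .
  qed
  have "0 \<le> (P (Suc t) *\<^sub>v g (Suc t)) \<bullet> (J (Suc t) *\<^sub>v (P (Suc t) *\<^sub>v g (Suc t)))"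
    by (rule J_nonneg) (simp del: P.simps)
  also have "J (Suc t) *\<^sub>v (P (Suc t) *\<^sub>v g (Suc t)) = g (Suc t)" by (rule JP) simp
  also have "(P (Suc t) *\<^sub>v g (Suc t)) \<bullet> g (Suc t) = g (Suc t) \<bullet> (P (Suc t) *\<^sub>v g (Suc t))"
    by (rule comm_scalar_prod[of _ d]) (simp_all del: P.simps)
  finally have "1 \<le> K (Suc t)" by (simp add: K_def del: P.simps)
  with JP show ?case by blast
qed

lemma JP_vec: "v \<in> carrier_vec d \<Longrightarrow> J t *\<^sub>v (P t *\<^sub>v v) = v"
  using JP_vec_and_K_ge_1 by blast

lemma K_pos[simp]: "0 < K t" and K_nz[simp]: "K t \<noteq> 0"
  using JP_vec_and_K_ge_1[of t] by auto

lemma JP: "J t * P t = 1\<^sub>m d"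
proof (rule eq_matI)
  fix i j assume ij: "i < dim_row (1\<^sub>m d :: real mat)" "j < dim_col (1\<^sub>m d :: real mat)"
  have "P t *\<^sub>v unit_vec d j = col (P t) j"
    using ij by (intro eq_vecI) auto
  then have "col (J t * P t) j = J t *\<^sub>v (P t *\<^sub>v unit_vec d j)"
    using ij by (simp add: col_mult2[of _ d d _ d])
  also have "\<dots> = unit_vec d j" by (rule JP_vec) simp
  finally have "col (J t * P t) j $ i = unit_vec d j $ i" by simp
  then show "(J t * P t) $$ (i, j) = 1\<^sub>m d $$ (i, j)" using ij by (auto simp: unit_vec_def)
qed auto

text \<open>Because \<open>J t\<close> inverts \<open>P t\<close>, it factors out of
  \<open>J (Suc t)\<close> and leaves a rank-one perturbation of the identity, whose determinant is
  the innovation variance.\<close>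

lemma det_J: "det (J t) = (\<Prod>s<t. K s)"
proof (induction t)
  case (Suc t)
  have u: "P t * (R t)\<^sup>T \<in> carrier_mat d 1" by (auto intro!: mult_carrier_mat[of _ d d])
  have "J (Suc t) = J t * (1\<^sub>m d + P t * (R t)\<^sup>T * R t)"
  proof -
    have "J t * (1\<^sub>m d + P t * (R t)\<^sup>T * R t) = J t * 1\<^sub>m d + J t * (P t * (R t)\<^sup>T * R t)"
      by (rule mult_add_distrib_mat[of _ d d _ d]) (auto intro!: mult_carrier_mat[OF u])
    also have "J t * (P t * (R t)\<^sup>T * R t) = J t * (P t * ((R t)\<^sup>T * R t))"
      by (subst assoc_mult_mat[of _ d d _ 1 _ d]) auto
    also have "\<dots> = J t * P t * ((R t)\<^sup>T * R t)"
      by (rule assoc_mult_mat[of _ d d _ d _ d, symmetric]) (auto intro!: mult_carrier_mat[of _ d 1])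
    also have "\<dots> = (R t)\<^sup>T * R t"
      by (simp add: JP)
    finally show ?thesis by simp
  qed
  then have "det (J (Suc t)) = det (J t) * det (1\<^sub>m d + P t * (R t)\<^sup>T * R t)"
    by (simp only:) (rule det_mult[of _ d], auto intro!: mult_carrier_mat[OF u])
  also have "det (1\<^sub>m d + P t * (R t)\<^sup>T * R t) = 1 + (R t * (P t * (R t)\<^sup>T)) $$ (0, 0)"
    by (rule det_one_plus_rank_one[OF u R])
  also have "R t * (P t * (R t)\<^sup>T) = R t * P t * (R t)\<^sup>T"
    by (rule assoc_mult_mat[of _ 1 d _ d _ 1, symmetric]) auto
  also have "1 + (R t * P t * (R t)\<^sup>T) $$ (0, 0) = K t" using K_eq[of t] by simp
  finally show ?case using Suc.IH by (simp add: lessThan_Suc mult.commute)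
qed simp

lemma inverse_matrices:
  "mat_inv (P t) = J t" "mat_inv (J t) = P t"
  using mat_mult_left_right_inverse[OF J P JP] JP by (auto intro!: mat_inv_eq[of _ d])

lemma J_index:
  assumes "i < d" "j < d"
  shows "J t $$ (i, j) = (if i = j then 1 else 0) + (\<Sum>s<t. g s $ i * g s $ j)"
proof (induction t)
  case 0
  then show ?case using assms by simp
next
  case (Suc t)
  have "((R t)\<^sup>T * R t) $$ (i, j) = g t $ i * g t $ j"
    using assms by (simp add: g_def scalar_prod_def)
  then show ?case using Suc.IH assms by simp
qed

text \<open>The left side is, up to the factor \<open>- 1 / 2\<close>, the exponent of the joint
  density of message and observations. On the right the message appears only through its distance
  from the estimate, which gives the conditional mean, and the rest is a sum over innovations, which
  gives the law of the observations.\<close>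

lemma completed_square:
  assumes w: "w \<in> carrier_vec d"
  shows "w \<bullet> w + (\<Sum>t<k. (y t - g t \<bullet> w)\<^sup>2) =
    (w - est y k) \<bullet> (J k *\<^sub>v (w - est y k)) + (\<Sum>t<k. (inn y t)\<^sup>2 / K t)"
proof (induction k)
  case 0
  then show ?case using w by simp
next
  case (Suc k)
  define a where "a = w - est y k"
  define \<kappa> where "\<kappa> = P k *\<^sub>v g k"
  define c where "c = inn y k / K k"
  have a[simp]: "a \<in> carrier_vec d" and \<kappa>[simp]: "\<kappa> \<in> carrier_vec d"
    using w by (auto simp: a_def \<kappa>_def)
  have [simp]: "dim_vec a = d" "dim_vec \<kappa> = d" using a \<kappa> by (auto simp del: a \<kappa>)
  have step: "w - est y (Suc k) = a - c \<cdot>\<^sub>v \<kappa>"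
    using w by (intro eq_vecI) (auto simp: a_def c_def \<kappa>_def inn_def)
  \<comment> \<open>These two values, \<open>g k \<bullet> \<kappa>\<close> and \<open>J k\<close>
    applied to \<open>\<kappa>\<close>, are all that is needed about the gain direction: the first
    is the definition of \<open>K k\<close>, the second the inverse property.\<close>
  have g\<kappa>: "g k \<bullet> \<kappa> = K k - 1" by (simp add: K_def \<kappa>_def)
  have J\<kappa>: "J k *\<^sub>v \<kappa> = g k" by (simp add: \<kappa>_def JP_vec)
  have swap: "\<kappa> \<bullet> (J k *\<^sub>v a) = g k \<bullet> a"
    using J_sym[of \<kappa> a k] by (simp add: J\<kappa> comm_scalar_prod[of _ d])
  have Q: "(a - c \<cdot>\<^sub>v \<kappa>) \<bullet> (J k *\<^sub>v (a - c \<cdot>\<^sub>v \<kappa>)) =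
      a \<bullet> (J k *\<^sub>v a) - 2 * c * (g k \<bullet> a) + c\<^sup>2 * (K k - 1)"
    by (simp add: mult_minus_distrib_mat_vec[of _ d d] mult_mat_vec[of _ d d] J\<kappa>
        scalar_prod_minus_distrib[of _ d] minus_scalar_prod_distrib[of _ d] swap
        comm_scalar_prod[of a d "g k"] comm_scalar_prod[of \<kappa> d "g k"] g\<kappa>)
      (simp add: algebra_simps power2_eq_square)
  have ga: "g k \<bullet> (a - c \<cdot>\<^sub>v \<kappa>) = g k \<bullet> a - c * (K k - 1)"
    by (simp add: scalar_prod_minus_distrib[of _ d] g\<kappa>)
  have "(w - est y (Suc k)) \<bullet> (J (Suc k) *\<^sub>v (w - est y (Suc k))) =
      (a - c \<cdot>\<^sub>v \<kappa>) \<bullet> (J k *\<^sub>v (a - c \<cdot>\<^sub>v \<kappa>)) + (g k \<bullet> (a - c \<cdot>\<^sub>v \<kappa>))\<^sup>2"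
    unfolding step
    by (simp add: J_step scalar_prod_add_distrib[of _ d] comm_scalar_prod[of _ d "g k"]
        power2_eq_square del: J.simps)
  also have "\<dots> = a \<bullet> (J k *\<^sub>v a) + (g k \<bullet> a)\<^sup>2 - 2 * (K k * c) * (g k \<bullet> a) + (K k * c)\<^sup>2 - K k * c\<^sup>2"
    unfolding Q ga by (simp add: algebra_simps power2_eq_square)
  also have "K k * c = inn y k" by (simp add: c_def)
  also have "K k * c\<^sup>2 = (inn y k)\<^sup>2 / K k" by (simp add: c_def power2_eq_square)
  finally have "(w - est y (Suc k)) \<bullet> (J (Suc k) *\<^sub>v (w - est y (Suc k))) + (inn y k)\<^sup>2 / K k =
      a \<bullet> (J k *\<^sub>v a) + (inn y k - g k \<bullet> a)\<^sup>2"
    by (simp add: algebra_simps power2_eq_square)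
  moreover have "y k - g k \<bullet> w = inn y k - g k \<bullet> a"
    using w by (simp add: a_def inn_def scalar_prod_minus_distrib[of _ d])
  ultimately show ?case using Suc.IH by (simp add: a_def del: est.simps J.simps)
qed

end

section \<open>Second moments\<close>

lemma (in prob_space) distributed_rvec_std_normal_moments:
  fixes X :: "nat \<Rightarrow> 'a \<Rightarrow> real" and a :: "nat \<Rightarrow> nat"
  assumes X: "distributed M (lborel_pow k) (rvec {..<k} X) (\<lambda>x. ennreal (\<Prod>i<k. std_normal_density (x i)))"
  shows "integrable M (\<lambda>\<omega>. \<Prod>i<k. X i \<omega> ^ a i)"
    and "(\<integral>\<omega>. (\<Prod>i<k. X i \<omega> ^ a i) \<partial>M) =
      (\<Prod>i<k. \<integral>x. std_normal_density x * x ^ a i \<partial>lborel)"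
proof -
  let ?\<phi> = "\<lambda>x. \<Prod>i<k. std_normal_density (x i)"
  let ?f = "\<lambda>x. \<Prod>i<k. x i ^ a i :: real"
  have [measurable]: "?f \<in> borel_measurable (lborel_pow k)" by measurable
  have nonneg: "0 \<le> ?\<phi> x" for x by (intro prod_nonneg) auto
  have f: "?f (rvec {..<k} X \<omega>) = (\<Prod>i<k. X i \<omega> ^ a i)" for \<omega>
    by (intro prod.cong) (auto simp: rvec_def)
  have prod: "?\<phi> x * ?f x = (\<Prod>i<k. std_normal_density (x i) * x i ^ a i)" for x
    by (simp add: prod.distrib)
  have "integrable (lborel_pow k) (\<lambda>x. ?\<phi> x * ?f x)"
    unfolding prod
    by (intro lborel_pow.product_integrable_prod integrable_std_normal_moment) auto
  then show "integrable M (\<lambda>\<omega>. \<Prod>i<k. X i \<omega> ^ a i)"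
    using distributed_integrable[OF X, of ?f] nonneg by (simp add: f)
  have "(\<integral>\<omega>. ?f (rvec {..<k} X \<omega>) \<partial>M) = (\<integral>x. ?\<phi> x * ?f x \<partial>lborel_pow k)"
    using distributed_integral[OF X, of ?f] nonneg by simp
  also have "\<dots> = (\<Prod>i<k. \<integral>x. std_normal_density x * x ^ a i \<partial>lborel)"
    unfolding prod
    by (intro lborel_pow.product_integral_prod integrable_std_normal_moment) auto
  finally show "(\<integral>\<omega>. (\<Prod>i<k. X i \<omega> ^ a i) \<partial>M) =
      (\<Prod>i<k. \<integral>x. std_normal_density x * x ^ a i \<partial>lborel)" by (simp add: f)
qed

lemma std_normal_moments_0_1_2:
  "(\<integral>x. std_normal_density x * x ^ 0 \<partial>lborel) = 1"
  "(\<integral>x. std_normal_density x * x ^ 1 \<partial>lborel) = 0"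
  "(\<integral>x. std_normal_density x * x ^ 2 \<partial>lborel) = 1"
  using integral_std_normal_moment_even[of 0] integral_std_normal_moment_odd[of 0]
    integral_std_normal_moment_even[of 1] by simp_all

text \<open>The exponents are the indicator of \<open>i\<close>, or the sum of the indicators of
  \<open>i\<close> and \<open>j\<close>. An exponent 1 contributes a zero factor, so only
  \<open>i = j\<close>, with exponent 2, gives a nonzero second moment.\<close>

lemma (in prob_space) distributed_rvec_std_normal_covariance:
  fixes X :: "nat \<Rightarrow> 'a \<Rightarrow> real"
  assumes X: "distributed M (lborel_pow k) (rvec {..<k} X) (\<lambda>x. ennreal (\<Prod>i<k. std_normal_density (x i)))"
    and ij: "i < k" "j < k"
  shows "integrable M (X i)" "(\<integral>\<omega>. X i \<omega> \<partial>M) = 0"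
    and "integrable M (\<lambda>\<omega>. X i \<omega> * X j \<omega>)"
    and "(\<integral>\<omega>. X i \<omega> * X j \<omega> \<partial>M) = (if i = j then 1 else 0)"
proof -
  note mom = distributed_rvec_std_normal_moments[OF X]
  have pow: "(\<Prod>l<k. x l ^ ((if l = i then 1 else 0) + b l)) = x i * (\<Prod>l<k. x l ^ b l)"
    if "i < k" for i and x :: "nat \<Rightarrow> real" and b
    using that by (simp add: power_add prod.distrib if_distrib[of "\<lambda>e. _ ^ e"] cong: if_cong)
  have 1: "(\<Prod>l<k. x l ^ (if l = i then 1 else 0)) = x i" for x :: "nat \<Rightarrow> real"
    using pow[OF ij(1), of x "\<lambda>_. 0"] by simp
  have 2: "(\<Prod>l<k. x l ^ ((if l = i then 1 else 0) + (if l = j then 1 else 0))) = x i * x j"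
    for x :: "nat \<Rightarrow> real"
    using pow[OF ij(1), of x] pow[OF ij(2), of x "\<lambda>_. 0"] by simp
  show "integrable M (X i)"
    using mom(1)[of "\<lambda>l. if l = i then 1 else 0"] by (simp only: 1)
  show "integrable M (\<lambda>\<omega>. X i \<omega> * X j \<omega>)"
    using mom(1)[of "\<lambda>l. (if l = i then 1 else 0) + (if l = j then 1 else 0)"] by (simp only: 2)
  have "(\<integral>\<omega>. X i \<omega> \<partial>M) = (\<Prod>l<k. \<integral>x. std_normal_density x * x ^ (if l = i then 1 else 0) \<partial>lborel)"
    using mom(2)[of "\<lambda>l. if l = i then 1 else 0"] by (simp only: 1)
  also have "\<dots> = 0"
    using ij std_normal_moments_0_1_2 by (intro prod_zero) auto
  finally show "(\<integral>\<omega>. X i \<omega> \<partial>M) = 0" .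
  have "(\<integral>\<omega>. X i \<omega> * X j \<omega> \<partial>M) = (\<Prod>l<k. \<integral>x. std_normal_density x *
      x ^ ((if l = i then 1 else 0) + (if l = j then 1 else 0)) \<partial>lborel)"
    using mom(2)[of "\<lambda>l. (if l = i then 1 else 0) + (if l = j then 1 else 0)"] by (simp only: 2)
  also have "\<dots> = (if i = j then 1 else 0)"
  proof (cases "i = j")
    case True
    have "(if l = i then 1 else 0) + (if l = j then 1 else 0) = (if l = i then 2 else 0 :: nat)" for l
      using True by simp
    moreover have "(\<integral>x. std_normal_density x * x ^ (if l = i then 2 else 0) \<partial>lborel) = 1" for l
      using std_normal_moments_0_1_2 by (cases "l = i") simp_all
    ultimately show ?thesis using True by simp
  next
    case False
    then show ?thesis using ij std_normal_moments_0_1_2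
      by (simp only: if_False) (intro prod_zero, auto intro!: bexI[of _ i])
  qed
  finally show "(\<integral>\<omega>. X i \<omega> * X j \<omega> \<partial>M) = (if i = j then 1 else 0)" .
qed

lemma (in prob_space) distributed_rvec_indep:
  assumes indep: "indep_vars (\<lambda>_. borel) X {..<k}"
    and X: "\<And>t. distributed M lborel (X t) (\<lambda>x. ennreal (f x))"
    and f: "\<And>x. 0 \<le> f x"
  shows "distributed M (lborel_pow k) (rvec {..<k} X) (\<lambda>x. ennreal (\<Prod>i<k. f (x i)))"
proof -
  have [measurable]: "X t \<in> borel_measurable M" for t
    using distributed_measurable[OF X[of t]] by simp
  have fm[measurable]: "f \<in> borel_measurable borel"
    using distributed_real_measurable[OF f X[of 0]] by simp
  have rv: "rvec {..<k} X \<in> measurable M (lborel_pow k)"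
    unfolding rvec_def by (intro measurable_restrict) auto
  have X': "distr M borel (X t) = density lborel f" for t
    using distributed_distr_eq_density[OF X[of t]] by (simp cong: distr_cong)
  then interpret D: prob_space "density lborel f"
    using prob_space_distr[of "X 0" borel] by simp
  have "distr M (lborel_pow k) (rvec {..<k} X) = Pi\<^sub>M {..<k} (\<lambda>_. density lborel f)"
  \<comment> \<open>The product characterisation of independence is applied to a nonempty index set;
    for \<open>k = 0\<close> both sides are the probability measure on a one-point space.\<close>
  proof (cases "k = 0")
    case True
    show ?thesis
    proof (rule product_sigma_finite.PiM_eqI)
      show "product_sigma_finite (\<lambda>_::nat. density lborel f)"
        by (simp add: product_sigma_finite_def D.sigma_finite_measure_axioms)
      show "sets (distr M (lborel_pow k) (rvec {..<k} X)) = sets (Pi\<^sub>M {..<k} (\<lambda>_. density lborel f))"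
        by (simp cong: sets_PiM_cong)
      fix A :: "nat \<Rightarrow> real set"
      have "Pi\<^sub>E {..<k} A = space (lborel_pow k)" by (simp add: True space_PiM)
      then show "emeasure (distr M (lborel_pow k) (rvec {..<k} X)) (Pi\<^sub>E {..<k} A) =
          (\<Prod>i<k. emeasure (density lborel f) (A i))"
        using prob_space.emeasure_space_1[OF prob_space_distr[OF rv]] True by simp
    qed simp
  next
    case False
    then have "{..<k} \<noteq> {}" by auto
    then have "distr M (Pi\<^sub>M {..<k} (\<lambda>_. borel)) (\<lambda>x. \<lambda>i\<in>{..<k}. X i x) =
        Pi\<^sub>M {..<k} (\<lambda>i. distr M borel (X i))"
      using indep by (subst (asm) indep_vars_iff_distr_eq_PiM') auto
    moreover have "distr M (Pi\<^sub>M {..<k} (\<lambda>_. borel)) (\<lambda>x. \<lambda>i\<in>{..<k}. X i x) =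
        distr M (lborel_pow k) (rvec {..<k} X)"
      by (intro distr_cong) (auto simp: rvec_def cong: sets_PiM_cong)
    ultimately show ?thesis by (simp add: X')
  qed
  also have "\<dots> = density (lborel_pow k) (\<lambda>x. \<Prod>i<k. ennreal (f (x i)))"
    by (intro PiM_density) (auto intro: D.sigma_finite_measure_axioms)
  also have "(\<lambda>x. \<Prod>i<k. ennreal (f (x i))) = (\<lambda>x. ennreal (\<Prod>i<k. f (x i)))"
    using f by (simp add: prod_ennreal)
  finally show ?thesis using rv by (auto simp: distributed_def)
qed

section \<open>The inner product of square-integrable random variables\<close>

context prob_space
begin

definition sq_integrable :: "('a \<Rightarrow> real) \<Rightarrow> bool" where
  "sq_integrable f \<longleftrightarrow> f \<in> borel_measurable M \<and> integrable M (\<lambda>\<omega>. (f \<omega>)\<^sup>2)"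

text \<open>Uncentred on purpose: \<open>ip f (\<lambda>_. 1)\<close> is the mean, so the recursions
  that give second moments also give means. Once these vanish, \<open>ip\<close> is the
  covariance.\<close>

definition ip :: "('a \<Rightarrow> real) \<Rightarrow> ('a \<Rightarrow> real) \<Rightarrow> real" where
  "ip f g = (\<integral>\<omega>. f \<omega> * g \<omega> \<partial>M)"

lemma sq_integrable_mult:
  assumes "sq_integrable f" "sq_integrable g"
  shows "integrable M (\<lambda>\<omega>. f \<omega> * g \<omega>)"
proof (rule Bochner_Integration.integrable_bound)
  show "integrable M (\<lambda>\<omega>. (f \<omega>)\<^sup>2 + (g \<omega>)\<^sup>2)"
    using assms by (auto simp: sq_integrable_def)
  show "(\<lambda>\<omega>. f \<omega> * g \<omega>) \<in> borel_measurable M"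
    using assms by (auto simp: sq_integrable_def)
  have "\<bar>x * y\<bar> \<le> x\<^sup>2 + y\<^sup>2" for x y :: real
    using sum_squares_bound[of x y] sum_squares_bound[of x "-y"] zero_le_power2[of x]
      zero_le_power2[of y] by (auto simp: abs_if)
  then show "AE \<omega> in M. norm (f \<omega> * g \<omega>) \<le> norm ((f \<omega>)\<^sup>2 + (g \<omega>)\<^sup>2)" by auto
qed

lemma sq_integrable_const: "sq_integrable (\<lambda>_. c)"
  by (simp add: sq_integrable_def)

lemma sq_integrable_scale: "sq_integrable f \<Longrightarrow> sq_integrable (\<lambda>\<omega>. c * f \<omega>)"
  by (auto simp: sq_integrable_def power_mult_distrib)

lemma sq_integrable_add:
  assumes f: "sq_integrable f" and g: "sq_integrable g"
  shows "sq_integrable (\<lambda>\<omega>. f \<omega> + g \<omega>)"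
  using f g sq_integrable_mult[OF f g] by (auto simp: sq_integrable_def power2_sum mult.assoc)

lemma sq_integrable_diff:
  "sq_integrable f \<Longrightarrow> sq_integrable g \<Longrightarrow> sq_integrable (\<lambda>\<omega>. f \<omega> - g \<omega>)"
  using sq_integrable_add[of f "\<lambda>\<omega>. - 1 * g \<omega>"] sq_integrable_scale[of g "-1"] by simp

lemma sq_integrable_sum:
  "(\<And>i. i \<in> I \<Longrightarrow> sq_integrable (f i)) \<Longrightarrow> sq_integrable (\<lambda>\<omega>. \<Sum>i\<in>I. f i \<omega>)"
  by (induction I rule: infinite_finite_induct)
    (auto intro: sq_integrable_const sq_integrable_add)

lemmas sq_integrable_intros =
  sq_integrable_const sq_integrable_scale sq_integrable_add sq_integrable_diff sq_integrable_sum

lemma sq_integrable_integrable: "sq_integrable f \<Longrightarrow> integrable M f"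
  using sq_integrable_mult[of f "\<lambda>_. 1"] sq_integrable_const[of 1] by simp

lemma ip_commute: "ip f g = ip g f"
  by (simp add: ip_def mult.commute)

lemma ip_add:
  assumes "sq_integrable f" "sq_integrable f'" "sq_integrable g"
  shows "ip (\<lambda>\<omega>. f \<omega> + f' \<omega>) g = ip f g + ip f' g"
  using sq_integrable_mult[OF assms(1,3)] sq_integrable_mult[OF assms(2,3)]
  by (simp add: ip_def distrib_right)

lemma ip_diff:
  assumes "sq_integrable f" "sq_integrable f'" "sq_integrable g"
  shows "ip (\<lambda>\<omega>. f \<omega> - f' \<omega>) g = ip f g - ip f' g"
  using sq_integrable_mult[OF assms(1,3)] sq_integrable_mult[OF assms(2,3)]
  by (simp add: ip_def left_diff_distrib)

lemma ip_scale: "ip (\<lambda>\<omega>. c * f \<omega>) g = c * ip f g"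
  by (simp add: ip_def mult.assoc)

lemma ip_sum:
  assumes "\<And>i. i \<in> I \<Longrightarrow> sq_integrable (f i)" "sq_integrable g"
  shows "ip (\<lambda>\<omega>. \<Sum>i\<in>I. f i \<omega>) g = (\<Sum>i\<in>I. ip (f i) g)"
  using assms(1)
proof (induction I rule: infinite_finite_induct)
  case (insert i I)
  then show ?case using assms(2) by (simp add: ip_add sq_integrable_sum)
qed (simp_all add: ip_def)

end

section \<open>The channel without feedback\<close>

text \<open>Since the channel state is a linear function of \<open>W\<close>, the whole no-feedback system is the
  observation \<open>Y t = g t \<bullet> W + N t\<close> of the constant \<open>W\<close>.\<close>

locale gauss_channel = prob_space M + rls "Suc n" R
  for M :: "'a measure" and n :: nat and R :: "nat \<Rightarrow> real mat" +
  fixes W N :: "nat \<Rightarrow> 'a \<Rightarrow> real"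
  assumes W_dist: "distributed M (lborel_pow (Suc n)) (rvec {..<Suc n} W)
      (\<lambda>w. ennreal (\<Prod>i<Suc n. std_normal_density (w i)))"
    and N_indep: "indep_vars (\<lambda>_. borel) N UNIV"
    and N_dist: "\<And>t. distributed M lborel (N t) std_normal_density"
    and WN_indep: "indep_var (Pi\<^sub>M {..<Suc n} (\<lambda>_. borel)) (rvec {..<Suc n} W)
      (Pi\<^sub>M UNIV (\<lambda>_. borel)) (rvec UNIV N)"
begin

definition wv :: "(nat \<Rightarrow> real) \<Rightarrow> real vec" where "wv w = vec (Suc n) w"

lemma wv[simp]: "wv w \<in> carrier_vec (Suc n)" "dim_vec (wv w) = Suc n"
  by (auto simp: wv_def)

definition Y :: "nat \<Rightarrow> 'a \<Rightarrow> real" where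
  "Y t \<omega> = g t \<bullet> wv (\<lambda>i. W i \<omega>) + N t \<omega>"

text \<open>Testing against \<open>a\<close> reduces the vector-valued error to scalar inner
  products. The choice \<open>unit_vec\<close> gives its entries, \<open>g t\<close> its
  contribution to the innovation, and \<open>r t\<close>, introduced below, the prediction error of
  the source.\<close>

definition err :: "nat \<Rightarrow> real vec \<Rightarrow> 'a \<Rightarrow> real" where
  "err t a \<omega> = a \<bullet> (wv (\<lambda>i. W i \<omega>) - est (\<lambda>s. Y s \<omega>) t)"

definition I :: "nat \<Rightarrow> 'a \<Rightarrow> real" where
  "I t \<omega> = inn (\<lambda>s. Y s \<omega>) t"

lemma I_eq: "I t \<omega> = err t (g t) \<omega> + N t \<omega>"
  by (simp add: I_def err_def inn_def Y_def scalar_prod_minus_distrib[of _ "Suc n"])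

lemma err_Suc:
  assumes a: "a \<in> carrier_vec (Suc n)"
  shows "err (Suc t) a \<omega> = err t a \<omega> - a \<bullet> (P t *\<^sub>v g t) / K t * I t \<omega>"
  using a by (simp add: err_def I_def inn_def scalar_prod_minus_distrib[of _ "Suc n"]
      scalar_prod_add_distrib[of _ "Suc n"])

lemma N_rvec: "distributed M (lborel_pow k) (rvec {..<k} N)
    (\<lambda>v. ennreal (\<Prod>t<k. std_normal_density (v t)))"
  using N_dist by (intro distributed_rvec_indep indep_vars_subset[OF N_indep]) auto

lemma W_N_measurable[measurable]: "i \<le> n \<Longrightarrow> W i \<in> borel_measurable M" "N t \<in> borel_measurable M"
proof -
  show "N t \<in> borel_measurable M"
    using distributed_measurable[OF N_dist[of t]] by simp
  assume i: "i \<le> n"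
  have "(\<lambda>\<omega>. rvec {..<Suc n} W \<omega> i) \<in> borel_measurable M"
    using i by (intro measurable_compose[OF distributed_measurable[OF W_dist]]) auto
  then show "W i \<in> borel_measurable M" using i by (simp add: rvec_def cong: measurable_cong)
qed

lemma W_moments:
  assumes "i < Suc n" "j < Suc n"
  shows "ip (W i) (W j) = (if i = j then 1 else 0)" "ip (W i) (\<lambda>_. 1) = 0"
  using distributed_rvec_std_normal_covariance[OF W_dist assms] by (auto simp: ip_def)

lemma sq_integrable_W: "i < Suc n \<Longrightarrow> sq_integrable (W i)"
  using distributed_rvec_std_normal_covariance[OF W_dist, of i i]
  by (auto simp: sq_integrable_def power2_eq_square)

lemma N_moments:
  "sq_integrable (N s)" "ip (N s) (N t) = (if s = t then 1 else 0)" "ip (N s) (\<lambda>_. 1) = 0"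
  using distributed_rvec_std_normal_covariance[OF N_rvec[of "Suc (max s t)"], of s t]
    distributed_rvec_std_normal_covariance[OF N_rvec[of "Suc s"], of s s]
  by (auto simp: sq_integrable_def ip_def power2_eq_square less_Suc_eq_le)

lemma W_N_indep: "indep_var (lborel_pow (Suc n)) (rvec {..<Suc n} W) (lborel_pow k) (rvec {..<k} N)"
proof -
  have "indep_var (lborel_pow (Suc n)) (id \<circ> rvec {..<Suc n} W)
      (lborel_pow k) ((\<lambda>v. restrict v {..<k}) \<circ> rvec UNIV N)"
  proof (rule indep_var_compose[OF WN_indep])
    have "sets (Pi\<^sub>M {..<Suc n} (\<lambda>_. borel :: real measure)) = sets (lborel_pow (Suc n))"
      by (intro sets_PiM_cong) auto
    from measurable_cong_sets[OF this refl]
    show "id \<in> measurable (Pi\<^sub>M {..<Suc n} (\<lambda>_. borel)) (lborel_pow (Suc n))"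
      by (simp add: id_def)
    show "(\<lambda>v. restrict v {..<k}) \<in> measurable (Pi\<^sub>M UNIV (\<lambda>_. borel)) (lborel_pow k)"
      by (rule measurable_restrict) (simp add: measurable_component_singleton)
  qed
  moreover have "(\<lambda>v. restrict v {..<k}) \<circ> rvec UNIV N = rvec {..<k} N"
    by (auto simp: rvec_def fun_eq_iff)
  ultimately show ?thesis by simp
qed

lemma ip_W_N:
  assumes i: "i < Suc n"
  shows "ip (W i) (N t) = 0"
proof -
  have "indep_var borel ((\<lambda>w. w i) \<circ> rvec {..<Suc n} W) borel ((\<lambda>v. v t) \<circ> rvec {..<Suc t} N)"
    using i by (intro indep_var_compose[OF W_N_indep]) auto
  then have "indep_var borel (W i) borel (N t)"
    using i by (simp add: comp_def rvec_def)
  then have "(\<integral>\<omega>. W i \<omega> * N t \<omega> \<partial>M) = (\<integral>\<omega>. W i \<omega> \<partial>M) * (\<integral>\<omega>. N t \<omega> \<partial>M)"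
    by (rule indep_var_lebesgue_integral)
      (use sq_integrable_W[OF i] N_moments in \<open>auto intro: sq_integrable_integrable\<close>)
  then show ?thesis using W_moments[OF i i] by (simp add: ip_def)
qed

lemma scalar_prod_W_eq:
  "a \<in> carrier_vec (Suc n) \<Longrightarrow> a \<bullet> wv (\<lambda>i. W i \<omega>) = (\<Sum>i<Suc n. a $ i * W i \<omega>)"
  by (simp add: scalar_prod_def wv_def atLeast0LessThan)

lemma err_0: "a \<in> carrier_vec (Suc n) \<Longrightarrow> err 0 a \<omega> = (\<Sum>i<Suc n. a $ i * W i \<omega>)"
  unfolding scalar_prod_W_eq[symmetric]
  by (simp add: err_def scalar_prod_minus_distrib[of _ "Suc n"])

lemma sq_integrable_err: "a \<in> carrier_vec (Suc n) \<Longrightarrow> sq_integrable (err t a)"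
proof (induction t arbitrary: a)
  case 0
  then show ?case unfolding err_0[OF 0, abs_def]
    by (intro sq_integrable_intros sq_integrable_W) auto
next
  case (Suc t)
  then show ?case unfolding err_Suc[OF Suc.prems, abs_def] I_eq
    by (intro sq_integrable_intros Suc.IH N_moments) auto
qed

lemma sq_integrable_I: "sq_integrable (I t)"
  unfolding I_eq[abs_def] by (intro sq_integrable_intros sq_integrable_err N_moments) auto

lemmas sq_simps = sq_integrable_err sq_integrable_I sq_integrable_W N_moments(1)
  sq_integrable_intros

lemma ip_err_step:
  assumes "a \<in> carrier_vec (Suc n)" "sq_integrable f"
  shows "ip (err (Suc t) a) f = ip (err t a) f - a \<bullet> (P t *\<^sub>v g t) / K t * ip (I t) f"
  unfolding err_Suc[OF assms(1), abs_def] using assms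
  by (subst ip_diff) (simp_all add: ip_scale sq_simps del: times_divide_eq_left)

lemma ip_I_step:
  assumes "sq_integrable f"
  shows "ip (I t) f = ip (err t (g t)) f + ip (N t) f"
  unfolding I_eq[abs_def] using assms by (simp add: ip_add sq_simps)

text \<open>The error at time \<open>t\<close> is built from \<open>W\<close> and the noise strictly
  before \<open>t\<close>; the noise at time \<open>t\<close> first enters at
  \<open>Suc t\<close>.\<close>

lemma ip_err_N: "a \<in> carrier_vec (Suc n) \<Longrightarrow> t \<le> s \<Longrightarrow> ip (err t a) (N s) = 0"
proof (induction t arbitrary: a)
  case 0
  then show ?case unfolding err_0[OF 0(1), abs_def]
    by (subst ip_sum) (auto simp: sq_simps ip_scale ip_W_N simp del: sum.lessThan_Suc)
next
  case (Suc t)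
  then show ?case by (simp add: ip_err_step ip_I_step sq_simps N_moments)
qed

lemma ip_I_N: "t < s \<Longrightarrow> ip (I t) (N s) = 0"
  by (simp add: ip_I_step sq_simps ip_err_N N_moments)

text \<open>The gain makes the new error orthogonal to the newest innovation, so the update of the
  covariance collapses to the single correction term of \<open>P_step\<close>.\<close>

lemma ip_err_err:
  assumes "a \<in> carrier_vec (Suc n)" "b \<in> carrier_vec (Suc n)"
  shows "ip (err t a) (err t b) = a \<bullet> (P t *\<^sub>v b)"
  using assms
proof (induction t arbitrary: a b)
  case 0
  have "ip (err 0 a) (err 0 b) = (\<Sum>i<Suc n. a $ i * ip (W i) (err 0 b))"
    unfolding err_0[OF 0(1), abs_def] using 0
    by (subst ip_sum) (auto simp: sq_simps ip_scale simp del: sum.lessThan_Suc)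
  also have "\<dots> = (\<Sum>i<Suc n. a $ i * (\<Sum>j<Suc n. b $ j * ip (W j) (W i)))"
  proof (intro sum.cong refl arg_cong[of _ _ "\<lambda>x. _ * x"])
    fix i assume "i \<in> {..<Suc n}"
    then show "ip (W i) (err 0 b) = (\<Sum>j<Suc n. b $ j * ip (W j) (W i))"
      unfolding err_0[OF 0(2), abs_def]
      by (subst ip_commute, subst ip_sum) (auto simp: sq_simps ip_scale simp del: sum.lessThan_Suc)
  qed
  also have "\<dots> = (\<Sum>i<Suc n. a $ i * b $ i)"
  proof (intro sum.cong refl arg_cong[of _ _ "\<lambda>x. _ * x"])
    fix i assume i: "i \<in> {..<Suc n}"
    have "(\<Sum>j<Suc n. b $ j * ip (W j) (W i)) = (\<Sum>j<Suc n. if j = i then b $ j else 0)"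
      using i by (intro sum.cong) (auto simp: W_moments)
    also have "\<dots> = b $ i" using i by simp
    finally show "(\<Sum>j<Suc n. b $ j * ip (W j) (W i)) = b $ i" .
  qed
  also have "\<dots> = a \<bullet> (P 0 *\<^sub>v b)"
    using 0 by (simp add: scalar_prod_def atLeast0LessThan)
  finally show ?case .
next
  case (Suc t)
  let ?Pg = "P t *\<^sub>v g t"
  \<comment> \<open>These facts at time \<open>t\<close> rest on the induction hypothesis, and their
    general forms below rest on this lemma, so they are proved locally.\<close>
  have I_err: "ip (I t) (err t c) = c \<bullet> ?Pg" if c: "c \<in> carrier_vec (Suc n)" for c
  proof -
    have "ip (N t) (err t c) = 0" using ip_err_N[OF c, of t t] by (metis ip_commute order_refl)
    then show ?thesis
      using c Suc.IH[of "g t" c] by (simp add: ip_I_step sq_simps P_sym[of c "g t"])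
  qed
  have I_err': "ip (err t c) (I t) = c \<bullet> ?Pg" if c: "c \<in> carrier_vec (Suc n)" for c
    using I_err[OF c] by (simp add: ip_commute)
  have I_I: "ip (I t) (I t) = K t"
  proof -
    have "ip (N t) (I t) = ip (I t) (N t)" by (rule ip_commute)
    also have "\<dots> = 1" by (simp add: ip_I_step sq_simps ip_err_N N_moments)
    finally show ?thesis
      using ip_I_step[OF sq_integrable_I, of t t] by (simp add: I_err' K_def)
  qed
  have "ip (err (Suc t) a) (err (Suc t) b) =
      ip (err t a) (err (Suc t) b) - a \<bullet> ?Pg / K t * ip (I t) (err (Suc t) b)"
    using Suc.prems by (simp add: ip_err_step sq_simps)
  also have "ip (err t a) (err (Suc t) b) = a \<bullet> (P t *\<^sub>v b) - b \<bullet> ?Pg / K t * (a \<bullet> ?Pg)"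
    using Suc.prems by (subst ip_commute)
      (simp add: ip_err_step sq_simps I_err Suc.IH P_sym[of b a])
  also have "ip (I t) (err (Suc t) b) = 0"
    using Suc.prems by (subst ip_commute)
      (simp add: ip_err_step sq_simps I_err' I_I)
  finally show ?case
    using Suc.prems P_sym[of "g t" b t]
    by (simp add: P_step scalar_prod_minus_distrib[of _ "Suc n"] del: P.simps)
qed

lemma ip_err_I_same:
  assumes a: "a \<in> carrier_vec (Suc n)"
  shows "ip (err t a) (I t) = a \<bullet> (P t *\<^sub>v g t)"
proof -
  have "ip (N t) (err t a) = 0" using ip_err_N[OF a, of t t] by (metis ip_commute order_refl)
  then have "ip (I t) (err t a) = a \<bullet> (P t *\<^sub>v g t)"
    using a by (simp add: ip_I_step sq_simps ip_err_err P_sym[of a "g t"])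
  then show ?thesis by (simp add: ip_commute)
qed

lemma ip_I_I: "ip (I t) (I t) = K t"
proof -
  have "ip (N t) (I t) = ip (I t) (N t)" by (rule ip_commute)
  also have "\<dots> = 1" by (simp add: ip_I_step sq_simps ip_err_N N_moments)
  finally show ?thesis
    using ip_I_step[OF sq_integrable_I, of t t] by (simp add: ip_err_I_same K_def)
qed

text \<open>The gain removes the newest innovation from the error. Older ones stay orthogonal by
  induction, because the subtracted innovation consists of an error and of noise that is
  uncorrelated with the past.\<close>

lemma ip_err_I: "a \<in> carrier_vec (Suc n) \<Longrightarrow> s < t \<Longrightarrow> ip (err t a) (I s) = 0"
  and ip_I_I_0: "s < t \<Longrightarrow> ip (I t) (I s) = 0"
proof -
  have *: "\<forall>a\<in>carrier_vec (Suc n). \<forall>s<t. ip (err t a) (I s) = 0" for t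
  proof (induction t)
    case (Suc t)
    show ?case
    proof (intro ballI allI impI)
      fix a :: "real vec" and s assume a: "a \<in> carrier_vec (Suc n)" and s: "s < Suc t"
      show "ip (err (Suc t) a) (I s) = 0"
      proof (cases "s = t")
        case True
        then show ?thesis using a by (simp add: ip_err_step sq_simps ip_err_I_same ip_I_I)
      next
        case False
        then have "s < t" using s by simp
        moreover have "ip (N t) (I s) = 0" using ip_I_N[OF \<open>s < t\<close>] by (simp add: ip_commute)
        ultimately show ?thesis using Suc a by (simp add: ip_err_step ip_I_step sq_simps)
      qed
    qed
  qed simp
  then show "a \<in> carrier_vec (Suc n) \<Longrightarrow> s < t \<Longrightarrow> ip (err t a) (I s) = 0" by blast
  assume st: "s < t"
  then have "ip (N t) (I s) = 0" using ip_I_N[OF st] by (simp add: ip_commute)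
  then show "ip (I t) (I s) = 0" using * st by (simp add: ip_I_step sq_simps)
qed

lemma mean_err: "a \<in> carrier_vec (Suc n) \<Longrightarrow> (\<integral>\<omega>. err t a \<omega> \<partial>M) = 0"
  and mean_I: "(\<integral>\<omega>. I t \<omega> \<partial>M) = 0"
proof -
  have *: "a \<in> carrier_vec (Suc n) \<Longrightarrow> ip (err t a) (\<lambda>_. 1) = 0" for a t
  proof (induction t arbitrary: a)
    case 0
    then show ?case unfolding err_0[OF 0, abs_def]
      by (subst ip_sum) (auto simp: sq_simps ip_scale W_moments simp del: sum.lessThan_Suc)
  next
    case (Suc t)
    then show ?case by (simp add: ip_err_step ip_I_step sq_simps N_moments)
  qed
  then show "a \<in> carrier_vec (Suc n) \<Longrightarrow> (\<integral>\<omega>. err t a \<omega> \<partial>M) = 0" by (simp add: ip_def)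
  have "ip (I t) (\<lambda>_. 1) = 0" by (simp add: ip_I_step * sq_simps N_moments)
  then show "(\<integral>\<omega>. I t \<omega> \<partial>M) = 0" by (simp add: ip_def)
qed

end

section \<open>Causality and measurability of estimates and innovations\<close>

context rls
begin

lemma est_cong: "(\<And>s. s < t \<Longrightarrow> y s = y' s) \<Longrightarrow> est y t = est y' t"
  by (induction t) auto

lemma inn_cong: "(\<And>s. s \<le> t \<Longrightarrow> y s = y' s) \<Longrightarrow> inn y t = inn y' t"
  using est_cong[of t y y'] by (simp add: inn_def)

text \<open>The estimate at time \<open>t\<close> is a one-step prediction. This strictly causal
  linear form yields both its measurability and the unit triangular shape of the
  innovations.\<close>

lemma est_lin_span:
  "a \<in> carrier_vec d \<Longrightarrow> lin_span (\<lambda>s w. y w s) t (\<lambda>w. a \<bullet> est (y w) t)"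
proof (induction t arbitrary: a)
  case 0
  then show ?case by (simp add: lin_span_zero)
next
  case (Suc t)
  let ?c = "(a \<bullet> (P t *\<^sub>v g t)) / K t"
  have "lin_span (\<lambda>s w. y w s) (Suc t)
      (\<lambda>w. a \<bullet> est (y w) t + ?c * (y w t - g t \<bullet> est (y w) t))"
    using Suc by (intro lin_span_add lin_span_scale lin_span_diff lin_span_base[of t "Suc t" "\<lambda>s w. y w s"])
      (auto intro: lin_span_mono[of _ t])
  moreover have "a \<bullet> est y' (Suc t) = a \<bullet> est y' t + ?c * (y' t - g t \<bullet> est y' t)" for y'
    using Suc.prems by (simp add: scalar_prod_add_distrib[of _ d])
  ultimately show ?case by (simp del: est.simps)
qed

lemma inn_unit_tri: "unit_tri k (\<lambda>t w. inn (y w) t) (\<lambda>t w. y w t)"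
  unfolding unit_tri_def
proof (intro allI impI)
  fix t
  have "lin_span (\<lambda>t w. y w t) t (\<lambda>w. - 1 * (g t \<bullet> est (y w) t))"
    by (intro lin_span_scale est_lin_span) simp
  then show "lin_span (\<lambda>t w. y w t) t (\<lambda>w. inn (y w) t - y w t)" by (simp add: inn_def)
qed

lemma est_measurable:
  assumes "\<And>s. s < t \<Longrightarrow> (\<lambda>x. y x s) \<in> borel_measurable S" and a: "a \<in> carrier_vec d"
  shows "(\<lambda>x. a \<bullet> est (y x) t) \<in> borel_measurable S"
proof -
  obtain c where "\<And>x. a \<bullet> est (y x) t = (\<Sum>s<t. c s * y x s)"
    using est_lin_span[OF a, where y = y and t = t] unfolding lin_span_def by blast
  then show ?thesis using assms(1) by simp
qed

lemma est_index_measurable: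
  assumes "\<And>s. s < t \<Longrightarrow> (\<lambda>x. y x s) \<in> borel_measurable S" and i: "i < d"
  shows "(\<lambda>x. est (y x) t $ i) \<in> borel_measurable S"
proof -
  have "unit_vec d i \<bullet> est (y x) t = est (y x) t $ i" for x
    using i by (intro scalar_prod_left_unit) auto
  then show ?thesis
    using est_measurable[of t y S "unit_vec d i", OF assms(1) unit_vec_carrier] by (simp only:)
qed

lemma inn_measurable:
  assumes "\<And>s. s \<le> t \<Longrightarrow> (\<lambda>x. y x s) \<in> borel_measurable S"
  shows "(\<lambda>x. inn (y x) t) \<in> borel_measurable S"
  unfolding inn_def using assms by (intro borel_measurable_diff est_measurable) auto

end

lemma prod_std_normal_density:
  assumes "finite I"
  shows "(\<Prod>i\<in>I. std_normal_density (f i)) =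
    (1 / sqrt (2 * pi)) ^ card I * exp (- (\<Sum>i\<in>I. (f i)\<^sup>2) / 2)"
  using assms
  by (simp add: std_normal_density_def prod.distrib prod_dividef exp_sum[symmetric] sum_negf
      sum_divide_distrib power_divide)

section \<open>Joint density of message and observations, and the conditional mean\<close>

context gauss_channel
begin

abbreviation "lw \<equiv> lborel_pow (Suc n)"

definition dens :: "nat \<Rightarrow> (nat \<Rightarrow> real) \<Rightarrow> (nat \<Rightarrow> real) \<Rightarrow> real" where
  "dens k w y = (\<Prod>i<Suc n. std_normal_density (w i)) *
     (\<Prod>t<k. std_normal_density (y t - g t \<bullet> wv w))"

lemma dens_pos: "0 < dens k w y"
  unfolding dens_def by (intro mult_pos_pos prod_pos normal_density_pos) auto

lemma scalar_prod_wv: "a \<in> carrier_vec (Suc n) \<Longrightarrow> a \<bullet> wv w = (\<Sum>i<Suc n. a $ i * w i)"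
  by (simp add: scalar_prod_def wv_def atLeast0LessThan)

lemma wv_measurable:
  assumes "\<And>i. i \<le> n \<Longrightarrow> (\<lambda>x. w x i) \<in> borel_measurable S" "a \<in> carrier_vec (Suc n)"
  shows "(\<lambda>x. a \<bullet> wv (w x)) \<in> borel_measurable S"
  unfolding scalar_prod_wv[OF assms(2)] using assms(1) by auto

lemma component_measurable:
  "f \<in> measurable S (lborel_pow k) \<Longrightarrow> i < k \<Longrightarrow> (\<lambda>x. f x i) \<in> borel_measurable S"
  using measurable_compose[of f S "lborel_pow k" "\<lambda>x. x i" lborel] by simp

lemma dens_measurable[measurable]:
  "(\<lambda>z. dens k (fst z) (snd z)) \<in> borel_measurable (lw \<Otimes>\<^sub>M lborel_pow k)"
  unfolding dens_def
  by (intro borel_measurable_times borel_measurable_prod measurable_compose[OF _ borel_measurable_normal_density]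
      borel_measurable_diff wv_measurable component_measurable[OF measurable_fst]
      component_measurable[OF measurable_snd]) auto

lemma wv_rvec: "wv (rvec {..<Suc n} X \<omega>) = wv (\<lambda>i. X i \<omega>)"
  unfolding wv_def by (rule eq_vecI) (auto simp: rvec_def)

lemma Y_measurable[measurable]: "Y t \<in> borel_measurable M"
  unfolding Y_def[abs_def] by (intro borel_measurable_add wv_measurable) auto

text \<open>For a fixed message the observations are translated noise, so the independent pair of
  message and noise is moved by a fibrewise measure-preserving map. The sign of the translation
  gives the map and its inverse in one definition.\<close>

lemma joint_W_Y:
  "distributed M (lw \<Otimes>\<^sub>M lborel_pow k) (\<lambda>\<omega>. (rvec {..<Suc n} W \<omega>, rvec {..<k} Y \<omega>))
     (\<lambda>z. ennreal (dens k (fst z) (snd z)))"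
proof -
  let ?S = "lw \<Otimes>\<^sub>M lborel_pow k"
  let ?T = "\<lambda>\<sigma> w. tri_map k 1 (\<lambda>t. \<sigma> * (g t \<bullet> wv w)) (\<lambda>_ _. 0)"
  let ?\<Phi> = "\<lambda>\<sigma> z. (fst z, ?T \<sigma> (fst z) (snd z))"
  have T: "(\<lambda>z. ?T \<sigma> (fst z) (snd z)) \<in> measurable ?S (lborel_pow k)" for \<sigma>
    by (intro measurable_tri_map borel_measurable_times borel_measurable_const wv_measurable
        component_measurable[OF measurable_fst]) auto
  have \<Phi>: "?\<Phi> \<sigma> \<in> measurable ?S ?S" for \<sigma>
    using T by measurable
  have "distributed M ?S (\<lambda>\<omega>. (rvec {..<Suc n} W \<omega>, rvec {..<k} N \<omega>))
      (\<lambda>(w, v). ennreal (\<Prod>i<Suc n. std_normal_density (w i)) *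
        ennreal (\<Prod>t<k. std_normal_density (v t)))"
    by (rule distributed_joint_indep[OF sigma_finite_lborel_pow sigma_finite_lborel_pow
          W_dist N_rvec W_N_indep])
  from distributed_bij[OF this \<Phi>[of 1] \<Phi>[of "-1"]]
  have "distributed M ?S (\<lambda>\<omega>. ?\<Phi> 1 (rvec {..<Suc n} W \<omega>, rvec {..<k} N \<omega>))
      (\<lambda>z. case ?\<Phi> (-1) z of (w, v) \<Rightarrow> ennreal (\<Prod>i<Suc n. std_normal_density (w i)) *
        ennreal (\<Prod>t<k. std_normal_density (v t)))"
  proof this
    fix z assume "z \<in> space ?S"
    then have "snd z \<in> extensional {..<k}" by (auto simp: space_pair_measure space_PiM PiE_def)
    then show "?\<Phi> (-1) (?\<Phi> 1 z) = z"
      by (cases z) (auto simp: tri_map_def fun_eq_iff extensional_def)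
  next
    show "distr ?S ?S (?\<Phi> 1) = ?S"
      by (rule distr_pair_fibrewise[OF sigma_finite_lborel_pow T]) (simp add: distr_tri_map)
  qed
  moreover have "?\<Phi> 1 (rvec {..<Suc n} W \<omega>, rvec {..<k} N \<omega>) =
      (rvec {..<Suc n} W \<omega>, rvec {..<k} Y \<omega>)" for \<omega>
    by (auto simp: tri_map_def wv_rvec[unfolded rvec_def] fun_eq_iff Y_def rvec_def)
  moreover have "(case ?\<Phi> (-1) z of (w, v) \<Rightarrow> ennreal (\<Prod>i<Suc n. std_normal_density (w i)) *
        ennreal (\<Prod>t<k. std_normal_density (v t))) = ennreal (dens k (fst z) (snd z))" for z
  proof -
    have "(\<Prod>t<k. std_normal_density (?T (-1) (fst z) (snd z) t)) =
        (\<Prod>t<k. std_normal_density (snd z t - g t \<bullet> wv (fst z)))"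
      by (intro prod.cong) (auto simp: tri_map_def)
    then show ?thesis
      by (simp add: dens_def ennreal_mult' prod_nonneg split_beta del: prod.lessThan_Suc)
  qed
  ultimately show ?thesis by simp
qed

lemma dens_completed:
  "dens k w y = (1 / sqrt (2 * pi)) ^ (Suc n + k) *
     exp (- ((wv w - est y k) \<bullet> (J k *\<^sub>v (wv w - est y k))) / 2) *
     exp (- (\<Sum>t<k. (inn y t)\<^sup>2 / K t) / 2)"
proof -
  have "wv w \<bullet> wv w = (\<Sum>i<Suc n. (w i)\<^sup>2)"
    by (simp add: scalar_prod_wv del: sum.lessThan_Suc) (simp add: wv_def power2_eq_square)
  then have "(\<Sum>i<Suc n. (w i)\<^sup>2) + (\<Sum>t<k. (y t - g t \<bullet> wv w)\<^sup>2) =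
      (wv w - est y k) \<bullet> (J k *\<^sub>v (wv w - est y k)) + (\<Sum>t<k. (inn y t)\<^sup>2 / K t)"
    using completed_square[of "wv w" y k] by simp
  then have "exp (- (\<Sum>i<Suc n. (w i)\<^sup>2) / 2) * exp (- (\<Sum>t<k. (y t - g t \<bullet> wv w)\<^sup>2) / 2) =
      exp (- ((wv w - est y k) \<bullet> (J k *\<^sub>v (wv w - est y k))) / 2) *
      exp (- (\<Sum>t<k. (inn y t)\<^sup>2 / K t) / 2)"
    by (simp only: exp_add[symmetric]) (rule arg_cong[of _ _ exp], linarith)
  then show ?thesis
    unfolding dens_def by (subst (1 2) prod_std_normal_density)
      (simp_all add: power_add mult_ac del: sum.lessThan_Suc power_Suc add_Suc)
qed

text \<open>The reflection sends \<open>w\<close> to \<open>2 * est - w\<close>; the completed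
  square is even in \<open>w - est\<close>.\<close>

lemma dens_reflect:
  "dens k (tri_map (Suc n) (-1) (\<lambda>i. 2 * est y k $ i) (\<lambda>_ _. 0) w) y = dens k w y"
proof -
  have "wv (tri_map (Suc n) (-1) (\<lambda>i. 2 * est y k $ i) (\<lambda>_ _. 0) w) - est y k = - (wv w - est y k)"
    by (rule eq_vecI) (auto simp: wv_def tri_map_def)
  moreover have "(- v) \<bullet> (J k *\<^sub>v (- v)) = v \<bullet> (J k *\<^sub>v v)" if "v \<in> carrier_vec (Suc n)" for v
  proof -
    have "- v = (-1) \<cdot>\<^sub>v v" by (rule eq_vecI) auto
    then show ?thesis using that by (simp add: mult_mat_vec[of _ "Suc n" "Suc n"])
  qed
  ultimately show ?thesis unfolding dens_completed by simp
qed

lemma err_index: "i < Suc n \<Longrightarrow> err k (unit_vec (Suc n) i) \<omega> = W i \<omega> - est (\<lambda>s. Y s \<omega>) k $ i"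
  by (simp add: err_def wv_def)

text \<open>The joint density and Lebesgue measure are invariant under reflecting \<open>w\<close> about \<open>est y k\<close>, so the
  estimation error integrates to zero over every event determined by the observations; no
  conditional law is needed.\<close>

lemma real_cond_exp_W:
  assumes i: "i < Suc n"
  shows "AE \<omega> in M. real_cond_exp M (obs_algebra M {..<k} Y) (W i) \<omega> = est (\<lambda>s. Y s \<omega>) k $ i"
proof -
  let ?S = "lw \<Otimes>\<^sub>M lborel_pow k"
  let ?F = "obs_algebra M {..<k} Y"
  let ?\<mu> = "\<lambda>\<omega>. est (\<lambda>s. Y s \<omega>) k $ i"
  have "sets (lborel_pow k) = sets (Pi\<^sub>M {..<k} (\<lambda>_. borel :: real measure))"
    by (intro sets_PiM_cong) auto
  note borel_eq = this measurable_cong_sets[OF this refl] measurable_cong_sets[OF refl this]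
  have Yv: "rvec {..<k} Y \<in> measurable M (lborel_pow k)"
    unfolding rvec_def by (intro measurable_restrict) auto
  have rv: "rvec {..<k} Y \<in> space M \<rightarrow> space (Pi\<^sub>M {..<k} (\<lambda>_. borel))"
    by (auto simp: rvec_def space_PiM)
  interpret F: finite_measure_subalgebra M ?F
  proof
    show "subalgebra M ?F"
      unfolding subalgebra_def obs_algebra_def
      using Yv by (auto simp: borel_eq sets_vimage_algebra2[OF rv] intro: measurable_sets)
  qed
  have YF: "rvec {..<k} Y \<in> measurable ?F (lborel_pow k)"
    unfolding obs_algebra_def borel_eq(3) using rv by (rule measurable_vimage_algebra1)
  have YF': "Y s \<in> borel_measurable ?F" if "s < k" for s
    using component_measurable[OF YF that] that by (simp add: rvec_def)
  have \<mu>F: "?\<mu> \<in> borel_measurable ?F"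
    by (rule est_index_measurable) (use YF' i in auto)
  have \<mu>: "integrable M ?\<mu>"
  proof -
    have "integrable M (\<lambda>\<omega>. W i \<omega> - err k (unit_vec (Suc n) i) \<omega>)"
      using i by (intro sq_integrable_integrable sq_integrable_diff sq_integrable_W sq_integrable_err) auto
    then show ?thesis by (simp add: err_index i)
  qed
  have W: "integrable M (W i)" using sq_integrable_W[OF i] by (rule sq_integrable_integrable)
  show ?thesis
  proof (rule F.real_cond_exp_charact)
    fix A assume A: "A \<in> sets ?F"
    then obtain B where B[measurable]: "B \<in> sets (lborel_pow k)"
      and AB: "A = rvec {..<k} Y -` B \<inter> space M"
      unfolding obs_algebra_def sets_vimage_algebra2[OF rv] borel_eq by auto
    have [measurable]: "A \<in> sets M" unfolding AB using Yv by measurable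
    let ?h = "\<lambda>z. (fst z i - est (snd z) k $ i) * indicator B (snd z) :: real"
    have h[measurable]: "?h \<in> borel_measurable ?S"
    proof (intro borel_measurable_times borel_measurable_diff)
      show "(\<lambda>z. fst z i) \<in> borel_measurable ?S"
        using i by (intro component_measurable[OF measurable_fst]) auto
      show "(\<lambda>z. est (snd z) k $ i) \<in> borel_measurable ?S"
        by (rule est_index_measurable) (use i in \<open>auto intro: component_measurable[OF measurable_snd]\<close>)
    qed measurable
    have hW: "?h (rvec {..<Suc n} W \<omega>, rvec {..<k} Y \<omega>) = indicator A \<omega> * (W i \<omega> - ?\<mu> \<omega>)"
      if "\<omega> \<in> space M" for \<omega>
    proof -
      have "est (rvec {..<k} Y \<omega>) k = est (\<lambda>s. Y s \<omega>) k"
        by (rule est_cong) (simp add: rvec_def)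
      then show ?thesis using i that by (auto simp: rvec_def AB indicator_def)
    qed
    have int: "integrable M (\<lambda>\<omega>. indicator A \<omega> * (W i \<omega> - ?\<mu> \<omega>))"
    proof -
      have "integrable M (\<lambda>\<omega>. W i \<omega> - ?\<mu> \<omega>)"
        by (rule Bochner_Integration.integrable_diff[OF W \<mu>])
      with \<open>A \<in> sets M\<close> have "integrable M (\<lambda>\<omega>. (W i \<omega> - ?\<mu> \<omega>) * indicator A \<omega>)"
        by (rule integrable_real_mult_indicator)
      then show ?thesis by (simp only: mult.commute)
    qed
    then have "integrable M (\<lambda>\<omega>. ?h (rvec {..<Suc n} W \<omega>, rvec {..<k} Y \<omega>))"
      by (subst Bochner_Integration.integrable_cong[OF refl hW]) auto
    then have int_h: "integrable ?S (\<lambda>z. dens k (fst z) (snd z) * ?h z)"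
      using distributed_integrable[OF joint_W_Y h] dens_pos[of k] by (simp add: less_imp_le)
    interpret ST: pair_sigma_finite lw "lborel_pow k"
      by (simp add: pair_sigma_finite_def sigma_finite_lborel_pow)
    have inner: "(\<integral>w. dens k w y * ?h (w, y) \<partial>lw) = 0" if y: "y \<in> space (lborel_pow k)" for y
    proof -
      let ?r = "tri_map (Suc n) (-1) (\<lambda>i. 2 * est y k $ i) (\<lambda>_ _. 0)"
      have "(\<lambda>w. (w, y)) \<in> measurable lw ?S"
        using y by measurable
      then have "(\<lambda>w. dens k w y * ?h (w, y)) \<in> borel_measurable lw"
        using measurable_compose[of "\<lambda>w. (w, y)" lw ?S "\<lambda>z. dens k (fst z) (snd z) * ?h z" borel]
        by (simp add: borel_measurable_integrable[OF int_h])
      then have "(\<integral>w. dens k w y * ?h (w, y) \<partial>lw) = (\<integral>w. dens k (?r w) y * ?h (?r w, y) \<partial>lw)"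
        by (intro integral_tri_map[symmetric]) auto
      also have "\<dots> = (\<integral>w. - (dens k w y * ?h (w, y)) \<partial>lw)"
        using i by (intro Bochner_Integration.integral_cong)
          (auto simp: dens_reflect, auto simp: tri_map_def algebra_simps)
      finally show ?thesis by simp
    qed
    have "(\<integral>\<omega>. indicator A \<omega> * (W i \<omega> - ?\<mu> \<omega>) \<partial>M) =
        (\<integral>\<omega>. ?h (rvec {..<Suc n} W \<omega>, rvec {..<k} Y \<omega>) \<partial>M)"
      by (rule Bochner_Integration.integral_cong[OF refl hW[symmetric]])
    also have "\<dots> = (\<integral>z. dens k (fst z) (snd z) * ?h z \<partial>?S)"
      using dens_pos[of k] by (intro distributed_integral[OF joint_W_Y h, symmetric]) (simp add: less_imp_le)
    also have "\<dots> = (\<integral>y. \<integral>w. dens k w y * ?h (w, y) \<partial>lw \<partial>lborel_pow k)"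
      using ST.integral_snd[of "\<lambda>w y. dens k w y * ?h (w, y)"] int_h
      unfolding split_beta' fst_conv snd_conv by simp
    also have "\<dots> = (\<integral>y. 0 \<partial>lborel_pow k)"
      by (rule Bochner_Integration.integral_cong[OF refl inner])
    finally have 0: "(\<integral>\<omega>. indicator A \<omega> * W i \<omega> - indicator A \<omega> * ?\<mu> \<omega> \<partial>M) = 0"
      by (simp add: right_diff_distrib)
    have "integrable M (\<lambda>\<omega>. indicator A \<omega> * W i \<omega>)" "integrable M (\<lambda>\<omega>. indicator A \<omega> * ?\<mu> \<omega>)"
      using integrable_real_mult_indicator[OF \<open>A \<in> sets M\<close> W]
        integrable_real_mult_indicator[OF \<open>A \<in> sets M\<close> \<mu>] by (simp_all only: mult.commute)
    then show "(\<integral>\<omega>\<in>A. W i \<omega> \<partial>M) = (\<integral>\<omega>\<in>A. ?\<mu> \<omega> \<partial>M)"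
      using 0 by (simp add: set_lebesgue_integral_def)
  qed (use W \<mu> \<mu>F in auto)
qed

lemma mmse_mat_eq: "mmse_mat M (Suc n) W {..<k} Y = P k"
proof (rule eq_matI)
  fix i j assume "i < dim_row (P k)" "j < dim_col (P k)"
  then have i: "i < Suc n" and j: "j < Suc n" by auto
  have "(\<integral>\<omega>. (W i \<omega> - real_cond_exp M (obs_algebra M {..<k} Y) (W i) \<omega>) *
        (W j \<omega> - real_cond_exp M (obs_algebra M {..<k} Y) (W j) \<omega>) \<partial>M) =
      ip (err k (unit_vec (Suc n) i)) (err k (unit_vec (Suc n) j))"
    unfolding ip_def
  proof (rule integral_cong_AE)
    show "AE \<omega> in M. (W i \<omega> - real_cond_exp M (obs_algebra M {..<k} Y) (W i) \<omega>) *
        (W j \<omega> - real_cond_exp M (obs_algebra M {..<k} Y) (W j) \<omega>) =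
        err k (unit_vec (Suc n) i) \<omega> * err k (unit_vec (Suc n) j) \<omega>"
      using real_cond_exp_W[OF i, of k] real_cond_exp_W[OF j, of k]
      by eventually_elim (simp add: err_index i j)
  next
    show "(\<lambda>\<omega>. err k (unit_vec (Suc n) i) \<omega> * err k (unit_vec (Suc n) j) \<omega>) \<in> borel_measurable M"
      using sq_integrable_err[of "unit_vec (Suc n) i" k] sq_integrable_err[of "unit_vec (Suc n) j" k]
      by (auto simp: sq_integrable_def)
    show "(\<lambda>\<omega>. (W i \<omega> - real_cond_exp M (obs_algebra M {..<k} Y) (W i) \<omega>) *
        (W j \<omega> - real_cond_exp M (obs_algebra M {..<k} Y) (W j) \<omega>)) \<in> borel_measurable M"
      using i j
      by (intro borel_measurable_times borel_measurable_diff W_N_measurable borel_measurable_cond_exp2) auto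
  qed
  also have "\<dots> = row (P k) i $ j"
    using i j by (simp add: ip_err_err)
  finally show "mmse_mat M (Suc n) W {..<k} Y $$ (i, j) = P k $$ (i, j)"
    using i j by (simp add: mmse_mat_def)
qed (auto simp: mmse_mat_def)

subsection \<open>Law of the observations and mutual information\<close>

text \<open>Under this density the innovations are independent with variances \<open>K t\<close>. It
  is a density in \<open>y\<close> without a Jacobian factor, since \<open>inn\<close> is unit
  triangular in \<open>y\<close>.\<close>

definition innov_dens :: "nat \<Rightarrow> (nat \<Rightarrow> real) \<Rightarrow> real" where
  "innov_dens k y = (\<Prod>t<k. normal_density 0 (sqrt (K t)) (inn y t))"

lemma innov_dens_pos: "0 < innov_dens k y"
  unfolding innov_dens_def by (intro prod_pos normal_density_pos) simp

lemma innov_dens_measurable[measurable]: "innov_dens k \<in> borel_measurable (lborel_pow k)"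
  unfolding innov_dens_def[abs_def]
  by (intro borel_measurable_prod measurable_compose[OF _ borel_measurable_normal_density] inn_measurable
      component_measurable[OF measurable_ident_sets[OF refl]]) auto

lemma innov_dens_exp:
  "exp (- (\<Sum>t<k. (inn y t)\<^sup>2 / K t) / 2) = (\<Prod>t<k. sqrt (2 * pi * K t)) * innov_dens k y"
proof -
  have "(\<Prod>t<k. sqrt (2 * pi * K t)) * innov_dens k y =
      (\<Prod>t<k. sqrt (2 * pi * K t) * normal_density 0 (sqrt (K t)) (inn y t))"
    by (simp add: innov_dens_def prod.distrib)
  also have "\<dots> = (\<Prod>t<k. exp (- ((inn y t)\<^sup>2 / K t) / 2))"
    using K_pos by (intro prod.cong refl) (simp add: normal_density_def less_imp_le field_simps)
  also have "\<dots> = exp (- (\<Sum>t<k. (inn y t)\<^sup>2 / K t) / 2)"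
    by (simp add: exp_sum[symmetric] sum_negf sum_divide_distrib)
  finally show ?thesis ..
qed

lemma nn_integral_innov_dens: "(\<integral>\<^sup>+y. ennreal (innov_dens k y) \<partial>lborel_pow k) = 1"
proof -
  obtain c where c: "\<And>t y. t < k \<Longrightarrow> inn y t = y t + (\<Sum>s<t. c t s * y s)"
    using unit_tri_coeffs[OF inn_unit_tri[of k "\<lambda>y. y"]] by blast
  let ?f = "\<lambda>v. \<Prod>t<k. ennreal (normal_density 0 (sqrt (K t)) (v t))"
  have "(\<integral>\<^sup>+y. ennreal (innov_dens k y) \<partial>lborel_pow k) =
      (\<integral>\<^sup>+y. ?f (tri_map k 1 (\<lambda>_. 0) c y) \<partial>lborel_pow k)"
  proof (rule nn_integral_cong)
    fix y
    have "innov_dens k y = (\<Prod>t<k. normal_density 0 (sqrt (K t)) (tri_map k 1 (\<lambda>_. 0) c y t))"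
      unfolding innov_dens_def by (intro prod.cong) (auto simp: tri_map_def c)
    then show "ennreal (innov_dens k y) = ?f (tri_map k 1 (\<lambda>_. 0) c y)"
      by (simp add: prod_ennreal)
  qed
  also have "\<dots> = (\<integral>\<^sup>+y. ?f y \<partial>lborel_pow k)"
    by (rule nn_integral_tri_map) auto
  also have "\<dots> = (\<Prod>t<k. \<integral>\<^sup>+x. ennreal (normal_density 0 (sqrt (K t)) x) \<partial>lborel)"
    by (rule lborel_pow.product_nn_integral_prod) auto
  also have "\<dots> = 1"
  proof (rule prod.neutral, intro ballI)
    fix t
    interpret D: prob_space "density lborel (\<lambda>x. ennreal (normal_density 0 (sqrt (K t)) x))"
      by (rule prob_space_normal_density) simp
    show "(\<integral>\<^sup>+x. ennreal (normal_density 0 (sqrt (K t)) x) \<partial>lborel) = 1"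
      using D.emeasure_space_1 by (simp add: emeasure_density)
  qed
  finally show ?thesis .
qed

text \<open>The Gaussian integral over \<open>w\<close> is never computed: its value follows from the fact that both the
  marginal of \<open>Y\<close> and \<open>innov_dens\<close> integrate to 1.\<close>

lemma distributed_Y:
  "distributed M (lborel_pow k) (rvec {..<k} Y) (\<lambda>y. ennreal (innov_dens k y))"
proof -
  define Q where "Q w = (1 / sqrt (2 * pi)) ^ (Suc n + k) * exp (- (wv w \<bullet> (J k *\<^sub>v wv w)) / 2)" for w
  define Z where "Z = (\<integral>\<^sup>+w. ennreal (Q w) \<partial>lw)"
  define a where "a = (\<Prod>t<k. sqrt (2 * pi * K t))"
  have "wv w \<bullet> (J k *\<^sub>v wv w) = (\<Sum>i<Suc n. w i * (row (J k) i \<bullet> wv w))" for w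
    by (simp add: scalar_prod_def[of "wv w" "J k *\<^sub>v wv w"] atLeast0LessThan del: sum.lessThan_Suc)
      (simp add: wv_def)
  moreover have "(\<lambda>w. \<Sum>i<Suc n. w i * (row (J k) i \<bullet> wv w)) \<in> borel_measurable lw"
    by (intro borel_measurable_sum borel_measurable_times wv_measurable
        component_measurable[OF measurable_ident_sets[OF refl]]) auto
  ultimately have [measurable]: "(\<lambda>w. wv w \<bullet> (J k *\<^sub>v wv w)) \<in> borel_measurable lw"
    by (simp only:)
  have Q[measurable]: "Q \<in> borel_measurable lw"
    unfolding Q_def[abs_def] by measurable
  have a: "0 < a" unfolding a_def using K_pos by (intro prod_pos) auto
  have inner: "(\<integral>\<^sup>+w. ennreal (dens k w y) \<partial>lw) = Z * ennreal a * ennreal (innov_dens k y)" for y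
  proof -
    \<comment> \<open>Translating \<open>w\<close> by the estimate removes \<open>y\<close> from the
      Gaussian factor, so \<open>Z\<close> is one constant for all \<open>y\<close>.\<close>
    let ?s = "tri_map (Suc n) 1 (\<lambda>i. - est y k $ i) (\<lambda>_ _. 0)"
    have "wv (?s w) = wv w - est y k" for w
      by (rule eq_vecI) (auto simp: wv_def tri_map_def)
    then have "dens k w y = a * innov_dens k y * Q (?s w)" for w
      unfolding dens_completed Q_def innov_dens_exp a_def by (simp add: mult_ac)
    then have "(\<integral>\<^sup>+w. ennreal (dens k w y) \<partial>lw) =
        (\<integral>\<^sup>+w. ennreal (a * innov_dens k y) * ennreal (Q (?s w)) \<partial>lw)"
      using a innov_dens_pos[of k y] by (simp add: ennreal_mult' less_imp_le)
    also have "\<dots> = ennreal (a * innov_dens k y) * (\<integral>\<^sup>+w. ennreal (Q (?s w)) \<partial>lw)"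
      by (rule nn_integral_cmult) measurable
    also have "(\<integral>\<^sup>+w. ennreal (Q (?s w)) \<partial>lw) = Z"
      unfolding Z_def by (rule nn_integral_tri_map) auto
    finally show ?thesis
      using a innov_dens_pos[of k y] by (simp add: ennreal_mult' less_imp_le mult_ac)
  qed
  have D: "distributed M (lborel_pow k) (rvec {..<k} Y)
      (\<lambda>y. Z * ennreal a * ennreal (innov_dens k y))"
    using distr_marginal2[OF sigma_finite_lborel_pow sigma_finite_lborel_pow joint_W_Y[of k]]
    by (simp add: inner)
  interpret DY: prob_space "distr M (lborel_pow k) (rvec {..<k} Y)"
    using distributed_measurable[OF D] by (rule prob_space_distr)
  have "1 = (\<integral>\<^sup>+y. Z * ennreal a * ennreal (innov_dens k y) \<partial>lborel_pow k)"
    using DY.emeasure_space_1 unfolding distributed_distr_eq_density[OF D]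
    by (subst (asm) emeasure_density)
      (auto simp: nn_integral_cmult intro!: distributed_borel_measurable[OF D])
  also have "\<dots> = Z * ennreal a"
    by (subst nn_integral_cmult) (auto simp: nn_integral_innov_dens)
  finally show ?thesis using D by simp
qed

lemma ln_normal_density:
  assumes "0 < \<kappa>"
  shows "ln (normal_density 0 (sqrt \<kappa>) x) = - ln (2 * pi) / 2 - ln \<kappa> / 2 - x\<^sup>2 / (2 * \<kappa>)"
proof -
  have "normal_density 0 (sqrt \<kappa>) x = exp (- (x\<^sup>2 / (2 * \<kappa>))) / sqrt (2 * pi * \<kappa>)"
    using assms by (simp add: normal_density_def)
  also have "ln \<dots> = - (x\<^sup>2 / (2 * \<kappa>)) - ln (2 * pi * \<kappa>) / 2"
    using assms by (simp add: ln_div ln_sqrt)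
  also have "ln (2 * pi * \<kappa>) = ln (2 * pi) + ln \<kappa>"
    using assms by (intro ln_mult_pos) auto
  finally show ?thesis by (simp add: field_simps)
qed

text \<open>The hypothesis is the shape of the output under any generator. Pulling the densities
  back to \<open>Y\<close>, the density of \<open>W\<close> cancels from the logarithmic ratio and
  the densities of the noise remain against those of the innovations.\<close>

lemma mutual_information_W:
  assumes y: "\<And>t \<omega>. t < k \<Longrightarrow> y t \<omega> = Y t \<omega> + (\<Sum>s<t. c t s * Y s \<omega>)"
  shows "mutual_information 2 lw (lborel_pow k) (rvec {..<Suc n} W) (rvec {..<k} y) =
    1 / 2 * (\<Sum>t<k. log 2 (K t))"
proof -
  interpret information_space M 2 by standard simp
  let ?S = "lw \<Otimes>\<^sub>M lborel_pow k"
  let ?\<Phi> = "tri_map k 1 (\<lambda>_. 0) c"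
  obtain d where d: "\<And>v. v \<in> space (lborel_pow k) \<Longrightarrow> tri_map k 1 (\<lambda>_. 0) d (?\<Phi> v) = v"
    using tri_map_inverse[of k c] by blast
  let ?\<Psi> = "tri_map k 1 (\<lambda>_. 0) d"
  have yY: "rvec {..<k} y = (\<lambda>\<omega>. ?\<Phi> (rvec {..<k} Y \<omega>))"
    by (auto simp: fun_eq_iff rvec_def tri_map_def y intro!: sum.cong)
  let ?Px = "\<lambda>w. \<Prod>i<Suc n. std_normal_density (w i)"
  let ?Py = "\<lambda>v. innov_dens k (?\<Psi> v)"
  let ?Pxy = "\<lambda>z. dens k (fst z) (?\<Psi> (snd z))"
  have Px_pos: "0 < ?Px w" for w by (intro prod_pos normal_density_pos) auto
  have Py: "distributed M (lborel_pow k) (rvec {..<k} y) (\<lambda>v. ennreal (?Py v))"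
    unfolding yY
    by (rule distributed_bij[OF distributed_Y]) (auto simp: d distr_tri_map)
  have "distributed M ?S (\<lambda>\<omega>. (\<lambda>z. (fst z, ?\<Phi> (snd z))) (rvec {..<Suc n} W \<omega>, rvec {..<k} Y \<omega>))
      (\<lambda>z. ennreal (dens k (fst (fst z, ?\<Psi> (snd z))) (snd (fst z, ?\<Psi> (snd z)))))"
  proof (rule distributed_bij[OF joint_W_Y])
    show "distr ?S ?S (\<lambda>z. (fst z, ?\<Phi> (snd z))) = ?S"
      by (rule distr_pair_fibrewise[OF sigma_finite_lborel_pow]) (auto simp: distr_tri_map)
  qed (auto simp: d space_pair_measure)
  then have Pxy: "distributed M ?S (\<lambda>\<omega>. (rvec {..<Suc n} W \<omega>, rvec {..<k} y \<omega>)) (\<lambda>z. ennreal (?Pxy z))"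
    by (simp add: yY)
  define h where "h z = log 2 (?Pxy z / (?Px (fst z) * ?Py (snd z)))" for z
  have Px_meas: "?Px \<in> borel_measurable lw"
    by measurable
  have [measurable]: "h \<in> borel_measurable ?S"
    unfolding h_def[abs_def]
    by (intro borel_measurable_log borel_measurable_divide borel_measurable_times
        distributed_real_measurable[OF _ Pxy] measurable_compose[OF measurable_fst Px_meas]
        measurable_compose[OF measurable_snd distributed_real_measurable[OF _ Py]])
      (auto simp: less_imp_le dens_pos innov_dens_pos)
  have "mutual_information 2 lw (lborel_pow k) (rvec {..<Suc n} W) (rvec {..<k} y) =
      (\<integral>z. ?Pxy z * h z \<partial>?S)"
    unfolding h_def
    by (rule mutual_information_distr[OF sigma_finite_lborel_pow sigma_finite_lborel_pow W_dist _ Py _ Pxy])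
      (simp_all add: less_imp_le dens_pos innov_dens_pos less_imp_le[OF Px_pos] del: prod.lessThan_Suc)
  also have "\<dots> = (\<integral>\<omega>. h (rvec {..<Suc n} W \<omega>, rvec {..<k} y \<omega>) \<partial>M)"
    by (rule distributed_integral[OF Pxy]) (auto simp: less_imp_le dens_pos)
  also have "\<dots> = (\<integral>\<omega>. (\<Sum>t<k. 1 / 2 * log 2 (K t) +
      ((I t \<omega>)\<^sup>2 / (2 * K t) - (N t \<omega>)\<^sup>2 / 2) / ln 2) \<partial>M)"
  proof (rule Bochner_Integration.integral_cong[OF refl])
    fix \<omega>
    have sp: "rvec {..<k} Y \<omega> \<in> space (lborel_pow k)" by (simp add: rvec_def space_PiM)
    have 1: "dens k (rvec {..<Suc n} W \<omega>) (rvec {..<k} Y \<omega>) =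
        ?Px (rvec {..<Suc n} W \<omega>) * (\<Prod>t<k. std_normal_density (N t \<omega>))"
      unfolding dens_def wv_rvec
      by (intro arg_cong2[of _ _ _ _ "(*)"] prod.cong refl) (auto simp: rvec_def Y_def)
    have 2: "innov_dens k (rvec {..<k} Y \<omega>) = (\<Prod>t<k. normal_density 0 (sqrt (K t)) (I t \<omega>))"
    proof -
      have "inn (rvec {..<k} Y \<omega>) t = I t \<omega>" if "t < k" for t
        unfolding I_def by (rule inn_cong) (use that in \<open>auto simp: rvec_def\<close>)
      then show ?thesis unfolding innov_dens_def by (intro prod.cong) auto
    qed
    have p1: "0 < (\<Prod>t<k. std_normal_density (N t \<omega>))"
      by (intro prod_pos normal_density_pos) auto
    have p2: "0 < (\<Prod>t<k. normal_density 0 (sqrt (K t)) (I t \<omega>))"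
      by (intro prod_pos normal_density_pos) auto
    have nz: "normal_density 0 \<sigma> x \<noteq> 0" if "0 < \<sigma>" for \<sigma> x :: real
      using normal_density_pos[OF that, of 0 x] by simp
    have log_quot: "log 2 (a / b) = (ln a - ln b) / ln 2" if "0 < a" "0 < b" for a b :: real
      using that by (simp add: log_def ln_div)
    have "h (rvec {..<Suc n} W \<omega>, rvec {..<k} y \<omega>) =
        log 2 ((\<Prod>t<k. std_normal_density (N t \<omega>)) / (\<Prod>t<k. normal_density 0 (sqrt (K t)) (I t \<omega>)))"
      by (simp only: h_def yY d[OF sp] 1 2 fst_conv snd_conv
          mult_divide_mult_cancel_left[OF not_sym[OF less_imp_neq[OF Px_pos]]])
    also have "\<dots> = (ln (\<Prod>t<k. std_normal_density (N t \<omega>)) -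
        ln (\<Prod>t<k. normal_density 0 (sqrt (K t)) (I t \<omega>))) / ln 2"
      by (rule log_quot[OF p1 p2])
    also have "ln (\<Prod>t<k. std_normal_density (N t \<omega>)) = (\<Sum>t<k. ln (std_normal_density (N t \<omega>)))"
      by (rule ln_prod) (auto simp: nz)
    also have "ln (\<Prod>t<k. normal_density 0 (sqrt (K t)) (I t \<omega>)) =
        (\<Sum>t<k. ln (normal_density 0 (sqrt (K t)) (I t \<omega>)))"
      by (rule ln_prod) (auto simp: nz)
    also have "((\<Sum>t<k. ln (std_normal_density (N t \<omega>))) -
        (\<Sum>t<k. ln (normal_density 0 (sqrt (K t)) (I t \<omega>)))) / ln 2 =
        (\<Sum>t<k. (ln (std_normal_density (N t \<omega>)) - ln (normal_density 0 (sqrt (K t)) (I t \<omega>))) / ln 2)"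
      by (simp add: sum_subtractf sum_divide_distrib diff_divide_distrib)
    also have "\<dots> = (\<Sum>t<k. 1 / 2 * log 2 (K t) + ((I t \<omega>)\<^sup>2 / (2 * K t) - (N t \<omega>)\<^sup>2 / 2) / ln 2)"
      using ln_normal_density[of 1]
      by (intro sum.cong refl) (simp add: ln_normal_density log_def diff_divide_distrib add_divide_distrib)
    finally show "h (rvec {..<Suc n} W \<omega>, rvec {..<k} y \<omega>) =
        (\<Sum>t<k. 1 / 2 * log 2 (K t) + ((I t \<omega>)\<^sup>2 / (2 * K t) - (N t \<omega>)\<^sup>2 / 2) / ln 2)" .
  qed
  \<comment> \<open>The quadratic terms cancel in expectation because the innovation has second
    moment \<open>K t\<close> and the noise has second moment 1.\<close>
  also have "\<dots> = (\<Sum>t<k. 1 / 2 * log 2 (K t) + (K t / (2 * K t) - 1 / 2) / ln 2)"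
  proof -
    have int: "integrable M (\<lambda>\<omega>. (I t \<omega>)\<^sup>2)" "integrable M (\<lambda>\<omega>. (N t \<omega>)\<^sup>2)" for t
      using sq_integrable_I N_moments(1) by (auto simp: sq_integrable_def)
    have "(\<integral>\<omega>. (I t \<omega>)\<^sup>2 \<partial>M) = K t" "(\<integral>\<omega>. (N t \<omega>)\<^sup>2 \<partial>M) = 1" for t
      using ip_I_I[of t] N_moments(2)[of t t] by (auto simp: ip_def power2_eq_square)
    then show ?thesis using int by (simp add: prob_space)
  qed
  also have "\<dots> = 1 / 2 * (\<Sum>t<k. log 2 (K t))"
    by (simp add: sum_distrib_left)
  finally show ?thesis .
qed

subsection \<open>Fisher information\<close>

lemma ln_dens:
  "ln (dens k w y) = ln ((1 / sqrt (2 * pi)) ^ (Suc n + k)) -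
     (\<Sum>i<Suc n. (w i)\<^sup>2) / 2 - (\<Sum>t<k. (y t - g t \<bullet> wv w)\<^sup>2) / 2"
proof -
  have "dens k w y = (1 / sqrt (2 * pi)) ^ (Suc n + k) *
      (exp (- (\<Sum>i<Suc n. (w i)\<^sup>2) / 2) * exp (- (\<Sum>t<k. (y t - g t \<bullet> wv w)\<^sup>2) / 2))"
    unfolding dens_def by (subst (1 2) prod_std_normal_density)
      (simp_all add: power_add mult_ac del: sum.lessThan_Suc power_Suc add_Suc)
  then show ?thesis
    by (simp add: ln_mult_pos del: sum.lessThan_Suc power_Suc add_Suc)
qed

lemma ln_dens_deriv:
  assumes i: "i \<le> n"
  shows "((\<lambda>x. ln (dens k (w(i := x)) y)) has_field_derivative
    (\<Sum>t<k. g t $ i * (y t - g t \<bullet> wv w)) - w i) (at (w i))"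
proof -
  have 1: "(\<Sum>j<Suc n. ((w(i := x)) j)\<^sup>2) = (\<Sum>j<Suc n. (w j)\<^sup>2) + (x\<^sup>2 - (w i)\<^sup>2)" for x
  proof -
    have "(\<Sum>j<Suc n. ((w(i := x)) j)\<^sup>2) = (\<Sum>j<Suc n. (w j)\<^sup>2 + (if j = i then x\<^sup>2 - (w i)\<^sup>2 else 0))"
      by (intro sum.cong) auto
    also have "\<dots> = (\<Sum>j<Suc n. (w j)\<^sup>2) + (x\<^sup>2 - (w i)\<^sup>2)"
      using i by (subst sum.distrib) (simp add: sum.delta del: sum.lessThan_Suc)
    finally show ?thesis .
  qed
  have 2: "g t \<bullet> wv (w(i := x)) = g t \<bullet> wv w + g t $ i * (x - w i)" for t x
  proof -
    have "g t \<bullet> wv (w(i := x)) =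
        (\<Sum>j<Suc n. g t $ j * w j + (if j = i then g t $ i * (x - w i) else 0))"
      unfolding scalar_prod_wv[OF g] by (intro sum.cong) (auto simp: algebra_simps)
    also have "\<dots> = g t \<bullet> wv w + g t $ i * (x - w i)"
      unfolding scalar_prod_wv[OF g] using i
      by (subst sum.distrib) (simp add: sum.delta del: sum.lessThan_Suc)
    finally show ?thesis .
  qed
  show ?thesis
    unfolding ln_dens 1 2
    by (auto intro!: derivative_eq_intros simp: sum_divide_distrib[symmetric] sum_distrib_left[symmetric]
        algebra_simps simp del: sum.lessThan_Suc)
      (subst sum_divide_distrib, subst sum_negf[symmetric], intro sum.cong, auto simp: field_simps)
qed

text \<open>Observations first, as \<open>joint_density\<close> prescribes.\<close>

definition yw_dens :: "nat \<Rightarrow> (nat \<Rightarrow> real) \<times> (nat \<Rightarrow> real) \<Rightarrow> real" where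
  "yw_dens k z = dens k (snd z) (fst z)"

text \<open>Besides naming the density, this is the existence needed to reason about the
  \<open>SOME\<close> in \<open>fisher_mat\<close>. Differentiability is recovered from the
  logarithm by exponentiation.\<close>

lemma joint_density_yw_dens: "joint_density M T n Y W (yw_dens (Suc T))"
proof -
  have "distributed M (lborel_pow (Suc T) \<Otimes>\<^sub>M lw)
      (\<lambda>\<omega>. (rvec {..<Suc T} Y \<omega>, rvec {..<Suc n} W \<omega>)) (\<lambda>z. ennreal (yw_dens (Suc T) z))"
    using distributed_swap[OF sigma_finite_lborel_pow sigma_finite_lborel_pow joint_W_Y[of "Suc T"]]
    by (simp add: yw_dens_def split_beta')
  moreover have "(\<lambda>x. dens (Suc T) (w(i := x)) y) differentiable (at (w i))" if "i \<le> n" for w y i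
  proof -
    have "((\<lambda>x. exp (ln (dens (Suc T) (w(i := x)) y))) has_field_derivative
        exp (ln (dens (Suc T) (w(i := w i)) y)) *
          ((\<Sum>t<Suc T. g t $ i * (y t - g t \<bullet> wv w)) - w i)) (at (w i))"
      by (rule DERIV_fun_exp[OF ln_dens_deriv[OF that]])
    then show ?thesis
      unfolding real_differentiable_def by (auto simp: exp_ln[OF dens_pos])
  qed
  ultimately show ?thesis
    unfolding joint_density_def lessThan_Suc_atMost[symmetric] by (simp add: yw_dens_def dens_pos)
qed

lemma score_yw_dens:
  "i \<le> n \<Longrightarrow> score (yw_dens k) i y w = (\<Sum>t<k. g t $ i * (y t - g t \<bullet> wv w)) - w i"
  unfolding score_def yw_dens_def by (simp add: DERIV_imp_deriv[OF ln_dens_deriv])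

text \<open>Two versions of the density agree almost everywhere, hence, by translation invariance, so do
  almost everywhere all their difference quotients along a null sequence, and the score is the limit
  of these.\<close>

lemma score_joint_density:
  assumes p: "joint_density M T n Y W p" and i: "i \<le> n"
  shows "(\<lambda>z. score p i (fst z) (snd z)) \<in> borel_measurable (lborel_pow (Suc T) \<Otimes>\<^sub>M lw)" (is ?meas)
    and "AE z in lborel_pow (Suc T) \<Otimes>\<^sub>M lw.
      score p i (fst z) (snd z) = score (yw_dens (Suc T)) i (fst z) (snd z)" (is ?ae)
proof -
  let ?S = "lborel_pow (Suc T) \<Otimes>\<^sub>M lw"
  let ?h = "\<lambda>m::nat. 1 / real (Suc m)"
  \<comment> \<open>A shift of coordinate \<open>i\<close> alone, written as a
    \<open>tri_map\<close> so that its invariance is already available.\<close>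
  define \<theta> where "\<theta> m z = (fst z, tri_map (Suc n) 1 (\<lambda>j. if j = i then ?h m else 0) (\<lambda>_ _. 0) (snd z))"
    for m and z :: "(nat \<Rightarrow> real) \<times> (nat \<Rightarrow> real)"
  define quot where "quot p m z = (ln (p (\<theta> m z)) - ln (p z)) / ?h m"
    for p :: "(nat \<Rightarrow> real) \<times> (nat \<Rightarrow> real) \<Rightarrow> real" and m z
  have \<theta>[measurable]: "\<theta> m \<in> measurable ?S ?S" for m
    unfolding \<theta>_def by measurable
  have \<theta>_eq: "\<theta> m (y, w) = (y, w(i := w i + ?h m))" if "(y, w) \<in> space ?S" for m y w
  proof -
    have "w \<in> extensional {..<Suc n}"
      using that by (auto simp: space_pair_measure space_PiM PiE_def)
    then show ?thesis using i by (auto simp: \<theta>_def tri_map_def fun_eq_iff extensional_def)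
  qed
  have distr_\<theta>: "distr ?S ?S (\<theta> m) = ?S" for m
    unfolding \<theta>_def by (rule distr_pair_fibrewise[OF sigma_finite_lborel_pow]) (auto simp: distr_tri_map)
  have lim: "(\<lambda>m. quot q m z) \<longlonglongrightarrow> score q i (fst z) (snd z)"
    if q: "joint_density M T n Y W q" and z: "z \<in> space ?S" for q z
  proof -
    obtain y w where yw: "z = (y, w)" by (cases z)
    have sp: "y \<in> space (lborel_pow (Suc T))" "w \<in> space lw"
      using z by (auto simp: yw space_pair_measure)
    have pos: "0 < q (y, w)" and diff: "(\<lambda>x. q (y, w(i := x))) differentiable (at (w i))"
      using q sp i unfolding joint_density_def lessThan_Suc_atMost[symmetric] by auto
    from diff obtain D where "((\<lambda>x. q (y, w(i := x))) has_field_derivative D) (at (w i))"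
      by (auto simp: real_differentiable_def)
    then have "((\<lambda>x. ln (q (y, w(i := x)))) has_field_derivative (1 / q (y, w) * D)) (at (w i))"
      using pos by (auto intro!: derivative_eq_intros)
    then have "((\<lambda>x. ln (q (y, w(i := x)))) has_field_derivative score q i y w) (at (w i))"
      unfolding score_def by (metis DERIV_imp_deriv)
    then have "((\<lambda>h. (ln (q (y, w(i := w i + h))) - ln (q (y, w(i := w i)))) / h) \<longlongrightarrow> score q i y w) (at 0)"
      by (simp only: DERIV_def)
    moreover have "filterlim ?h (at 0) sequentially"
      unfolding filterlim_at using LIMSEQ_inverse_real_of_nat
      by (auto simp: inverse_eq_divide)
    ultimately have "(\<lambda>m. (ln (q (y, w(i := w i + ?h m))) - ln (q (y, w(i := w i)))) / ?h m) \<longlonglongrightarrow> score q i y w"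
      by (rule filterlim_compose)
    then show ?thesis
      using z unfolding quot_def yw fst_conv snd_conv by (simp add: \<theta>_eq)
  qed
  have meas: "q \<in> borel_measurable ?S" if q: "joint_density M T n Y W q" for q
    by (rule distributed_real_measurable[where M = M])
      (use q in \<open>auto simp: joint_density_def lessThan_Suc_atMost[symmetric] space_pair_measure less_imp_le\<close>)
  note meas[OF p, measurable]
  show ?meas
  proof (rule borel_measurable_LIMSEQ_real)
    show "(\<lambda>m. quot p m z) \<longlonglongrightarrow> score p i (fst z) (snd z)" if "z \<in> space ?S" for z
      using lim[OF p that] .
    show "quot p m \<in> borel_measurable ?S" for m
      unfolding quot_def by measurable
  qed
  let ?q = "yw_dens (Suc T)"
  have q: "joint_density M T n Y W ?q" by (rule joint_density_yw_dens)
  have "AE z in ?S. ennreal (p z) = ennreal (?q z)"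
    by (rule distributed_unique[where X = "\<lambda>\<omega>. (rvec {..<Suc T} Y \<omega>, rvec {..<Suc n} W \<omega>)"])
      (use p q in \<open>auto simp: joint_density_def lessThan_Suc_atMost[symmetric]\<close>)
  \<comment> \<open>\<open>ennreal\<close> sends every nonpositive real to 0, so positivity of both
    densities is what allows passing to real equality.\<close>
  then have eq: "AE z in ?S. p z = ?q z"
    using AE_space
  proof eventually_elim
    case (elim z)
    then have "0 < p z" "0 < ?q z"
      using p by (auto simp: joint_density_def lessThan_Suc_atMost[symmetric] space_pair_measure
          yw_dens_def dens_pos)
    then show ?case using elim by simp
  qed
  \<comment> \<open>The exceptional null set pulls back to a null set under each measure-preserving
    \<open>\<theta> m\<close>, and there are countably many \<open>m\<close>.\<close>
  have "AE z in ?S. p (\<theta> m z) = ?q (\<theta> m z)" for m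
    by (rule AE_distrD[OF \<theta>]) (unfold distr_\<theta>, rule eq)
  then have "AE z in ?S. \<forall>m. p (\<theta> m z) = ?q (\<theta> m z)"
    by (simp add: AE_all_countable)
  with eq AE_space show ?ae
  proof eventually_elim
    case (elim z)
    then have "quot p m z = quot ?q m z" for m by (simp add: quot_def)
    moreover have z: "z \<in> space ?S" using elim by simp
    ultimately show ?case
      using LIMSEQ_unique[OF lim[OF p z]] lim[OF q z] by simp
  qed
qed

text \<open>The explicit score evaluated at the data, where the residual of observation
  \<open>t\<close> is just \<open>N t\<close>. Since noise and message are white and uncorrelated,
  its second moments can be read off as entries of \<open>J\<close>.\<close>

definition score_rv :: "nat \<Rightarrow> nat \<Rightarrow> 'a \<Rightarrow> real" where
  "score_rv k i \<omega> = (\<Sum>t<k. g t $ i * N t \<omega>) - W i \<omega>"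

lemma sq_integrable_score_rv: "i < Suc n \<Longrightarrow> sq_integrable (score_rv k i)"
  unfolding score_rv_def[abs_def] by (intro sq_integrable_intros N_moments sq_integrable_W)

lemma ip_score_rv:
  assumes i: "i < Suc n" and f: "sq_integrable f"
  shows "ip (score_rv k i) f = (\<Sum>t<k. g t $ i * ip (N t) f) - ip (W i) f"
proof -
  have "ip (score_rv k i) f = ip (\<lambda>\<omega>. \<Sum>t<k. g t $ i * N t \<omega>) f - ip (W i) f"
    unfolding score_rv_def[abs_def] by (intro ip_diff f sq_integrable_intros N_moments sq_integrable_W i)
  also have "ip (\<lambda>\<omega>. \<Sum>t<k. g t $ i * N t \<omega>) f = (\<Sum>t<k. ip (\<lambda>\<omega>. g t $ i * N t \<omega>) f)"
    by (intro ip_sum f sq_integrable_intros N_moments)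
  finally show ?thesis by (simp add: ip_scale)
qed

lemma ip_score_rv_score_rv:
  assumes i: "i < Suc n" and j: "j < Suc n"
  shows "ip (score_rv k i) (score_rv k j) = J k $$ (i, j)"
proof -
  have "ip (N t) (score_rv k j) = g t $ j" if t: "t < k" for t
  proof -
    have "ip (N t) (score_rv k j) = ip (score_rv k j) (N t)" by (rule ip_commute)
    also have "\<dots> = (\<Sum>s<k. g s $ j * (if s = t then 1 else 0)) - 0"
      unfolding ip_score_rv[OF j N_moments(1)] by (simp only: N_moments ip_W_N[OF j])
    also have "\<dots> = g t $ j" using t by (simp add: if_distrib[of "\<lambda>x. _ * x"] cong: if_cong)
    finally show ?thesis .
  qed
  moreover have "ip (W i) (score_rv k j) = - (if i = j then 1 else 0)"
  proof -
    have "ip (W i) (score_rv k j) = ip (score_rv k j) (W i)" by (rule ip_commute)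
    also have "\<dots> = - (if i = j then 1 else 0)"
      using ip_W_N[OF i] W_moments(1)[OF j i]
      by (simp add: ip_score_rv[OF j sq_integrable_W[OF i]] ip_commute[of "N _" "W i"])
    finally show ?thesis .
  qed
  ultimately show ?thesis
    unfolding ip_score_rv[OF i sq_integrable_score_rv[OF j]] using i j by (simp add: J_index)
qed

lemma fisher_mat_eq: "fisher_mat M T n Y W = J (Suc T)"
proof (rule eq_matI)
  let ?S = "lborel_pow (Suc T) \<Otimes>\<^sub>M lw"
  let ?X = "\<lambda>\<omega>. (rvec {..<Suc T} Y \<omega>, rvec {..<Suc n} W \<omega>)"
  define p where "p = (SOME p. joint_density M T n Y W p)"
  have p: "joint_density M T n Y W p"
    unfolding p_def by (rule someI[of "joint_density M T n Y W", OF joint_density_yw_dens])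
  have X: "?X \<in> measurable M ?S" and distr_X: "distr M ?S ?X = density ?S (\<lambda>z. ennreal (p z))"
    using p unfolding joint_density_def lessThan_Suc_atMost[symmetric] by (auto simp: distributed_def)
  have p_meas: "(\<lambda>z. ennreal (p z)) \<in> borel_measurable ?S"
    using p unfolding joint_density_def lessThan_Suc_atMost[symmetric] by (auto simp: distributed_def)
  have ae: "AE \<omega> in M. score p i (rvec {..<Suc T} Y \<omega>) (rvec {..<Suc n} W \<omega>) = score_rv (Suc T) i \<omega>"
    if i: "i < Suc n" for i
  proof -
    \<comment> \<open>The law of the data has a density, so a Lebesgue-null set is almost surely
      avoided by the data.\<close>
    have "AE z in distr M ?S ?X. score p i (fst z) (snd z) = score (yw_dens (Suc T)) i (fst z) (snd z)"
      unfolding distr_X AE_density[OF p_meas]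
      using score_joint_density(2)[OF p, of i] i by auto
    from AE_distrD[OF X this] show ?thesis
    proof eventually_elim
      case (elim \<omega>)
      have "score (yw_dens (Suc T)) i (rvec {..<Suc T} Y \<omega>) (rvec {..<Suc n} W \<omega>) = score_rv (Suc T) i \<omega>"
        using i unfolding score_rv_def
        by (subst score_yw_dens) (auto simp: wv_rvec[unfolded rvec_def] rvec_def Y_def
            simp del: sum.lessThan_Suc intro!: sum.cong)
      then show ?case using elim by simp
    qed
  qed
  have meas: "(\<lambda>\<omega>. score p i (rvec {..<Suc T} Y \<omega>) (rvec {..<Suc n} W \<omega>)) \<in> borel_measurable M"
    if "i < Suc n" for i
    using measurable_compose[OF X score_joint_density(1)[OF p, of i]] that by simp
  fix i j assume "i < dim_row (J (Suc T))" "j < dim_col (J (Suc T))"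
  then have i: "i < Suc n" and j: "j < Suc n" by auto
  have "fisher_mat M T n Y W $$ (i, j) = (\<integral>\<omega>. score p i (rvec {..<Suc T} Y \<omega>) (rvec {..<Suc n} W \<omega>) *
      score p j (rvec {..<Suc T} Y \<omega>) (rvec {..<Suc n} W \<omega>) \<partial>M)"
    using i j by (simp add: fisher_mat_def Let_def p_def lessThan_Suc_atMost)
  also have "\<dots> = ip (score_rv (Suc T) i) (score_rv (Suc T) j)"
    unfolding ip_def
  proof (rule integral_cong_AE)
    show "AE \<omega> in M. score p i (rvec {..<Suc T} Y \<omega>) (rvec {..<Suc n} W \<omega>) *
      score p j (rvec {..<Suc T} Y \<omega>) (rvec {..<Suc n} W \<omega>) = score_rv (Suc T) i \<omega> * score_rv (Suc T) j \<omega>"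
      using ae[OF i] ae[OF j] by eventually_elim simp
    show "(\<lambda>\<omega>. score_rv (Suc T) i \<omega> * score_rv (Suc T) j \<omega>) \<in> borel_measurable M"
      using sq_integrable_score_rv[OF i, of "Suc T"] sq_integrable_score_rv[OF j, of "Suc T"] by (auto simp: sq_integrable_def)
    show "(\<lambda>\<omega>. score p i (rvec {..<Suc T} Y \<omega>) (rvec {..<Suc n} W \<omega>) *
      score p j (rvec {..<Suc T} Y \<omega>) (rvec {..<Suc n} W \<omega>)) \<in> borel_measurable M"
      by (rule borel_measurable_times[OF meas[OF i] meas[OF j]])
  qed
  also have "\<dots> = J (Suc T) $$ (i, j)" by (rule ip_score_rv_score_rv[OF i j])
  finally show "fisher_mat M T n Y W $$ (i, j) = J (Suc T) $$ (i, j)" .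
qed (auto simp: fisher_mat_def Let_def)

end

section \<open>State space\<close>

lemma assoc_mult_mat_dim:
  "dim_col A = dim_row B \<Longrightarrow> dim_col B = dim_row C \<Longrightarrow> A * B * C = A * (B * (C :: 'a :: semiring_0 mat))"
  by (rule assoc_mult_mat[of _ "dim_row A" "dim_row B" _ "dim_row C" _ "dim_col C"]) auto

lemma assoc_mult_mat_vec_dim:
  "dim_col A = dim_row B \<Longrightarrow> dim_col B = dim_vec v \<Longrightarrow> A * B *\<^sub>v v = A *\<^sub>v (B *\<^sub>v (v :: 'a :: semiring_0 vec))"
  by (rule assoc_mult_mat_vec[of _ "dim_row A" "dim_row B" _ "dim_col B"]) auto

lemma transpose_mult_dim:
  "dim_col A = dim_row B \<Longrightarrow> (A * B)\<^sup>T = B\<^sup>T * (A :: 'a :: comm_semiring_0 mat)\<^sup>T"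
  by (rule transpose_mult[of _ "dim_row A" "dim_row B" _ "dim_col B"]) auto

lemma mat_eq_if_mult_vec_eq:
  fixes A B :: "'a :: semiring_1 mat"
  assumes A: "A \<in> carrier_mat k l" and B: "B \<in> carrier_mat k l"
    and eq: "\<And>v. v \<in> carrier_vec l \<Longrightarrow> A *\<^sub>v v = B *\<^sub>v v"
  shows "A = B"
proof (rule eq_matI)
  fix i j assume ij: "i < dim_row B" "j < dim_col B"
  then have "j < l" "i < k" using B by auto
  then have "(A *\<^sub>v unit_vec l j) $ i = A $$ (i, j)" "(B *\<^sub>v unit_vec l j) $ i = B $$ (i, j)"
    using A B by (auto simp: scalar_prod_right_unit)
  then show "A $$ (i, j) = B $$ (i, j)" using eq[of "unit_vec l j"] by simp
qed (use A B in auto)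

locale coding_system =
  fixes n m :: nat and F G H A C :: "real mat"
  assumes A: "A \<in> carrier_mat (Suc n) (Suc n)" and C: "C \<in> carrier_mat 1 (Suc n)"
    and F: "F \<in> carrier_mat m m" and G: "G \<in> carrier_mat m 1" and H: "H \<in> carrier_mat 1 m"
begin

lemma dims[simp]:
  "dim_row A = Suc n" "dim_col A = Suc n" "dim_row C = 1" "dim_col C = Suc n"
  "dim_row F = m" "dim_col F = m" "dim_row G = m" "dim_col G = 1" "dim_row H = 1" "dim_col H = m"
  using A C F G H by auto

abbreviation "AC \<equiv> AA F G A C"
abbreviation "CH \<equiv> CC H C"

lemma block_dims[simp]:
  "dim_row AC = Suc n + m" "dim_col AC = Suc n + m" "dim_row CH = 1" "dim_col CH = Suc n + m"
  "dim_row (DD F C) = 1" "dim_col (DD F C) = Suc n + m"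
  by (auto simp: AA_def CC_def DD_def beside_def)

text \<open>\<open>Psi t\<close> maps \<open>W\<close> to the joint state of source and channel without feedback.\<close>

primrec Psi :: "nat \<Rightarrow> real mat" where
  "Psi 0 = mat (Suc n + m) (Suc n) (\<lambda>(i, j). if i = j then 1 else 0)"
| "Psi (Suc t) = AC * Psi t"

lemma Psi_dims[simp]: "dim_row (Psi t) = Suc n + m" "dim_col (Psi t) = Suc n"
  by (induction t) auto

text \<open>The row through which the no-feedback output at time \<open>t\<close> observes the
  constant message.\<close>

definition R :: "nat \<Rightarrow> real mat" where "R t = CH * Psi t"

sublocale rls "Suc n" R
  by standard (rule carrier_matI; simp add: R_def)

lemma Psi_0_mult_vec:
  assumes w: "w \<in> carrier_vec (Suc n)"
  shows "Psi 0 *\<^sub>v w = w @\<^sub>v 0\<^sub>v m"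
proof (rule eq_vecI)
  fix i assume "i < dim_vec (w @\<^sub>v 0\<^sub>v m)"
  then have i: "i < Suc n + m" using w by simp
  have "row (Psi 0) i = (if i < Suc n then unit_vec (Suc n) i else 0\<^sub>v (Suc n))"
    using i by (intro eq_vecI) auto
  then show "(Psi 0 *\<^sub>v w) $ i = (w @\<^sub>v 0\<^sub>v m) $ i"
    using i w by auto
qed (use w in auto)

lemma kf_cov_0: "kf_cov F G H A C 0 = Psi 0 * (Psi 0)\<^sup>T"
proof (rule eq_matI)
  fix i j assume "i < dim_row (Psi 0 * (Psi 0)\<^sup>T)" "j < dim_col (Psi 0 * (Psi 0)\<^sup>T)"
  then have ij: "i < Suc n + m" "j < Suc n + m" by auto
  have row: "row (Psi 0) i = (if i < Suc n then unit_vec (Suc n) i else 0\<^sub>v (Suc n))"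
    if "i < Suc n + m" for i
    using that by (intro eq_vecI) auto
  have "(Psi 0 * (Psi 0)\<^sup>T) $$ (i, j) = row (Psi 0) i \<bullet> row (Psi 0) j"
    using ij by (simp del: Psi.simps)
  also have "\<dots> = (if i = j \<and> i < Suc n then 1 else 0)"
    using ij unfolding row[OF ij(1)] row[OF ij(2)] by auto
  finally show "kf_cov F G H A C 0 $$ (i, j) = (Psi 0 * (Psi 0)\<^sup>T) $$ (i, j)"
    using ij by auto
qed auto

text \<open>Inserting the factorisation into the Riccati step turns \<open>CH * Psi t\<close> into
  \<open>R t\<close> and \<open>AC * Psi t\<close> into \<open>Psi (Suc t)\<close>, so the update
  takes place entirely inside the middle factor. Already the initial covariance is singular for
  \<open>m > 0\<close>; passing to the middle factor is what makes an information matrix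
  available.\<close>

lemma kf_cov_eq: "kf_cov F G H A C t = Psi t * P t * (Psi t)\<^sup>T"
proof (induction t)
  case 0
  have "Psi 0 * 1\<^sub>m (Suc n) = Psi 0"
    by (rule right_mult_one_mat[of _ "Suc n + m"]) (rule carrier_matI; simp)
  then show ?case using kf_cov_0 by (simp del: Psi.simps kf_cov.simps)
next
  case (Suc t)
  let ?S = "kf_cov F G H A C t"
  have cSc: "CH * ?S * CH\<^sup>T = R t * P t * (R t)\<^sup>T"
    unfolding Suc R_def[of t] by (simp add: assoc_mult_mat_dim transpose_mult_dim)
  have 1: "AC * ?S * AC\<^sup>T = Psi (Suc t) * P t * (Psi (Suc t))\<^sup>T"
    unfolding Suc by (simp add: assoc_mult_mat_dim transpose_mult_dim)
  have 2: "AC * ?S * CH\<^sup>T * CH * ?S * AC\<^sup>T =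
      Psi (Suc t) * (P t * (R t)\<^sup>T * R t * P t) * (Psi (Suc t))\<^sup>T"
    unfolding Suc R_def[of t] by (simp add: assoc_mult_mat_dim transpose_mult_dim)
  have Psi: "Psi (Suc t) \<in> carrier_mat (Suc n + m) (Suc n)" by (rule carrier_matI) simp_all
  let ?X = "P t * (R t)\<^sup>T * R t * P t" and ?k = "1 / (K t)"
  have X: "?X \<in> carrier_mat (Suc n) (Suc n)" by (rule carrier_matI) simp_all
  have "Psi (Suc t) * P (Suc t) * (Psi (Suc t))\<^sup>T =
      (Psi (Suc t) * P t - ?k \<cdot>\<^sub>m (Psi (Suc t) * ?X)) * (Psi (Suc t))\<^sup>T"
    unfolding P.simps K_eq
    using X Psi by (simp add: mult_minus_distrib_mat[OF Psi P] mult_smult_distrib[OF Psi X] del: Psi.simps)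
  also have "\<dots> = Psi (Suc t) * P t * (Psi (Suc t))\<^sup>T - ?k \<cdot>\<^sub>m (Psi (Suc t) * ?X * (Psi (Suc t))\<^sup>T)"
  proof -
    have c1: "Psi (Suc t) * P t \<in> carrier_mat (Suc n + m) (Suc n)"
      "Psi (Suc t) * ?X \<in> carrier_mat (Suc n + m) (Suc n)"
      "(Psi (Suc t))\<^sup>T \<in> carrier_mat (Suc n) (Suc n + m)"
      by (rule carrier_matI; simp)+
    show ?thesis
      using c1 by (simp add: minus_mult_distrib_mat[OF c1(1) _ c1(3)] smult_carrier_mat
          mult_smult_assoc_mat[OF c1(2,3)] del: Psi.simps)
  qed
  finally show ?case
    by (simp only: kf_cov.simps Let_def cSc K_eq 1 2)
qed

lemma CC_kf_cov: "(CH * kf_cov F G H A C t * CH\<^sup>T) $$ (0, 0) + 1 = K t"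
proof -
  have "CH * kf_cov F G H A C t * CH\<^sup>T = R t * P t * (R t)\<^sup>T"
    unfolding kf_cov_eq R_def[of t] by (simp add: assoc_mult_mat_dim transpose_mult_dim)
  then show ?thesis by (simp only: K_eq)
qed

definition r :: "nat \<Rightarrow> real vec" where "r t = row (DD F C * Psi t) 0"

lemma r[simp]: "r t \<in> carrier_vec (Suc n)" "dim_vec (r t) = Suc n"
  by (auto simp: r_def intro: carrier_vecI)

lemma row_kf_cov_quadratic:
  assumes u: "u \<in> carrier_mat 1 (Suc n)"
  shows "(u * P t * u\<^sup>T) $$ (0, 0) = row u 0 \<bullet> (P t *\<^sub>v row u 0)"
proof -
  have [simp]: "dim_row u = 1" "dim_col u = Suc n" using u by auto
  have "u * P t * u\<^sup>T = u * (P t * u\<^sup>T)" by (rule assoc_mult_mat_dim) simp_all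
  moreover have "col (P t * u\<^sup>T) 0 = P t *\<^sub>v col (u\<^sup>T) 0"
    by (rule col_mult2[of _ "Suc n" "Suc n" _ 1]) (auto intro!: carrier_matI)
  ultimately show ?thesis by simp
qed

lemma DD_kf_cov: "(DD F C * kf_cov F G H A C t * (DD F C)\<^sup>T) $$ (0, 0) = r t \<bullet> (P t *\<^sub>v r t)"
proof -
  have "DD F C * kf_cov F G H A C t * (DD F C)\<^sup>T =
      (DD F C * Psi t) * P t * (DD F C * Psi t)\<^sup>T"
    unfolding kf_cov_eq by (simp add: assoc_mult_mat_dim transpose_mult_dim)
  then show ?thesis
    using row_kf_cov_quadratic[of "DD F C * Psi t"] by (simp add: r_def carrier_matI)
qed

text \<open>The least-squares gain transported to the joint state; the factor \<open>AC\<close> in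
  the filter gain accounts for the index \<open>Suc t\<close>.\<close>

lemma kf_gain_eq: "kf_gain F G H A C t = (1 / K t) \<cdot>\<^sub>v (Psi (Suc t) *\<^sub>v (P t *\<^sub>v g t))"
proof -
  have "AC * kf_cov F G H A C t * CH\<^sup>T = Psi (Suc t) * (P t * (R t)\<^sup>T)"
    unfolding kf_cov_eq R_def[of t] by (simp add: assoc_mult_mat_dim transpose_mult_dim)
  moreover have "col (Psi (Suc t) * (P t * (R t)\<^sup>T)) 0 = Psi (Suc t) *\<^sub>v col (P t * (R t)\<^sup>T) 0"
    by (rule col_mult2[of _ "Suc n + m" "Suc n" _ 1]) (auto intro!: carrier_matI)
  moreover have "col (P t * (R t)\<^sup>T) 0 = P t *\<^sub>v col ((R t)\<^sup>T) 0"
    by (rule col_mult2[of _ "Suc n" "Suc n" _ 1]) (auto intro!: carrier_matI)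
  ultimately show ?thesis
    unfolding kf_gain_def Let_def CC_kf_cov by (simp add: col_RT del: Psi.simps)
qed

lemma CC_Psi_mult_vec:
  assumes "v \<in> carrier_vec (Suc n)"
  shows "(CH *\<^sub>v (Psi t *\<^sub>v v)) $ 0 = g t \<bullet> v"
proof -
  have "CH *\<^sub>v (Psi t *\<^sub>v v) = R t *\<^sub>v v"
    unfolding R_def using assms by (subst assoc_mult_mat_vec_dim) auto
  then show ?thesis using assms by (simp add: R_mult_vec)
qed

lemma DD_Psi_mult_vec:
  assumes "v \<in> carrier_vec (Suc n)"
  shows "(DD F C *\<^sub>v (Psi t *\<^sub>v v)) $ 0 = r t \<bullet> v"
proof -
  have "DD F C *\<^sub>v (Psi t *\<^sub>v v) = (DD F C * Psi t) *\<^sub>v v"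
    using assms by (subst assoc_mult_mat_vec_dim) auto
  then show ?thesis by (simp add: r_def)
qed

lemma kf_est_eq: "kf_est F G H A C y t = Psi t *\<^sub>v est y t"
proof (induction t)
  case 0
  have "Psi 0 *\<^sub>v 0\<^sub>v (Suc n) = 0\<^sub>v (Suc n) @\<^sub>v 0\<^sub>v m" by (rule Psi_0_mult_vec) simp
  also have "\<dots> = 0\<^sub>v (Suc n + m)" by (rule eq_vecI) auto
  finally show ?case by (simp del: Psi.simps)
next
  case (Suc t)
  let ?k = "y t - g t \<bullet> est y t"
  have Psi: "Psi (Suc t) \<in> carrier_mat (Suc n + m) (Suc n)" by (rule carrier_matI) simp_all
  have "Psi (Suc t) *\<^sub>v est y (Suc t) =
      Psi (Suc t) *\<^sub>v est y t + (?k / K t) \<cdot>\<^sub>v (Psi (Suc t) *\<^sub>v (P t *\<^sub>v g t))"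
    by (simp add: mult_add_distrib_mat_vec[OF Psi] mult_mat_vec[OF Psi] del: Psi.simps)
  moreover have "Psi (Suc t) *\<^sub>v est y t = AC *\<^sub>v (Psi t *\<^sub>v est y t)"
    by (simp add: assoc_mult_mat_vec_dim)
  ultimately show ?case
    by (simp add: Suc CC_Psi_mult_vec kf_gain_eq smult_smult_assoc del: Psi.simps est.simps index_mult_mat_vec)
qed

lemma AA_mult_append:
  assumes "x \<in> carrier_vec (Suc n)" "s \<in> carrier_vec m"
  shows "AC *\<^sub>v (x @\<^sub>v s) = (A *\<^sub>v x) @\<^sub>v (F *\<^sub>v s + (C *\<^sub>v x) $ 0 \<cdot>\<^sub>v col G 0)"
proof -
  have "G * C *\<^sub>v x = (C *\<^sub>v x) $ 0 \<cdot>\<^sub>v col G 0"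
  proof -
    have "G * C *\<^sub>v x = G *\<^sub>v (C *\<^sub>v x)"
      using assms by (intro assoc_mult_mat_vec_dim) auto
    also have "\<dots> = (C *\<^sub>v x) $ 0 \<cdot>\<^sub>v col G 0"
      by (rule eq_vecI) (auto simp: scalar_prod_def mult.commute)
    finally show ?thesis .
  qed
  moreover have "AC *\<^sub>v (x @\<^sub>v s) = (A *\<^sub>v x + 0\<^sub>m (Suc n) m *\<^sub>v s) @\<^sub>v (G * C *\<^sub>v x + F *\<^sub>v s)"
    unfolding AA_def dims
    by (rule four_block_mat_mult_vec[of _ "Suc n" "Suc n" _ m _ m])
      (use assms A F in \<open>auto intro!: carrier_matI\<close>)
  ultimately show ?thesis
    using assms by (auto intro!: eq_vecI)
qed

lemma CC_mult_append:
  assumes "x \<in> carrier_vec (Suc n)" "s \<in> carrier_vec m"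
  shows "(CH *\<^sub>v (x @\<^sub>v s)) $ 0 = (C *\<^sub>v x) $ 0 + (H *\<^sub>v s) $ 0"
proof -
  have "CH *\<^sub>v (x @\<^sub>v s) = (C *\<^sub>v x + H *\<^sub>v s) @\<^sub>v (0\<^sub>m 0 (Suc n) *\<^sub>v x + 0\<^sub>m 0 m *\<^sub>v s)"
    unfolding CC_def beside_def dims
    by (rule four_block_mat_mult_vec[of _ 1 "Suc n" _ m _ 0]) (use assms C H in auto)
  then show ?thesis by simp
qed

lemma DD_mult_append:
  assumes "x \<in> carrier_vec (Suc n)" "s \<in> carrier_vec m"
  shows "(DD F C *\<^sub>v (x @\<^sub>v s)) $ 0 = (C *\<^sub>v x) $ 0"
proof -
  have "DD F C *\<^sub>v (x @\<^sub>v s) = (C *\<^sub>v x + 0\<^sub>m 1 m *\<^sub>v s) @\<^sub>v (0\<^sub>m 0 (Suc n) *\<^sub>v x + 0\<^sub>m 0 m *\<^sub>v s)"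
    unfolding DD_def beside_def dims index_zero_mat
    by (rule four_block_mat_mult_vec[of _ 1 "Suc n" _ m _ 0]) (use assms C in auto)
  then show ?thesis using assms by simp
qed

lemma src_state_carrier[simp]: "w \<in> carrier_vec (Suc n) \<Longrightarrow> src_state A w t \<in> carrier_vec (Suc n)"
  by (induction t) (auto intro: mult_mat_vec_carrier[OF A])

lemma ch_state_dim[simp]: "dim_vec (ch_state F G u t) = m"
  by (induction t) auto

lemma ch_state_carrier[simp]: "ch_state F G u t \<in> carrier_vec m"
  by (rule carrier_vecI) simp

lemma joint_state:
  assumes w: "w \<in> carrier_vec (Suc n)"
  shows "src_state A w t @\<^sub>v ch_state F G (src_out A C w) t = Psi t *\<^sub>v w"
proof (induction t)
  case 0
  then show ?case using w by (simp add: Psi_0_mult_vec del: Psi.simps)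
next
  case (Suc t)
  have "Psi (Suc t) *\<^sub>v w = AC *\<^sub>v (Psi t *\<^sub>v w)"
    using w by (simp add: assoc_mult_mat_vec_dim)
  then show ?case
    using w by (simp add: Suc[symmetric] AA_mult_append src_out_def)
qed

lemma src_out_eq: "w \<in> carrier_vec (Suc n) \<Longrightarrow> src_out A C w t = r t \<bullet> w"
  using DD_Psi_mult_vec[of w t] by (simp add: joint_state[symmetric] DD_mult_append src_out_def del: index_mult_mat_vec)

lemma ch_out_src_eq:
  assumes "w \<in> carrier_vec (Suc n)"
  shows "ch_out F G H (src_out A C w) v t = g t \<bullet> w + v t"
  using CC_Psi_mult_vec[OF assms, of t] assms
  by (simp add: joint_state[symmetric] CC_mult_append ch_out_def src_out_def del: index_mult_mat_vec)

lemma src_state_pow: "w \<in> carrier_vec (Suc n) \<Longrightarrow> src_state A w t = A ^\<^sub>m t *\<^sub>v w"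
proof (induction t arbitrary: w)
  case (Suc t)
  have "src_state A w (Suc t) = src_state A (A *\<^sub>v w) t" by (induction t) auto
  also have "\<dots> = A ^\<^sub>m t *\<^sub>v (A *\<^sub>v w)"
    by (rule Suc.IH) (rule mult_mat_vec_carrier[OF A Suc.prems])
  also have "\<dots> = A ^\<^sub>m Suc t *\<^sub>v w"
    using Suc.prems by (simp add: assoc_mult_mat_vec_dim)
  finally show ?case .
qed simp

text \<open>Both matrices send the initial source state to the source output at time
  \<open>t\<close>, and agreement on all vectors suffices. This lets the power be written with
  \<open>C * A ^\<^sub>m t\<close>.\<close>

lemma DD_Psi_eq: "DD F C * Psi t = C * A ^\<^sub>m t"
proof (rule mat_eq_if_mult_vec_eq[of _ 1 "Suc n"])
  fix v :: "real vec" assume v: "v \<in> carrier_vec (Suc n)"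
  have [simp]: "dim_vec v = Suc n" using v by simp
  have "C * A ^\<^sub>m t *\<^sub>v v = C *\<^sub>v src_state A v t"
    using v by (simp add: src_state_pow assoc_mult_mat_vec_dim)
  moreover have "(C *\<^sub>v src_state A v t) $ 0 = (DD F C *\<^sub>v (Psi t *\<^sub>v v)) $ 0"
    using v by (simp add: joint_state[symmetric] DD_mult_append del: index_mult_mat_vec)
  moreover have "DD F C * Psi t *\<^sub>v v = DD F C *\<^sub>v (Psi t *\<^sub>v v)"
    by (rule assoc_mult_mat_vec_dim) simp_all
  ultimately show "DD F C * Psi t *\<^sub>v v = C * A ^\<^sub>m t *\<^sub>v v"
    by (intro eq_vecI) (simp_all del: index_mult_mat_vec)
qed (auto intro!: carrier_matI)

lemma pow_P_quadratic: "(C * A ^\<^sub>m t * P s * (A ^\<^sub>m t)\<^sup>T * C\<^sup>T) $$ (0, 0) = r t \<bullet> (P s *\<^sub>v r t)"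
proof -
  have "C * A ^\<^sub>m t * P s * (A ^\<^sub>m t)\<^sup>T * C\<^sup>T = (C * A ^\<^sub>m t) * P s * (C * A ^\<^sub>m t)\<^sup>T"
    by (simp add: assoc_mult_mat_dim transpose_mult_dim)
  then show ?thesis
    using row_kf_cov_quadratic[of "C * A ^\<^sub>m t"] by (simp add: r_def DD_Psi_eq carrier_matI)
qed

end

section \<open>The closed loop\<close>

text \<open>The probabilistic assumptions are restated here because the rows \<open>R\<close> are
  derived from the state-space matrices; \<open>gauss_channel\<close> then follows as a sublocale
  for these rows.\<close>

locale coding_setup = coding_system n m F G H A C + prob_space M
  for n m and F G H A C :: "real mat" and M :: "'a measure" +
  fixes W N :: "nat \<Rightarrow> 'a \<Rightarrow> real"
  assumes W_dist': "distributed M (lborel_pow (Suc n)) (rvec {..<Suc n} W)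
      (\<lambda>w. ennreal (\<Prod>i<Suc n. std_normal_density (w i)))"
    and N_indep': "indep_vars (\<lambda>_. borel) N UNIV"
    and N_dist': "\<And>t. distributed M lborel (N t) std_normal_density"
    and WN_indep': "indep_var (Pi\<^sub>M {..<Suc n} (\<lambda>_. borel)) (rvec {..<Suc n} W)
      (Pi\<^sub>M UNIV (\<lambda>_. borel)) (rvec UNIV N)"
begin

sublocale gauss_channel M n R W N
  by standard (fact W_dist' N_indep' N_dist' WN_indep')+

lemma src_proc_eq: "src_proc A C W t \<omega> = r t \<bullet> wv (\<lambda>i. W i \<omega>)"
  using src_out_eq[of "wv (\<lambda>i. W i \<omega>)" t] by (simp add: src_proc_def wv_def)

lemma nofb_out_eq: "nofb_out_proc F G H A C W N = Y"
proof (intro ext)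
  fix t \<omega>
  have "(\<lambda>i. src_proc A C W i \<omega>) = src_out A C (wv (\<lambda>i. W i \<omega>))"
    by (simp add: src_proc_def wv_def fun_eq_iff)
  then show "nofb_out_proc F G H A C W N t \<omega> = Y t \<omega>"
    by (simp add: nofb_out_proc_def ch_out_src_eq Y_def)
qed

definition rhat :: "nat \<Rightarrow> 'a \<Rightarrow> real" where
  "rhat t \<omega> = r t \<bullet> est (\<lambda>s. Y s \<omega>) t"

lemma src_est_eq: "src_est F G H A C W N t \<omega> = rhat t \<omega>"
  by (simp add: src_est_def nofb_out_eq kf_est_eq DD_Psi_mult_vec rhat_def del: index_mult_mat_vec)

lemma err_r: "err t (r t) \<omega> = src_proc A C W t \<omega> - rhat t \<omega>"
  by (simp add: err_def src_proc_eq rhat_def scalar_prod_minus_distrib[of _ "Suc n"])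

lemma ch_state_add:
  "ch_state F G (\<lambda>i. u i + q i) t = ch_state F G u t + ch_state F G q t"
proof (induction t)
  case 0
  show ?case by (rule eq_vecI) auto
next
  case (Suc t)
  then show ?case
    by (simp add: mult_add_distrib_mat_vec[OF F]) (rule eq_vecI; simp add: algebra_simps)
qed

text \<open>The noise-free channel response: by superposition, the change of the output caused by
  adding \<open>q\<close> to the input.\<close>

definition resp :: "(nat \<Rightarrow> real) \<Rightarrow> nat \<Rightarrow> real" where
  "resp q t = (H *\<^sub>v ch_state F G q t) $ 0 + q t"

lemma ch_out_add: "ch_out F G H (\<lambda>i. u i + q i) v t = ch_out F G H u v t + resp q t"
  by (simp add: ch_out_def resp_def ch_state_add mult_add_distrib_mat_vec[OF H] del: index_mult_mat_vec)

text \<open>An arbitrary test vector \<open>h\<close> lets the induction move \<open>F\<close> onto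
  it by transposition.\<close>

lemma lin_span_ch_state:
  "(\<And>i. i < t \<Longrightarrow> lin_span b k (q i)) \<Longrightarrow> h \<in> carrier_vec m \<Longrightarrow>
    lin_span b k (\<lambda>\<omega>. h \<bullet> ch_state F G (\<lambda>i. q i \<omega>) t)"
proof (induction t arbitrary: h)
  case 0
  then show ?case by (simp add: lin_span_zero)
next
  case (Suc t)
  have FT: "F\<^sup>T *\<^sub>v h \<in> carrier_vec m" by (rule carrier_vecI) simp
  have eq: "h \<bullet> ch_state F G (\<lambda>i. q i \<omega>) (Suc t) =
      (F\<^sup>T *\<^sub>v h) \<bullet> ch_state F G (\<lambda>i. q i \<omega>) t + (h \<bullet> col G 0) * q t \<omega>" for \<omega>
  proof -
    let ?s = "ch_state F G (\<lambda>i. q i \<omega>) t"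
    have Fs: "F *\<^sub>v ?s \<in> carrier_vec m" and qG: "q t \<omega> \<cdot>\<^sub>v col G 0 \<in> carrier_vec m"
      by (rule carrier_vecI, simp)+
    have "h \<bullet> (F *\<^sub>v ?s + q t \<omega> \<cdot>\<^sub>v col G 0) = h \<bullet> (F *\<^sub>v ?s) + h \<bullet> (q t \<omega> \<cdot>\<^sub>v col G 0)"
      by (rule scalar_prod_add_distrib[OF Suc.prems(2) Fs qG])
    then show ?thesis
      using Suc.prems(2) transpose_vec_mult_scalar[OF F ch_state_carrier Suc.prems(2), of "\<lambda>i. q i \<omega>" t]
      by simp
  qed
  have "lin_span b k (\<lambda>\<omega>. (F\<^sup>T *\<^sub>v h) \<bullet> ch_state F G (\<lambda>i. q i \<omega>) t + (h \<bullet> col G 0) * q t \<omega>)"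
    by (intro lin_span_add lin_span_scale Suc.IH FT Suc.prems(1)) simp_all
  then show ?case by (simp only: eq)
qed

lemma lin_span_resp:
  assumes "\<And>i. i \<le> t \<Longrightarrow> lin_span b k (q i)"
  shows "lin_span b k (\<lambda>\<omega>. resp (\<lambda>i. q i \<omega>) t)"
proof -
  have "lin_span b k (\<lambda>\<omega>. row H 0 \<bullet> ch_state F G (\<lambda>i. q i \<omega>) t)"
    using assms by (intro lin_span_ch_state) (auto intro!: carrier_vecI)
  then show ?thesis
    unfolding resp_def using assms by (simp add: lin_span_add)
qed

abbreviation "u k \<equiv> in_proc F G H A C k W N"
abbreviation "y k \<equiv> out_proc F G H A C k W N"
abbreviation "fb k t \<omega> \<equiv> (\<Sum>j<t. k $$ (t, j) * y k j \<omega>)"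

lemma u_eq: "u k t \<omega> = src_proc A C W t \<omega> + fb k t \<omega>"
  unfolding in_proc_def out_proc_def by (subst fb_in.simps) simp

text \<open>The sample point is fixed and \<open>q\<close> is a real sequence, so the feedback of an
  arbitrary generator and \<open>- rhat\<close> are treated alike.\<close>

lemma y_eq:
  assumes "\<And>i. i \<le> t \<Longrightarrow> u k i \<omega> = src_proc A C W i \<omega> + q i"
  shows "y k t \<omega> = Y t \<omega> + resp q t"
proof -
  have "y k t \<omega> = ch_out F G H (\<lambda>i. src_proc A C W i \<omega> + q i) (\<lambda>i. N i \<omega>) t"
    unfolding out_proc_def using assms by (intro ch_out_cong) auto
  also have "\<dots> = nofb_out_proc F G H A C W N t \<omega> + resp q t"
    unfolding ch_out_add nofb_out_proc_def ..
  finally show ?thesis by (simp only: nofb_out_eq)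
qed

text \<open>Feedback applied by time \<open>t\<close> reads outputs strictly before
  \<open>t\<close>. By induction these lie in the span of earlier \<open>Y\<close>, and so does the
  channel response to them.\<close>

lemma unit_tri_y_Y: "unit_tri k' (y k) Y"
proof -
  have "lin_span Y t (\<lambda>\<omega>. y k t \<omega> - Y t \<omega>)" for t
  proof (induction t rule: less_induct)
    case (less t)
    have "lin_span Y t (fb k i)" if "i \<le> t" for i
    proof (intro lin_span_sum lin_span_scale)
      fix j assume j: "j \<in> {..<i}"
      then have jt: "j < t" using that by simp
      have "lin_span Y t (\<lambda>\<omega>. (y k j \<omega> - Y j \<omega>) + Y j \<omega>)"
        using jt by (intro lin_span_add lin_span_base lin_span_mono[OF less.IH]) auto
      then show "lin_span Y t (y k j)" by simp
    qed
    then have "lin_span Y t (\<lambda>\<omega>. resp (\<lambda>i. fb k i \<omega>) t)"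
      by (rule lin_span_resp)
    moreover have "y k t \<omega> - Y t \<omega> = resp (\<lambda>i. fb k i \<omega>) t" for \<omega>
      using y_eq[of t k \<omega> "\<lambda>i. fb k i \<omega>", OF u_eq] by linarith
    ultimately show ?case by simp
  qed
  then show ?thesis by (simp add: unit_tri_def)
qed

lemma unit_tri_Y_I: "unit_tri k Y I"
proof -
  have "I = (\<lambda>t \<omega>. inn (\<lambda>s. Y s \<omega>) t)" by (simp add: I_def fun_eq_iff)
  then show ?thesis
    using unit_tri_sym[OF inn_unit_tri[of k "\<lambda>\<omega> s. Y s \<omega>"]] by (simp only:)
qed

lemma lin_span_rhat: "lin_span Y t (rhat t)"
  using est_lin_span[of "r t" "\<lambda>\<omega> s. Y s \<omega>" t] by (simp add: rhat_def[abs_def])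

text \<open>Every generator adds to the prediction error a combination of past innovations, which are
  uncorrelated with it.\<close>

lemma u_decomp:
  obtains c where "\<And>\<omega>. u k t \<omega> = err t (r t) \<omega> + (\<Sum>s<t. c s * I s \<omega>)"
proof -
  have "lin_span Y t (fb k t)"
    by (intro lin_span_sum lin_span_scale)
      (auto intro: lin_span_mono[OF unit_tri_lin_span[OF unit_tri_y_Y lessI]])
  then have "lin_span Y t (\<lambda>\<omega>. fb k t \<omega> + rhat t \<omega>)"
    by (intro lin_span_add lin_span_rhat)
  then have "lin_span I t (\<lambda>\<omega>. fb k t \<omega> + rhat t \<omega>)"
    by (rule lin_span_unit_tri[OF unit_tri_Y_I order_refl])
  then obtain c where c: "\<And>\<omega>. fb k t \<omega> + rhat t \<omega> = (\<Sum>s<t. c s * I s \<omega>)"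
    unfolding lin_span_def by blast
  have "u k t \<omega> = err t (r t) \<omega> + (\<Sum>s<t. c s * I s \<omega>)" for \<omega>
    using c[of \<omega>] u_eq[of k t \<omega>] err_r[of t \<omega>] by linarith
  then show thesis by (rule that)
qed

section \<open>Power of the input and the optimal generator\<close>

definition pred_power :: "nat \<Rightarrow> real" where "pred_power t = r t \<bullet> (P t *\<^sub>v r t)"

text \<open>Pythagoras: the prediction error and the past innovations form an orthogonal
  family.\<close>

lemma power_t:
  assumes c: "\<And>\<omega>. f \<omega> = err t (r t) \<omega> + (\<Sum>s<t. c s * I s \<omega>)"
  shows "sq_integrable f" "ip f f = pred_power t + (\<Sum>s<t. (c s)\<^sup>2 * K s)"
proof -
  let ?d = "\<lambda>\<omega>. \<Sum>s<t. c s * I s \<omega>"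
  have f: "f = (\<lambda>\<omega>. err t (r t) \<omega> + ?d \<omega>)" using c by auto
  have d: "sq_integrable ?d" by (intro sq_integrable_intros sq_integrable_I)
  have e: "sq_integrable (err t (r t))" by (rule sq_integrable_err) simp
  show sf: "sq_integrable f" unfolding f by (intro sq_integrable_add d e)
  have d_ip: "ip ?d h = (\<Sum>s<t. c s * ip (I s) h)" if "sq_integrable h" for h
    using that by (subst ip_sum) (auto intro: sq_integrable_scale sq_integrable_I simp: ip_scale)
  have I_e: "ip (I s) (err t (r t)) = 0" if "s < t" for s
    using ip_err_I[OF r(1) that] by (simp add: ip_commute)
  have d_e: "ip ?d (err t (r t)) = 0"
    using I_e by (subst d_ip[OF e]) simp
  have I_I: "ip (I s) (I s') = (if s = s' then K s else 0)" for s s'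
    using ip_I_I_0[of s s'] ip_I_I_0[of s' s] ip_commute[of "I s" "I s'"]
    by (cases s s' rule: linorder_cases) (auto simp: ip_I_I)
  have d_I: "ip (I s) ?d = c s * K s" if "s < t" for s
  proof -
    have "ip (I s) ?d = (\<Sum>s'<t. c s' * ip (I s') (I s))"
      by (subst ip_commute) (rule d_ip[OF sq_integrable_I])
    also have "\<dots> = c s * K s"
      using that by (simp add: I_I if_distrib[of "\<lambda>x. _ * x"] cong: if_cong)
    finally show ?thesis .
  qed
  have "ip ?d ?d = (\<Sum>s<t. (c s)\<^sup>2 * K s)"
    using d_I by (subst d_ip[OF d]) (auto intro!: sum.cong simp: power2_eq_square)
  moreover have "ip f f = ip (err t (r t)) f + ip ?d f"
    by (subst (1) f) (rule ip_add[OF e d sf])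
  moreover have "ip (err t (r t)) f = ip (err t (r t)) (err t (r t)) + ip ?d (err t (r t))"
    by (subst ip_commute, subst f) (rule ip_add[OF e d e])
  moreover have "ip ?d f = ip (err t (r t)) ?d + ip ?d ?d"
    by (subst ip_commute, subst f) (rule ip_add[OF e d d])
  moreover have "ip (err t (r t)) ?d = 0" using d_e by (simp add: ip_commute)
  moreover have "ip (err t (r t)) (err t (r t)) = pred_power t" by (simp add: ip_err_err pred_power_def)
  ultimately show "ip f f = pred_power t + (\<Sum>s<t. (c s)\<^sup>2 * K s)" using d_e by simp
qed

lemma avg_power_eq:
  "avg_power M F G H A C W N T k = 1 / real (T + 1) * (\<Sum>t\<le>T. ip (u k t) (u k t))"
proof -
  have "sq_integrable (u k t)" for t
    using u_decomp[of k t] power_t(1)[of "u k t" t] by metis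
  then have "(\<integral>\<omega>. (\<Sum>t\<le>T. (u k t \<omega>)\<^sup>2) \<partial>M) = (\<Sum>t\<le>T. \<integral>\<omega>. (u k t \<omega>)\<^sup>2 \<partial>M)"
    by (intro Bochner_Integration.integral_sum) (simp add: sq_integrable_def)
  then show ?thesis by (simp add: avg_power_def ip_def power2_eq_square)
qed

text \<open>Every \<open>K s\<close> is positive, so attaining the bound annihilates all
  coefficients. The resulting equality of input and prediction error then holds everywhere, not
  merely almost surely.\<close>

lemma pred_power_le: "pred_power t \<le> ip (u k t) (u k t)"
  and u_eq_err_if: "ip (u k t) (u k t) \<le> pred_power t \<Longrightarrow> u k t \<omega> = err t (r t) \<omega>"
proof -
  obtain c where c: "\<And>\<omega>. u k t \<omega> = err t (r t) \<omega> + (\<Sum>s<t. c s * I s \<omega>)"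
    using u_decomp by blast
  have ip: "ip (u k t) (u k t) = pred_power t + (\<Sum>s<t. (c s)\<^sup>2 * K s)"
    by (rule power_t(2)[of "u k t" t c]) (rule c)
  have nn: "0 \<le> (c s)\<^sup>2 * K s" for s by (simp add: less_imp_le)
  show "pred_power t \<le> ip (u k t) (u k t)" unfolding ip using nn by (simp add: sum_nonneg)
  assume "ip (u k t) (u k t) \<le> pred_power t"
  then have "(\<Sum>s<t. (c s)\<^sup>2 * K s) = 0"
    unfolding ip using sum_nonneg[of "{..<t}" "\<lambda>s. (c s)\<^sup>2 * K s"] nn by simp
  then have "\<forall>s\<in>{..<t}. (c s)\<^sup>2 * K s = 0"
    using nn by (subst (asm) sum_nonneg_eq_0_iff) auto
  then show "u k t \<omega> = err t (r t) \<omega>" by (simp add: c)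
qed

text \<open>The output that feeding back \<open>- rhat\<close> would produce determines \<open>Y\<close> causally, hence \<open>rhat\<close>.\<close>

lemma ex_optimal_gen:
  "\<exists>k. strictly_lower_triangular (T + 1) k \<and> (\<forall>t\<le>T. \<forall>\<omega>. u k t \<omega> = err t (r t) \<omega>)"
proof -
  define y' where "y' t \<omega> = Y t \<omega> + resp (\<lambda>i. - rhat i \<omega>) t" for t \<omega>
  have neg: "lin_span Y t (\<lambda>\<omega>. - rhat t \<omega>)" for t
    using lin_span_scale[OF lin_span_rhat, where a = "-1"] by simp
  have resp: "resp (\<lambda>i. - rhat i \<omega>) t = y' t \<omega> - Y t \<omega>" for t \<omega> by (simp add: y'_def)
  have "unit_tri (Suc T) y' Y"
    unfolding unit_tri_def
  proof (intro allI impI)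
    fix t
    have "lin_span Y t (\<lambda>\<omega>. resp (\<lambda>i. - rhat i \<omega>) t)"
      by (intro lin_span_resp lin_span_mono[OF neg])
    then show "lin_span Y t (\<lambda>\<omega>. y' t \<omega> - Y t \<omega>)" by (simp only: resp)
  qed
  then have "unit_tri (Suc T) Y y'" by (rule unit_tri_sym)
  then have "\<exists>c. t \<le> T \<longrightarrow> (\<forall>\<omega>. - rhat t \<omega> = (\<Sum>s<t. c s * y' s \<omega>))" for t
    using lin_span_unit_tri[OF _ _ neg] unfolding lin_span_def by (metis le_SucI)
  then obtain c where c: "\<And>t \<omega>. t \<le> T \<Longrightarrow> - rhat t \<omega> = (\<Sum>s<t. c t s * y' s \<omega>)"
    by metis
  define k where "k = mat (T + 1) (T + 1) (\<lambda>(t, s). if s < t then c t s else 0)"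
  \<comment> \<open>Both claims advance together by causality: past outputs equal to
    \<open>y'\<close> make the feedback \<open>- rhat t\<close>, and inputs of this form up to
    \<open>t\<close> make the output \<open>y' t\<close>.\<close>
  have "t \<le> T \<longrightarrow> u k t \<omega> = src_proc A C W t \<omega> + - rhat t \<omega> \<and> y k t \<omega> = y' t \<omega>" for t \<omega>
  proof (induction t rule: less_induct)
    case (less t)
    show ?case
    proof
      assume t: "t \<le> T"
      have "fb k t \<omega> = (\<Sum>s<t. c t s * y' s \<omega>)"
        using less t by (intro sum.cong) (auto simp: k_def)
      then have u: "u k t \<omega> = src_proc A C W t \<omega> + - rhat t \<omega>"
        using c[OF t] by (simp add: u_eq)
      have "y k t \<omega> = Y t \<omega> + resp (\<lambda>i. - rhat i \<omega>) t"
        using less u t by (intro y_eq) (metis le_neq_implies_less le_trans)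
      with u show "u k t \<omega> = src_proc A C W t \<omega> + - rhat t \<omega> \<and> y k t \<omega> = y' t \<omega>"
        by (simp add: y'_def)
    qed
  qed
  then have "\<forall>t\<le>T. \<forall>\<omega>. u k t \<omega> = err t (r t) \<omega>" by (simp add: err_r)
  moreover have "strictly_lower_triangular (T + 1) k"
    by (auto simp: strictly_lower_triangular_def k_def)
  ultimately show ?thesis by blast
qed

abbreviation "opt T \<equiv> opt_gen M F G H A C W N T"

lemma avg_power_ge: "1 / real (T + 1) * (\<Sum>t\<le>T. pred_power t) \<le> avg_power M F G H A C W N T k"
  unfolding avg_power_eq by (intro mult_left_mono sum_mono pred_power_le) simp

text \<open>Only an existing minimiser guarantees that the choice \<open>opt_gen\<close> is one,
  which is the purpose of the witness \<open>k\<close>. Equality of the sums, with a lower bound for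
  each term, forces equality at every time.\<close>

lemma opt_power_eq: "opt_power M F G H A C W N T = 1 / real (T + 1) * (\<Sum>t\<le>T. pred_power t)"
  and u_opt: "t \<le> T \<Longrightarrow> u (opt T) t \<omega> = err t (r t) \<omega>"
proof -
  let ?p = "avg_power M F G H A C W N T" and ?S = "strictly_lower_triangular (T + 1)"
  let ?v = "1 / real (T + 1) * (\<Sum>t\<le>T. pred_power t)"
  obtain k where k: "?S k" "\<And>t \<omega>. t \<le> T \<Longrightarrow> u k t \<omega> = err t (r t) \<omega>"
    using ex_optimal_gen by blast
  have "ip (u k t) (u k t) = pred_power t" if "t \<le> T" for t
  proof -
    have "u k t = err t (r t)" using k(2)[OF that] by auto
    then show ?thesis by (simp add: ip_err_err pred_power_def)
  qed
  then have pk: "?p k = ?v" unfolding avg_power_eq by simp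
  have "is_arg_min ?p ?S k"
    unfolding is_arg_min_def using k(1) avg_power_ge[of T] pk by (auto simp: not_less)
  then have "is_arg_min ?p ?S (opt T)"
    unfolding opt_gen_def arg_min_def by (rule someI)
  then have "\<not> ?p k < ?p (opt T)" using k(1) by (auto simp: is_arg_min_def)
  then have p: "?p (opt T) = ?v" using pk avg_power_ge[of T "opt T"] by simp
  then show "opt_power M F G H A C W N T = ?v" by (simp add: opt_power_def)
  assume t: "t \<le> T"
  let ?i = "\<lambda>t. ip (u (opt T) t) (u (opt T) t)"
  have "(\<Sum>t\<le>T. ?i t - pred_power t) = 0"
    using p by (simp add: avg_power_eq sum_subtractf)
  then have "?i t - pred_power t = 0"
    using t pred_power_le by (subst (asm) sum_nonneg_eq_0_iff) auto
  then show "u (opt T) t \<omega> = err t (r t) \<omega>" by (intro u_eq_err_if) simp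
qed

lemma opt_out_eq: "t \<le> T \<Longrightarrow> opt_out M F G H A C W N T t \<omega> = Y t \<omega> + resp (\<lambda>i. - rhat i \<omega>) t"
  unfolding opt_out_def by (rule y_eq) (simp add: u_opt err_r)

section \<open>Innovations of the closed loop\<close>

lemma vec_last_append: "s \<in> carrier_vec m \<Longrightarrow> vec_last (x @\<^sub>v s) m = s"
  by (intro eq_vecI) (auto simp: vec_last_def)

lemma vec_last_add_smult:
  "dim_vec v = dim_vec w \<Longrightarrow> m \<le> dim_vec w \<Longrightarrow>
    vec_last (v + k \<cdot>\<^sub>v w) m = vec_last v m + k \<cdot>\<^sub>v vec_last w m"
  by (intro eq_vecI) (auto simp: vec_last_def)

lemma kf_est_split:
  obtains x s where "x \<in> carrier_vec (Suc n)" "s \<in> carrier_vec m"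
    "kf_est F G H A C (\<lambda>i. Y i \<omega>) t = x @\<^sub>v s" "(C *\<^sub>v x) $ 0 = rhat t \<omega>"
    "rhat t \<omega> + (H *\<^sub>v s) $ 0 = g t \<bullet> est (\<lambda>i. Y i \<omega>) t"
proof -
  let ?k = "kf_est F G H A C (\<lambda>i. Y i \<omega>) t"
  have k: "?k \<in> carrier_vec (Suc n + m)"
    unfolding kf_est_eq by (rule carrier_vecI) simp
  let ?x = "vec_first ?k (Suc n)" and ?s = "vec_last ?k m"
  have eq: "?x @\<^sub>v ?s = Psi t *\<^sub>v est (\<lambda>i. Y i \<omega>) t"
    using vec_first_last_append[OF k] by (simp add: kf_est_eq)
  have x: "?x \<in> carrier_vec (Suc n)" and s: "?s \<in> carrier_vec m" by auto
  have 1: "(C *\<^sub>v ?x) $ 0 = rhat t \<omega>"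
    using DD_mult_append[OF x s] unfolding eq DD_Psi_mult_vec[OF est] rhat_def ..
  have "rhat t \<omega> + (H *\<^sub>v ?s) $ 0 = g t \<bullet> est (\<lambda>i. Y i \<omega>) t"
    using CC_mult_append[OF x s] unfolding eq CC_Psi_mult_vec[OF est] 1 ..
  with x s 1 show thesis
    using vec_first_last_append[OF k] by (intro that[of ?x ?s]) auto
qed

text \<open>Feeding back \<open>- rhat\<close> shifts the output by its channel response. The state
  part of that response cancels against the shifted estimate, and the direct term
  \<open>- rhat t\<close> supplies the source prediction that \<open>loop_est\<close> does not
  contain.\<close>

lemma innov_eq_if:
  assumes t: "t \<le> T"
    and loop: "loop_est F G H A C (\<lambda>i. opt_out M F G H A C W N T i \<omega>) t =
      vec_last (kf_est F G H A C (\<lambda>i. Y i \<omega>) t) m + ch_state F G (\<lambda>i. - rhat i \<omega>) t"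
  shows "innov M F G H A C W N T t \<omega> = I t \<omega>"
proof -
  obtain x s where xs: "x \<in> carrier_vec (Suc n)" "s \<in> carrier_vec m"
      "kf_est F G H A C (\<lambda>i. Y i \<omega>) t = x @\<^sub>v s"
      "rhat t \<omega> + (H *\<^sub>v s) $ 0 = g t \<bullet> est (\<lambda>i. Y i \<omega>) t"
    using kf_est_split by blast
  have "(H *\<^sub>v loop_est F G H A C (\<lambda>i. opt_out M F G H A C W N T i \<omega>) t) $ 0 =
      (H *\<^sub>v s) $ 0 + (H *\<^sub>v ch_state F G (\<lambda>i. - rhat i \<omega>) t) $ 0"
    unfolding loop xs(3) vec_last_append[OF xs(2)]
    by (subst mult_add_distrib_mat_vec[OF H xs(2) ch_state_carrier])
      (simp del: index_mult_mat_vec)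
  then show ?thesis
    using xs(4) unfolding innov_def opt_out_eq[OF t] resp_def by (simp add: I_def inn_def)
qed

text \<open>Feedback is a known input, so it moves the channel state estimate by exactly the state
  it produces; the corrections agree because the innovations do. The range reaches
  \<open>Suc T\<close> since the estimate at that time reads outputs up to \<open>T\<close>
  only.\<close>

lemma loop_est_eq:
  "t \<le> Suc T \<Longrightarrow> loop_est F G H A C (\<lambda>i. opt_out M F G H A C W N T i \<omega>) t =
    vec_last (kf_est F G H A C (\<lambda>i. Y i \<omega>) t) m + ch_state F G (\<lambda>i. - rhat i \<omega>) t"
proof (induction t)
  case 0
  show ?case by (rule eq_vecI) (auto simp: vec_last_def)
next
  case (Suc t)
  let ?loop = "loop_est F G H A C (\<lambda>i. opt_out M F G H A C W N T i \<omega>)"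
  let ?ch = "ch_state F G (\<lambda>i. - rhat i \<omega>) t"
  let ?gain = "kf_gain F G H A C t"
  have t: "t \<le> T" using Suc.prems by simp
  have IH: "?loop t = vec_last (kf_est F G H A C (\<lambda>i. Y i \<omega>) t) m + ?ch"
    using Suc by simp
  obtain x s where xs: "x \<in> carrier_vec (Suc n)" "s \<in> carrier_vec m"
      "kf_est F G H A C (\<lambda>i. Y i \<omega>) t = x @\<^sub>v s" "(C *\<^sub>v x) $ 0 = rhat t \<omega>"
      "rhat t \<omega> + (H *\<^sub>v s) $ 0 = g t \<bullet> est (\<lambda>i. Y i \<omega>) t"
    using kf_est_split by blast
  have gain: "dim_vec ?gain = Suc n + m" by (simp add: kf_gain_eq del: Psi.simps)
  have Fs: "dim_vec (F *\<^sub>v s) = m" by simp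
  have "opt_out M F G H A C W N T t \<omega> - (H *\<^sub>v ?loop t) $ 0 = I t \<omega>"
    using innov_eq_if[OF t IH] by (simp only: innov_def)
  then have "?loop (Suc t) = F *\<^sub>v ?loop t + I t \<omega> \<cdot>\<^sub>v vec_last ?gain m"
    by (simp del: index_mult_mat_vec)
  also have "F *\<^sub>v ?loop t = F *\<^sub>v s + F *\<^sub>v ?ch"
    unfolding IH xs(3) vec_last_append[OF xs(2)] by (rule mult_add_distrib_mat_vec[OF F xs(2) ch_state_carrier])
  finally have 1: "?loop (Suc t) = F *\<^sub>v s + F *\<^sub>v ?ch + I t \<omega> \<cdot>\<^sub>v vec_last ?gain m" .
  have "kf_est F G H A C (\<lambda>i. Y i \<omega>) (Suc t) =
      (A *\<^sub>v x @\<^sub>v (F *\<^sub>v s + rhat t \<omega> \<cdot>\<^sub>v col G 0)) + I t \<omega> \<cdot>\<^sub>v ?gain"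
    by (simp add: xs(3) AA_mult_append[OF xs(1,2)] CC_mult_append[OF xs(1,2)] xs(4,5) I_def inn_def
        del: index_mult_mat_vec)
  then have "vec_last (kf_est F G H A C (\<lambda>i. Y i \<omega>) (Suc t)) m =
      (F *\<^sub>v s + rhat t \<omega> \<cdot>\<^sub>v col G 0) + I t \<omega> \<cdot>\<^sub>v vec_last ?gain m"
    by (simp only:) (subst vec_last_add_smult,
        auto simp: gain intro!: vec_last_append carrier_vecI arg_cong2[of _ _ _ _ "(+)"])
  \<comment> \<open>The term \<open>rhat t \<omega> \<cdot>\<^sub>v col G 0\<close> of the filter
    cancels against the input \<open>- rhat t\<close> of the channel response.\<close>
  then show ?case
    unfolding 1 by (intro eq_vecI) (auto simp del: index_mult_mat_vec)
qed

lemma innov_eq: "t \<le> T \<Longrightarrow> innov M F G H A C W N T t \<omega> = I t \<omega>"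
  by (intro innov_eq_if loop_est_eq) auto

lemma innov_second_moment: "t \<le> T \<Longrightarrow> (\<integral>\<omega>. (innov M F G H A C W N T t \<omega>)\<^sup>2 \<partial>M) = K t"
  using ip_I_I[of t] by (simp add: innov_eq ip_def power2_eq_square)

text \<open>The innovations are centred and mutually orthogonal, so the covariance matrix is
  diagonal.\<close>

lemma det_cov_innov: "det (cov_mat M (T + 1) (innov M F G H A C W N T)) = (\<Prod>t<Suc T. K t)"
proof -
  let ?e = "innov M F G H A C W N T" and ?S = "cov_mat M (T + 1) (innov M F G H A C W N T)"
  have e: "?e i = I i" if "i \<le> T" for i using innov_eq[OF that] by auto
  have S: "?S $$ (i, j) = (if i = j then K i else 0)" if "i \<le> T" "j \<le> T" for i j
  proof -
    have "?S $$ (i, j) = ip (I i) (I j)"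
      using that by (simp add: cov_mat_def e mean_I ip_def)
    also have "\<dots> = (if i = j then K i else 0)"
      using ip_I_I_0[of i j] ip_I_I_0[of j i] ip_commute[of "I i" "I j"]
      by (cases i j rule: linorder_cases) (auto simp: ip_I_I)
    finally show ?thesis .
  qed
  have c: "?S \<in> carrier_mat (Suc T) (Suc T)" by (simp add: cov_mat_def)
  have "upper_triangular ?S"
    unfolding upper_triangular_def using c S by auto
  then have "det ?S = prod_list (diag_mat ?S)" using c by (rule det_upper_triangular)
  also have "\<dots> = (\<Prod>t<Suc T. ?S $$ (t, t))"
    using c by (simp add: prod_list_diag_prod atLeast0LessThan)
  also have "\<dots> = (\<Prod>t<Suc T. K t)"
  proof (rule prod.cong[OF refl])
    fix t assume "t \<in> {..<Suc T}"
    then show "?S $$ (t, t) = K t" using S[of t t] by auto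
  qed
  finally show ?thesis .
qed

lemma trace_CMMSE: "mat_trace (CMMSE M F G H A C W N T) = (\<Sum>t\<le>T. pred_power t)"
proof -
  have "(\<lambda>t \<omega>. src_proc A C W t \<omega> - src_est F G H A C W N t \<omega>) = (\<lambda>t. err t (r t))"
    by (auto simp: fun_eq_iff err_r src_est_eq)
  then have "mat_trace (CMMSE M F G H A C W N T) = (\<Sum>t<T + 1. ip (err t (r t)) (err t (r t)))"
    unfolding mat_trace_def CMMSE_def by (simp add: cov_mat_def mean_err ip_def)
  then show ?thesis by (simp add: ip_err_err pred_power_def lessThan_Suc_atMost)
qed

lemma info_eq:
  "mutual_information 2 (lborel_pow (Suc n)) (lborel_pow (Suc T)) (rvec {..<Suc n} W)
     (rvec {..<Suc T} (opt_out M F G H A C W N T)) = 1 / 2 * (\<Sum>t<Suc T. log 2 (K t))"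
proof -
  obtain c where "\<And>t \<omega>. t < Suc T \<Longrightarrow> y (opt T) t \<omega> = Y t \<omega> + (\<Sum>s<t. c t s * Y s \<omega>)"
    using unit_tri_coeffs[OF unit_tri_y_Y] by blast
  then show ?thesis unfolding opt_out_def by (rule mutual_information_W)
qed

lemma log_prod_K: "log 2 (\<Prod>t<k. K t) = (\<Sum>t<k. log 2 (K t))"
  unfolding log_def by (subst ln_prod) (auto simp: sum_divide_distrib)

end

theorem proposition3:
  fixes M :: "'a measure" and W N :: "nat \<Rightarrow> 'a \<Rightarrow> real"
    and n T m :: nat and A C F G H :: "real mat" and num den :: "real poly"
  assumes "prob_space M"
    and "distributed M (Pi\<^sub>M {..n} (\<lambda>_. lborel)) (rvec {..n} W)
           (\<lambda>w. ennreal (\<Prod>i\<le>n. std_normal_density (w i)))"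
    and "prob_space.indep_vars M (\<lambda>_. borel) N UNIV"
    and "\<forall>t. distributed M lborel (N t) std_normal_density"
    and "prob_space.indep_var M (Pi\<^sub>M {..n} (\<lambda>_. borel)) (rvec {..n} W)
           (Pi\<^sub>M UNIV (\<lambda>_. borel)) (rvec UNIV N)"
    and "channel_model num den m F G H"
    and "admissible n F A C"
    and "n \<le> T"
  shows "(let
      e = innov M F G H A C W N T;
      ybar = nofb_out_proc F G H A C W N;
      MMSE = (\<lambda>I. mmse_mat M (n + 1) W I ybar);
      \<Sigma> = kf_cov F G H A C;
      info = prob_space.mutual_information M 2 (Pi\<^sub>M {..n} (\<lambda>_. lborel)) (Pi\<^sub>M {..T} (\<lambda>_. lborel))
               (rvec {..n} W) (rvec {..T} (opt_out M F G H A C W N T));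
      P = opt_power M F G H A C W N T
    in
      (info = 1 / 2 * log 2 (det (cov_mat M (T + 1) e)) \<and>
       info = 1 / 2 * (\<Sum>t\<le>T. log 2 (integral\<^sup>L M (\<lambda>\<omega>. (e t \<omega>)\<^sup>2))) \<and>
       info = 1 / 2 * (\<Sum>t\<le>T. log 2 ((CC H C * \<Sigma> t * (CC H C)\<^sup>T) $$ (0, 0) + 1)) \<and>
       info = 1 / 2 * log 2 (det (mat_inv (MMSE {..T}))) \<and>
       info = 1 / 2 * log 2 (det (fisher_mat M T n ybar W)) \<and>
       info = 1 / 2 * log 2 (det (mat_inv (crb_mat M T n ybar W)))) \<and>
      (P = 1 / real (T + 1) * (\<Sum>t\<le>T. (DD F C * \<Sigma> t * (DD F C)\<^sup>T) $$ (0, 0)) \<and>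
       P = 1 / real (T + 1) * mat_trace (CMMSE M F G H A C W N T) \<and>
       P = 1 / real (T + 1) *
             (\<Sum>t\<le>T. (C * A ^\<^sub>m t * MMSE {..<t} * (A ^\<^sub>m t)\<^sup>T * C\<^sup>T) $$ (0, 0))))"
proof -
  interpret prob_space M by fact
  have carriers: "A \<in> carrier_mat (Suc n) (Suc n)" "C \<in> carrier_mat 1 (Suc n)"
      "F \<in> carrier_mat m m" "G \<in> carrier_mat m 1" "H \<in> carrier_mat 1 m"
    using assms(6,7) by (auto simp: channel_model_def minimal_realization_def realizes_def admissible_def)
  \<comment> \<open>The development uses half-open index sets so that zero observations need no
    special treatment; these equations convert the closed ranges \<open>{..n}\<close> and
    \<open>{..T}\<close>.\<close>
  note Suc_simps = lessThan_Suc_atMost[symmetric] Suc_eq_plus1[symmetric]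
  interpret coding_setup n m F G H A C M W N
    by standard (use carriers assms(2-5) in \<open>auto simp: Suc_simps simp del: prod.lessThan_Suc\<close>)
  let ?L = "\<Sum>t<Suc T. log 2 (K t)"
  let ?e = "innov M F G H A C W N T"
  have dets: "det (cov_mat M (Suc T) ?e) = (\<Prod>t<Suc T. K t)" "det (J (Suc T)) = (\<Prod>t<Suc T. K t)"
    using det_cov_innov[of T] det_J[of "Suc T"] by (simp_all only: Suc_eq_plus1)
  have second: "(\<Sum>t<Suc T. log 2 (\<integral>\<omega>. (?e t \<omega>)\<^sup>2 \<partial>M)) = ?L"
    by (intro sum.cong refl) (simp add: innov_second_moment)
  \<comment> \<open>With \<open>{..T}\<close> read as \<open>{..<Suc T}\<close>, the error matrix
    and the Cramer-Rao bound are both \<open>P (Suc T)\<close> with inverse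
    \<open>J (Suc T)\<close>, whereas the power at time \<open>t\<close> meets \<open>P t\<close>
    through \<open>{..<t}\<close>.\<close>
  show ?thesis
    unfolding Let_def Suc_simps nofb_out_eq mmse_mat_eq fisher_mat_eq crb_mat_def inverse_matrices
      info_eq CC_kf_cov DD_kf_cov pow_P_quadratic opt_power_eq trace_CMMSE dets log_prod_K second
    by (simp add: pred_power_def Suc_simps del: sum.lessThan_Suc)
qed

end
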